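(* Let $n\ge2$, $\omega\in\mathbf{C}^n$, $R_\omega>0$, and let $\zeta\in B(\omega,R_\omega)$ be a regular root of an analytic system $f=(f_1,\dots,f_n)\in(\mathbf{A}^2(\omega,R_\omega))^n$ (that is, $f(\zeta)=0$ and $Df(\zeta)$ is invertible). Let $\gamma=\gamma(f,\zeta)$ and $\kappa=\kappa_\zeta$ be as defined in the context. Then for every $x$ such that $$u:=\kappa\,\|x-\zeta\|<\frac{2\gamma+1-\sqrt{4\gamma^2+3\gamma}}{\gamma+1}$$ the Newton sequence $x_0=x$, $x_{k+1}=N_f(x_k)$, $k\ge0$, converges quadratically to $\zeta$. More precisely, $$\|x_k-\zeta\|\le\Big(\frac12\Big)^{2^k-1}\|x-\zeta\|,\qquad k\ge0.$$
   Context: $N_f(x)=x-Df(x)^{-1}f(x)$ is the Newton operator. Balls are open Euclidean balls in $\mathbf{C}^n$. $\mathbf{A}^2(\omega,R_\omega)$ is the Hilbert space of analytic square-integrable functions on $B(\omega,R_\omega)$ with inner product $\langle f,g\rangle=\frac{c_n}{R_\omega^{2n}}\int_{B(\omega,R_\omega)}f(z)\overline{g(z)}\,dz$, $c_n=n!/\pi^n$; on $(\mathbf{A}^2(\omega,R_\omega))^n$ the norm is $\|f\|=(\sum_i\|f_i\|^2)^{1/2}$. Matrix norms are operator norms. With $\nu_\zeta=\|\zeta-\omega\|/R_\omega$: $\lambda(f,\zeta)=\|f\|/(1-\nu_\zeta^2)^{\frac{n+1}{2}}$, $\kappa_\zeta=\max\Big(1,\frac{n+1}{R_\omega(1-\nu_\zeta^2)}\Big)$,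 $\mu(f,\zeta)=\|Df(\zeta)^{-1}\|$, and $\gamma(f,\zeta)=\max\big(1,\lambda(f,\zeta)\,\kappa_\zeta\,\mu(f,\zeta)\big)$. *)

theory Defs
  imports "HOL-Analysis.Analysis"
begin

(* Analyticity in several complex variables, in the style of the library's holomorphic_on:
   at each point of the open set S the Frechet derivative exists and is C-linear. *)
definition cvec_analytic_on :: "(complex^'n \<Rightarrow> complex) \<Rightarrow> (complex^'n) set \<Rightarrow> bool"
  where "cvec_analytic_on f S \<longleftrightarrow>
    open S \<and>
    (\<forall>z\<in>S. \<exists>L. (f has_derivative L) (at z) \<and> (\<forall>c v. L (c *s v) = c * L v))"

(* Elements of A^2(\<omega>,R) are represented by total functions; everything below
   depends only on their values on the ball. *)
definition bergman_space :: "complex^'n \<Rightarrow> real \<Rightarrow> (complex^'n \<Rightarrow> complex) set"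
  where "bergman_space \<omega> R =
    {f. cvec_analytic_on f (ball \<omega> R) \<and>
        set_integrable lborel (ball \<omega> R) (\<lambda>z. (cmod (f z))\<^sup>2)}"

definition bergman_inner ::
    "complex^'n \<Rightarrow> real \<Rightarrow> (complex^'n \<Rightarrow> complex) \<Rightarrow> (complex^'n \<Rightarrow> complex) \<Rightarrow> complex"
  where "bergman_inner \<omega> R f g =
    complex_of_real ((fact CARD('n) / pi ^ CARD('n)) / R ^ (2 * CARD('n))) *
    (LINT z:ball \<omega> R|lborel. f z * cnj (g z))"

definition bergman_norm :: "complex^'n \<Rightarrow> real \<Rightarrow> (complex^'n \<Rightarrow> complex) \<Rightarrow> real"
  where "bergman_norm \<omega> R f = sqrt (Re (bergman_inner \<omega> R f f))"

definition bergman_systems :: "complex^'n \<Rightarrow> real \<Rightarrow> (complex^'n \<Rightarrow> complex^'n) set"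
  where "bergman_systems \<omega> R = {f. \<forall>i. (\<lambda>z. f z $ i) \<in> bergman_space \<omega> R}"

definition system_norm :: "complex^'n \<Rightarrow> real \<Rightarrow> (complex^'n \<Rightarrow> complex^'n) \<Rightarrow> real"
  where "system_norm \<omega> R f = sqrt (\<Sum>i\<in>UNIV. (bergman_norm \<omega> R (\<lambda>z. f z $ i))\<^sup>2)"

(* The Frechet derivative is C-linear at points of analyticity, so its complex matrix
   represents it there. *)
definition Dmat :: "(complex^'n \<Rightarrow> complex^'n) \<Rightarrow> complex^'n \<Rightarrow> complex^'n^'n"
  where "Dmat f z = matrix (frechet_derivative f (at z))"

(* Meaningful only where f is differentiable with invertible derivative. *)
definition newton_op :: "(complex^'n \<Rightarrow> complex^'n) \<Rightarrow> complex^'n \<Rightarrow> complex^'n"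
  where "newton_op f x = x - matrix_inv (Dmat f x) *v f x"

definition nu_at :: "complex^'n \<Rightarrow> real \<Rightarrow> complex^'n \<Rightarrow> real"
  where "nu_at \<omega> R \<zeta> = norm (\<zeta> - \<omega>) / R"

definition lambda_at :: "complex^'n \<Rightarrow> real \<Rightarrow> (complex^'n \<Rightarrow> complex^'n) \<Rightarrow> complex^'n \<Rightarrow> real"
  where "lambda_at \<omega> R f \<zeta> =
    system_norm \<omega> R f / (1 - (nu_at \<omega> R \<zeta>)\<^sup>2) powr ((real CARD('n) + 1) / 2)"

definition kappa_at :: "complex^'n \<Rightarrow> real \<Rightarrow> complex^'n \<Rightarrow> real"
  where "kappa_at \<omega> R \<zeta> =
    max 1 ((real CARD('n) + 1) / (R * (1 - (nu_at \<omega> R \<zeta>)\<^sup>2)))"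

definition mu_at :: "(complex^'n \<Rightarrow> complex^'n) \<Rightarrow> complex^'n \<Rightarrow> real"
  where "mu_at f \<zeta> = onorm (\<lambda>v. matrix_inv (Dmat f \<zeta>) *v v)"

definition gamma_at :: "complex^'n \<Rightarrow> real \<Rightarrow> (complex^'n \<Rightarrow> complex^'n) \<Rightarrow> complex^'n \<Rightarrow> real"
  where "gamma_at \<omega> R f \<zeta> =
    max 1 (lambda_at \<omega> R f \<zeta> * kappa_at \<omega> R \<zeta> * mu_at f \<zeta>)"

end

theory Submission
  imports Defs "HOL-Complex_Analysis.Complex_Analysis" "HOL-Probability.Sinc_Integral"
begin

text \<open>On the unit ball put \<open>N = n + 1\<close> and write \<open>\<langle>z, w\<rangle>\<close> for the Hermitian product. The homogeneous
  part \<open>P\<close> of degree \<open>m\<close> of a function that is analytic on the ball satisfies the Fock space identity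
  \<open>\<integral> P(w) exp \<langle>z, w\<rangle> exp (-|w|\<^sup>2) dw = \<pi>\<^sup>n P(z)\<close>: translate by \<open>z\<close> and apply the mean value property.
  A layer cake argument turns it into \<open>\<integral> P(w) \<langle>z, w\<rangle>\<^sup>m dw = \<pi>\<^sup>n m! / (n + m)! P(z)\<close> over the ball, and
  summation over \<open>m\<close> gives the reproducing kernel \<open>(1 - \<langle>z, w\<rangle>)\<^sup>-\<^sup>N\<close>. Cauchy-Schwarz against the
  derivatives of the kernel, whose norms are again given by the reproducing property, bounds the
  first and second derivatives at every point.

  Since \<open>\<Sum>k \<gamma> u\<^sup>k\<^sup>-\<^sup>1\<close> over \<open>k \<ge> 2\<close> is \<open>\<gamma> (1/(1 - u)\<^sup>2 - 1)\<close>, the stated radius is the one for which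
  Taylor coefficients at \<open>\<zeta>\<close> bounded by \<open>\<lambda> \<kappa>\<^sup>k\<close> make Newton's method contract by \<open>1/2\<close>. For \<open>n = 2\<close>
  the coefficient of order 2 does not obey this bound in general; it does only because \<open>f(\<zeta>) = 0\<close>.
  Therefore \<open>|D\<^sup>2f(z)| \<le> 2 \<lambda> \<kappa>\<^sup>2 / (1 - \<kappa> |z - \<zeta>|)\<^sup>3\<close> is proved for \<open>z\<close> near \<open>\<zeta>\<close>, after subtracting a
  multiple of the small number \<open>f(z)\<close>, and integrated along the segment from \<open>\<zeta>\<close> to \<open>x\<close>.\<close>

subsection \<open>Rotation invariance and circle averages\<close>

text \<open>The Fock identity needs functions on the whole space, while \<open>f\<close> lives on
  the ball only. Homogeneous parts bridge this: each extends to all of C^n, and Gaussian and ball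
  integrals can be compared degree by degree. Only scalar rotations \<open>circ t *s w\<close> are
  ever averaged, so neither monomial bases nor integrals over spheres occur. Why the correction by
  f(z) is forced: with \<delta> = 1 - |z|^2, the representing function of the second derivative in a
  unit direction has squared norm close to N(N+1)(N+2)(N+3) / \<delta>^(N+4) when |z| is near 1,
  while the target is 4 N^4 / \<delta>^(N+4). For N = 3 this is 360 against 324. Projecting onto the
  functions that vanish at z replaces (N+2)(N+3) by (N+2)(N+3) - N(N+1) = 4N+6, giving 216, and the
  gap pays for the term with f(z). The stated radius is the smaller root of (1+\<gamma>)(1-u)^2 -
  \<gamma> = 2\<gamma>u and equals 1/(2\<gamma>+1+sqrt(4\<gamma>^2+3\<gamma>)). It is largest at
  \<gamma> = 1, where it is (3 - sqrt 7)/2 < 178/1000; the estimates along segments rest on this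
  number.\<close>

lemma nn_integral_lborel_shift:
  fixes a :: "'a::euclidean_space"
  assumes [measurable]: "g \<in> borel_measurable borel"
  shows "(\<integral>\<^sup>+x. g (a + x) \<partial>lborel) = (\<integral>\<^sup>+x. g x \<partial>lborel)"
proof -
  have "(\<integral>\<^sup>+x. g x \<partial>lborel) = (\<integral>\<^sup>+x. g x \<partial>distr lborel borel ((+) a))"
    by (simp add: lborel_distr_plus)
  also have "\<dots> = (\<integral>\<^sup>+x. g (a + x) \<partial>lborel)"
    by (rule nn_integral_distr) auto
  finally show ?thesis ..
qed

text \<open>The uniqueness argument for Haar measure: integrate \<open>1\<^sub>A(T x) 1\<^sub>B(y - T x)\<close> over the product
  in both orders, where \<open>B\<close> is the unit ball, whose measure is preserved by \<open>T\<close>.\<close>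

lemma lborel_distr_isometry:
  fixes T :: "'a::euclidean_space \<Rightarrow> 'a"
  assumes lin: "linear T" and iso: "\<And>x. norm (T x) = norm x"
  shows "distr lborel borel T = lborel"
proof (rule measure_eqI)
  show "sets (distr lborel borel T) = sets lborel" by simp
next
  fix A assume "A \<in> sets (distr lborel borel T)"
  hence A [measurable]: "A \<in> sets borel" by simp
  have [measurable]: "T \<in> borel_measurable borel"
    using linear_continuous_on[of T UNIV] lin
    by (simp add: borel_measurable_continuous_onI linear_conv_bounded_linear)
  have "inj T"
    using lin iso by (metis linear_injective_0 norm_eq_zero)
  hence "surj T" by (rule linear_injective_imp_surjective[OF lin]) simp
  then obtain S where S: "\<And>y. T (S y) = y" by (metis surjD)
  let ?B = "ball (0::'a) 1"
  have "unit_ball_vol (real DIM('a)) \<noteq> 0"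
    using unit_ball_vol_pos[OF of_nat_0_le_iff[of "DIM('a)"]] by linarith
  hence cB: "emeasure lborel ?B \<noteq> 0" "emeasure lborel ?B \<noteq> \<infinity>"
    by (simp_all add: emeasure_ball)
  define a :: "'a \<Rightarrow> ennreal" where "a = indicator A"
  define b :: "'a \<Rightarrow> ennreal" where "b = indicator ?B"
  have [measurable]: "a \<in> borel_measurable borel" "b \<in> borel_measurable borel"
    unfolding a_def b_def by (intro borel_measurable_indicator; simp)+
  have ia: "(\<integral>\<^sup>+x. a x \<partial>lborel) = emeasure lborel A" and ib: "(\<integral>\<^sup>+x. b x \<partial>lborel) = emeasure lborel ?B"
    by (simp_all add: a_def b_def)
  have e1: "(\<integral>\<^sup>+y. b (y - c) \<partial>lborel) = emeasure lborel ?B" for c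
    using nn_integral_lborel_shift[of b "- c"] by (simp add: ib)
  have e2: "(\<integral>\<^sup>+y. a (c + y) \<partial>lborel) = emeasure lborel A" for c
    using nn_integral_lborel_shift[of a c] by (simp add: ia)
  have e3: "b (- T x) = b x" for x
    by (simp add: b_def indicator_def iso)
  have "emeasure (distr lborel borel T) A * emeasure lborel ?B
      = (\<integral>\<^sup>+x. a (T x) \<partial>lborel) * emeasure lborel ?B"
    using nn_integral_distr[of T lborel borel a] by (simp add: a_def)
  also have "\<dots> = (\<integral>\<^sup>+x. a (T x) * (\<integral>\<^sup>+y. b (y - T x) \<partial>lborel) \<partial>lborel)"
    by (simp add: e1 nn_integral_multc)
  also have "\<dots> = (\<integral>\<^sup>+x. (\<integral>\<^sup>+y. a (T x) * b (y - T x) \<partial>lborel) \<partial>lborel)"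
    by (intro nn_integral_cong nn_integral_cmult[symmetric]) measurable
  also have "\<dots> = (\<integral>\<^sup>+y. (\<integral>\<^sup>+x. a (T x) * b (y - T x) \<partial>lborel) \<partial>lborel)"
    by (rule lborel_pair.Fubini'[symmetric]) measurable
  \<comment> \<open>Translating the inner variable by a preimage \<open>S y\<close> of
    \<open>y\<close> moves the dependence on \<open>y\<close> from \<open>b\<close> to
    \<open>a\<close>.\<close>
  also have "\<dots> = (\<integral>\<^sup>+y. (\<integral>\<^sup>+x. a (T x + y) * b (- T x) \<partial>lborel) \<partial>lborel)"
  proof (rule nn_integral_cong)
    fix y
    have "T (S y + x) = T x + y" for x using linear_add[OF lin] S by simp
    thus "(\<integral>\<^sup>+x. a (T x) * b (y - T x) \<partial>lborel)
        = (\<integral>\<^sup>+x. a (T x + y) * b (- T x) \<partial>lborel)"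
      using nn_integral_lborel_shift[of "\<lambda>x. a (T x) * b (y - T x)" "S y"]
      by simp
  qed
  also have "\<dots> = (\<integral>\<^sup>+x. (\<integral>\<^sup>+y. a (T x + y) * b (- T x) \<partial>lborel) \<partial>lborel)"
    by (rule lborel_pair.Fubini') measurable
  also have "\<dots> = (\<integral>\<^sup>+x. emeasure lborel A * b x \<partial>lborel)"
    by (simp add: nn_integral_multc e2 e3)
  also have "\<dots> = emeasure lborel A * emeasure lborel ?B"
    by (simp add: nn_integral_cmult ib)
  finally show "emeasure (distr lborel borel T) A = emeasure lborel A"
    using cB by (metis ennreal_mult_divide_eq infinity_ennreal_def)
qed

section \<open>Scalar rotations of C^n and averages over them\<close>

lemma norm_vector_smult: "norm (c *s x) = cmod c * norm (x :: complex^'n)"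
  by (simp add: norm_vec_def norm_mult L2_set_right_distrib)

lemma continuous_on_vector_smult [continuous_intros]:
  fixes g :: "'a::topological_space \<Rightarrow> complex^'n"
  assumes "continuous_on S c" "continuous_on S g"
  shows "continuous_on S (\<lambda>x. c x *s g x)"
  unfolding vector_scalar_mult_def by (intro continuous_intros assms)

lemma borel_measurable_vector_smult [measurable]:
  assumes "c \<in> borel_measurable M" "g \<in> borel_measurable M"
  shows "(\<lambda>x. c x *s (g x :: complex^'n)) \<in> borel_measurable M"
proof -
  have "continuous_on UNIV (\<lambda>p :: complex \<times> (complex^'n). fst p *s snd p)"
    by (intro continuous_intros)
  hence "(\<lambda>p :: complex \<times> (complex^'n). fst p *s snd p) \<in> borel_measurable borel"
    by (rule borel_measurable_continuous_onI)
  from measurable_compose[OF borel_measurable_Pair[OF assms] this] show ?thesis by simp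
qed

lemma lborel_distr_vector_smult:
  assumes "cmod c = 1"
  shows "distr lborel borel ((*s) c) = (lborel :: (complex^'n) measure)"
proof (rule lborel_distr_isometry)
  show "linear ((*s) c :: complex^'n \<Rightarrow> complex^'n)"
    by (rule linearI) (simp_all add: vector_add_ldistrib vec_eq_iff algebra_simps)
qed (simp add: norm_vector_smult assms)

text \<open>Period 1, so that a circle average is the plain integral over \<open>{0..1}\<close>, in
  the parametrization of \<open>circlepath 0 1\<close>.\<close>

definition circ :: "real \<Rightarrow> complex" where "circ t = exp (2 * of_real pi * \<i> * of_real t)"

lemma cmod_circ [simp]: "cmod (circ t) = 1"
  by (simp add: circ_def norm_exp_eq_Re)

lemma circ_nz [simp]: "circ t \<noteq> 0"
  by (simp add: circ_def)

lemma continuous_on_circ [continuous_intros]: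
  "continuous_on S g \<Longrightarrow> continuous_on S (\<lambda>x. circ (g x))"
  unfolding circ_def by (intro continuous_intros)

lemma circ_measurable [measurable]: "circ \<in> borel_measurable borel"
  by (intro borel_measurable_continuous_onI continuous_intros)

lemma cnj_circ: "cnj (circ t) = inverse (circ t)"
  by (metis cmod_circ complex_norm_square inverse_unique mult.commute of_real_1 power_one)

text \<open>Every rotation preserves Lebesgue measure, so each \<open>t\<close> contributes the same
  integral, and Fubini moves the average inside. Continuity in \<open>t\<close> turns the inner
  Lebesgue integral into the gauge integral used for contour integrals.\<close>

lemma integral_circle_average:
  fixes g :: "complex^'n \<Rightarrow> complex"
  assumes int: "integrable lborel g"
    and cont: "\<And>w. continuous_on {0..1} (\<lambda>t. g (circ t *s w))"
  shows "integral\<^sup>L lborel g = (LINT w|lborel. integral {0..1} (\<lambda>t. g (circ t *s w)))"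
proof -
  have [measurable]: "g \<in> borel_measurable borel" using int by auto
  let ?h = "\<lambda>t w. indicator {0..1::real} t *\<^sub>R g (circ t *s w)"
  have rot_int: "integrable lborel (\<lambda>w. g (circ t *s w))" for t
    using int integrable_distr_eq[of "(*s) (circ t)" lborel borel g]
    by (simp add: lborel_distr_vector_smult)
  have rot: "(LINT w|lborel. g (circ t *s w)) = integral\<^sup>L lborel g" for t
    by (subst (2) lborel_distr_vector_smult[of "circ t", symmetric]) (auto simp: integral_distr)
  have rotn: "(LINT w|lborel. norm (g (circ t *s w))) = (LINT w|lborel. norm (g w))" for t
    by (subst (2) lborel_distr_vector_smult[of "circ t", symmetric]) (auto simp: integral_distr)
  have int2: "integrable (lborel \<Otimes>\<^sub>M lborel) (case_prod ?h)"
  proof (rule lborel_pair.Fubini_integrable)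
    have "(\<lambda>t. LINT w|lborel. norm (?h t w)) = (\<lambda>t. indicator {0..1} t *\<^sub>R (LINT w|lborel. norm (g w)))"
      by (auto simp: fun_eq_iff rotn)
    thus "integrable lborel (\<lambda>x. \<integral>y. norm (case (x, y) of (x, y) \<Rightarrow> ?h x y) \<partial>lborel)"
      by simp
  qed (use rot_int in \<open>auto\<close>)
  have inner: "(LINT t|lborel. ?h t w) = integral {0..1} (\<lambda>t. g (circ t *s w))" for w
    using set_borel_integral_eq_integral(2)[OF borel_integrable_compact[OF compact_Icc cont[of w], folded set_integrable_def]]
    unfolding set_lebesgue_integral_def by simp
  have "integral\<^sup>L lborel g = (LINT t|lborel. (LINT w|lborel. ?h t w))"
    by (simp add: rot)
  also have "\<dots> = (LINT w|lborel. (LINT t|lborel. ?h t w))"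
    by (rule lborel_pair.Fubini_integral[OF int2, symmetric])
  finally show ?thesis
    by (simp add: inner)
qed

text \<open>Cauchy's formula for derivatives on the unit circle, the velocity of the circle
  cancelling one factor of the denominator. The case \<open>m = 0\<close> is the mean value
  property.\<close>

lemma circle_average_coeff:
  assumes hol: "\<phi> holomorphic_on ball 0 \<rho>" and "\<rho> > 1"
  shows "integral {0..1} (\<lambda>t. \<phi> (circ t) / circ t ^ m) = (deriv ^^ m) \<phi> 0 / fact m"
proof -
  have sub: "cball 0 1 \<subseteq> ball (0::complex) \<rho>" using assms by auto
  have "((\<lambda>u. \<phi> u / (u-0) ^ (Suc m)) has_contour_integral ((2 * pi * \<i>) / (fact m) * (deriv ^^ m) \<phi> 0))
           (circlepath 0 1)"
  proof (rule Cauchy_has_contour_integral_higher_derivative_circlepath)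
    show "continuous_on (cball 0 1) \<phi>"
      using hol holomorphic_on_imp_continuous_on continuous_on_subset sub by blast
    show "\<phi> holomorphic_on ball 0 1"
      using hol sub holomorphic_on_subset ball_subset_cball by blast
  qed simp
  hence "((\<lambda>t. \<phi> (circ t) / circ t ^ Suc m * (2 * pi * \<i> * circ t)) has_integral
      ((2 * pi * \<i>) / (fact m) * (deriv ^^ m) \<phi> 0)) {0..1}"
    unfolding has_contour_integral_def
    by (subst (asm) has_integral_cong[where g="\<lambda>t. \<phi> (circ t) / circ t ^ Suc m * (2 * pi * \<i> * circ t)"])
       (simp_all only: vector_derivative_circlepath01 atLeastAtMost_iff, simp_all add: circlepath circ_def)
  from has_integral_mult_right[OF this, of "1 / (2 * pi * \<i>)"]
  have "((\<lambda>t. \<phi> (circ t) / circ t ^ m) has_integral ((deriv ^^ m) \<phi> 0 / fact m)) {0..1}"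
    by (simp add: field_simps)
  thus ?thesis by (rule integral_unique)
qed

text \<open>Conjugate linear in the second argument; the real inner product of the type is its real
  part.\<close>

definition herm :: "complex^'n \<Rightarrow> complex^'n \<Rightarrow> complex"
  where "herm z w = (\<Sum>i\<in>UNIV. z $ i * cnj (w $ i))"

lemma herm_add_left: "herm (x + y) z = herm x z + herm y z"
  by (simp add: herm_def algebra_simps sum.distrib)

lemma herm_add_right: "herm z (x + y) = herm z x + herm z y"
  by (simp add: herm_def algebra_simps sum.distrib)

lemma herm_smult_left: "herm (c *s x) z = c * herm x z"
  by (simp add: herm_def algebra_simps sum_distrib_left)

lemma herm_smult_right: "herm z (c *s x) = cnj c * herm z x"
  by (simp add: herm_def algebra_simps sum_distrib_left)

lemma herm_scaleR_left: "herm (r *\<^sub>R x) z = of_real r * herm x z"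
  by (simp add: herm_def scaleR_conv_of_real[where 'a=complex] algebra_simps sum_distrib_left)

lemma herm_scaleR_right: "herm z (r *\<^sub>R x) = of_real r * herm z x"
  by (simp add: herm_def scaleR_conv_of_real[where 'a=complex] algebra_simps sum_distrib_left)

lemma cnj_herm: "cnj (herm z w) = herm w z"
  by (simp add: herm_def mult.commute)

lemma herm_zero_left [simp]: "herm 0 z = 0"
  by (simp add: herm_def)

lemma norm_vec_power2: "(norm (z :: complex^'n))\<^sup>2 = (\<Sum>i\<in>UNIV. (cmod (z $ i))\<^sup>2)"
  by (simp add: norm_vec_def L2_set_def sum_nonneg)

lemma herm_self: "herm z z = of_real ((norm z)\<^sup>2)"
  unfolding herm_def norm_vec_power2 of_real_sum by (intro sum.cong) (simp_all add: complex_norm_square[symmetric])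

lemma norm_herm_le: "cmod (herm z w) \<le> norm z * norm w"
proof -
  have "cmod (herm z w) \<le> (\<Sum>i\<in>UNIV. \<bar>cmod (z $ i)\<bar> * \<bar>cmod (w $ i)\<bar>)"
    unfolding herm_def by (rule order_trans[OF norm_sum]) (simp add: norm_mult)
  also have "\<dots> \<le> norm z * norm w"
    unfolding norm_vec_def by (rule L2_set_mult_ineq)
  finally show ?thesis .
qed

lemma continuous_on_herm [continuous_intros]:
  fixes f g :: "'a::topological_space \<Rightarrow> complex^'n"
  assumes "continuous_on S f" "continuous_on S g"
  shows "continuous_on S (\<lambda>x. herm (f x) (g x))"
  unfolding herm_def by (intro continuous_intros assms)

lemma borel_measurable_herm [measurable]:
  assumes "f \<in> borel_measurable M" "g \<in> borel_measurable M"
  shows "(\<lambda>x. herm (f x) (g x :: complex^'n)) \<in> borel_measurable M"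
proof -
  have "continuous_on UNIV (\<lambda>p :: (complex^'n) \<times> (complex^'n). herm (fst p) (snd p))"
    by (intro continuous_intros)
  hence "(\<lambda>p :: (complex^'n) \<times> (complex^'n). herm (fst p) (snd p)) \<in> borel_measurable borel"
    by (rule borel_measurable_continuous_onI)
  from measurable_compose[OF borel_measurable_Pair[OF assms] this] show ?thesis by simp
qed

lemma scaleR_eq_vector_smult: "r *\<^sub>R x = of_real r *s (x :: complex^'n)"
  by (simp add: vec_eq_iff scaleR_conv_of_real[where 'a=complex])

subsection \<open>Homogeneous parts\<close>

lemma cvec_analytic_on_continuous:
  assumes "cvec_analytic_on f S" shows "continuous_on S f"
  using assms unfolding cvec_analytic_on_def
  by (meson continuous_at_imp_continuous_on has_derivative_continuous)

text \<open>A C-linear derivative \<open>L\<close> acts on the line as multiplication by the number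
  \<open>L v\<close>, which is a complex derivative in one variable. One-variable theory reaches
  \<open>f\<close> only through such lines.\<close>

lemma cvec_analytic_on_line:
  assumes f: "cvec_analytic_on f S"
  shows "(\<lambda>\<tau>. f (z + \<tau> *s v)) holomorphic_on {\<tau>. z + \<tau> *s v \<in> S}"
proof (rule holomorphic_onI)
  fix \<tau> assume "\<tau> \<in> {\<tau>. z + \<tau> *s v \<in> S}"
  with f obtain L where L: "(f has_derivative L) (at (z + \<tau> *s v))"
     and hom: "\<And>c v. L (c *s v) = c * L v"
    unfolding cvec_analytic_on_def by blast
  have "((\<lambda>\<tau>. \<tau> *s v) has_derivative (\<lambda>h. h *s v)) (at \<tau>)"
    by (rule bounded_linear_imp_has_derivative, rule bounded_linear_intro[of _ "norm v"])
       (simp_all add: vec_eq_iff algebra_simps norm_vector_smult)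
  hence "((\<lambda>\<tau>. z + \<tau> *s v) has_derivative (\<lambda>h. h *s v)) (at \<tau>)"
    by (auto intro: derivative_eq_intros)
  from diff_chain_at[OF this, of f L] L
  have "((\<lambda>\<tau>. f (z + \<tau> *s v)) has_derivative (\<lambda>h. h * L v)) (at \<tau>)"
    by (simp add: o_def hom)
  hence "((\<lambda>\<tau>. f (z + \<tau> *s v)) has_field_derivative L v) (at \<tau>)"
    by (simp add: has_field_derivative_def mult.commute[of _ "L v"])
  thus "(\<lambda>\<tau>. f (z + \<tau> *s v)) field_differentiable at \<tau> within {\<tau>. z + \<tau> *s v \<in> S}"
    using field_differentiable_def field_differentiable_at_within by blast
qed

text \<open>Read off as a Taylor coefficient on the complex line through 0 and \<open>w\<close>.
  Only small \<open>\<tau>\<close> matter, so it is meaningful for every \<open>w\<close>, inside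
  the ball or not.\<close>

definition hpart :: "(complex^'n \<Rightarrow> complex) \<Rightarrow> nat \<Rightarrow> complex^'n \<Rightarrow> complex"
  where "hpart f m w = (deriv ^^ m) (\<lambda>\<tau>. f (\<tau> *s w)) 0 / fact m"

context
  fixes f :: "complex^'n \<Rightarrow> complex"
  assumes f: "cvec_analytic_on f (ball 0 1)"
begin

lemma holomorphic_on_ray:
  assumes "\<rho> * norm w \<le> 1"
  shows "(\<lambda>\<tau>. f (\<tau> *s w)) holomorphic_on ball 0 \<rho>"
proof -
  have "ball 0 \<rho> \<subseteq> {\<tau>. 0 + \<tau> *s w \<in> ball 0 1}"
  proof (cases "w = 0")
    case False
    show ?thesis
    proof
      fix \<tau> :: complex assume "\<tau> \<in> ball 0 \<rho>"
      hence "cmod \<tau> * norm w < \<rho> * norm w" using False by auto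
      thus "\<tau> \<in> {\<tau>. 0 + \<tau> *s w \<in> ball 0 1}" using assms by (simp add: norm_vector_smult)
    qed
  qed auto
  thus ?thesis using cvec_analytic_on_line[OF f, of 0 w] holomorphic_on_subset by fastforce
qed

lemma hpart_smult: "hpart f m (c *s w) = c ^ m * hpart f m w"
proof -
  define \<rho> where "\<rho> = 1 / (norm w + 1)"
  define r where "r = \<rho> / (cmod c + 1)"
  have \<rho>: "\<rho> > 0" "\<rho> * norm w \<le> 1"
    using add_nonneg_pos[OF norm_ge_zero[of w] zero_less_one] by (auto simp: \<rho>_def divide_le_eq_1)
  have r: "r > 0" using \<rho> by (simp add: r_def add_nonneg_pos)
  have "(deriv ^^ m) (\<lambda>\<tau>. f ((c * \<tau>) *s w)) 0 = c ^ m * (deriv ^^ m) (\<lambda>\<tau>. f (\<tau> *s w)) (c * 0)"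
  proof (rule higher_deriv_compose_linear[OF holomorphic_on_ray[OF \<rho>(2)], where S="ball 0 r"])
    fix \<tau> assume "\<tau> \<in> ball (0::complex) r"
    hence "cmod c * cmod \<tau> \<le> cmod c * r" by (intro mult_left_mono) auto
    also have "\<dots> < (cmod c + 1) * r" using r by simp
    also have "\<dots> = \<rho>" using add_nonneg_pos[OF norm_ge_zero[of c] zero_less_one] by (simp add: r_def)
    finally show "c * \<tau> \<in> ball 0 \<rho>" by (simp add: norm_mult)
  qed (use r in auto)
  moreover have "(\<lambda>\<tau>. f ((c * \<tau>) *s w)) = (\<lambda>\<tau>. f (\<tau> *s (c *s w)))"
    by (simp only: vector_smult_assoc mult.commute)
  ultimately show ?thesis by (simp add: hpart_def)
qed

lemma hpart_scaleR: "hpart f m (r *\<^sub>R w) = of_real r ^ m * hpart f m w"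
  by (simp add: scaleR_eq_vector_smult hpart_smult)

lemma hpart_average:
  assumes "norm w < 1"
  shows "integral {0..1} (\<lambda>t. f (circ t *s w) / circ t ^ m) = hpart f m w"
proof -
  define \<rho> where "\<rho> = 2 / (norm w + 1)"
  have \<rho>: "\<rho> > 1" "\<rho> * norm w \<le> 1"
    using add_nonneg_pos[OF norm_ge_zero[of w] zero_less_one] assms by (auto simp: \<rho>_def less_divide_eq_1 divide_le_eq_1)
  show ?thesis unfolding hpart_def
    by (rule circle_average_coeff[OF holomorphic_on_ray[OF \<rho>(2)] \<rho>(1)])
qed

text \<open>Reaches arguments outside the unit ball: \<open>w\<close> is first shrunk by
  \<open>r\<close>, and homogeneity accounts for the factor.\<close>

lemma hpart_average_scaled:
  assumes "r * norm w < 1" "r > 0"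
  shows "integral {0..1} (\<lambda>t. f (of_real r *s (circ t *s w)) / circ t ^ m) = of_real r ^ m * hpart f m w"
proof -
  have "of_real r *s (circ t *s w) = circ t *s (of_real r *s w)" for t
    by (simp only: vector_smult_assoc mult.commute)
  thus ?thesis
    using hpart_average[of "of_real r *s w" m] assms by (simp add: hpart_smult norm_vector_smult mult.commute[of "of_real r"])
qed

text \<open>On the ball of radius \<open>R\<close> the function is, up to a constant, an average of
  values of \<open>f\<close> at points shrunk by \<open>1/R\<close>, that is, a parameter integral
  of a jointly continuous integrand.\<close>

lemma continuous_on_hpart: "continuous_on UNIV (hpart f m)"
proof -
  have cf: "continuous_on (ball 0 1) f" by (rule cvec_analytic_on_continuous[OF f])
  have "continuous_on (ball 0 R) (hpart f m)" if R: "R > 0" for R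
  proof -
    have "continuous_on (ball 0 R) (\<lambda>w. integral (cbox 0 1) (\<lambda>t. f (of_real (1/R) *s (circ t *s w)) / circ t ^ m))"
    proof (rule integral_continuous_on_param)
      show "continuous_on (ball 0 R \<times> cbox 0 1)
         (\<lambda>(w, t). f (of_real (1/R) *s (circ t *s w)) / circ t ^ m)"
        unfolding case_prod_beta
      proof (intro continuous_on_divide continuous_on_compose2[OF cf] continuous_intros)
        show "(\<lambda>x. of_real (1/R) *s (circ (snd x) *s fst x)) ` (ball 0 R \<times> cbox 0 1) \<subseteq> ball 0 1"
          using R by (auto simp: norm_vector_smult norm_divide)
      qed auto
    qed
    moreover have "integral (cbox 0 1) (\<lambda>t. f (of_real (1/R) *s (circ t *s w)) / circ t ^ m)
        = of_real (1/R) ^ m * hpart f m w" if "w \<in> ball 0 R" for w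
      using hpart_average_scaled[of "1/R" w m] that R by (simp add: field_simps)
    ultimately have "continuous_on (ball 0 R) (\<lambda>w. of_real (1/R) ^ m * hpart f m w)"
      by (rule continuous_on_eq)
    from continuous_on_mult_left[OF this, of "of_real R ^ m"] show ?thesis
      using R by (simp add: power_divide)
  qed
  hence "continuous_on (ball 0 (norm w + 1)) (hpart f m)" for w
    by (simp add: add_nonneg_pos)
  hence "isCont (hpart f m) w" for w
    by (rule continuous_on_interior[of "ball 0 (norm w + 1)"]) simp
  thus ?thesis by (simp add: continuous_at_imp_continuous_on)
qed

text \<open>Compactness bounds the values on the closed unit ball and homogeneity spreads the bound.
  This polynomial growth makes the Gaussian integrals converge.\<close>

lemma hpart_bound: obtains C where "C \<ge> 0" "\<And>w. cmod (hpart f m w) \<le> C * norm w ^ m"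
proof -
  have "compact (hpart f m ` cball 0 1)"
    using continuous_on_hpart continuous_on_subset compact_cball compact_continuous_image by blast
  then obtain C where "\<forall>y\<in>hpart f m ` cball 0 1. cmod y \<le> C"
    using compact_imp_bounded bounded_iff by blast
  hence C: "cmod (hpart f m w) \<le> C" if "norm w \<le> 1" for w
    using that by simp
  have "C \<ge> 0" by (rule order_trans[OF norm_ge_zero C[of 0]]) simp
  moreover have "cmod (hpart f m w) \<le> C * norm w ^ m" for w
  proof -
    have w: "norm w *\<^sub>R sgn w = w" by (cases "w = 0") (simp_all add: sgn_div_norm)
    have "hpart f m w = of_real (norm w) ^ m * hpart f m (sgn w)"
      using hpart_scaleR[of m "norm w" "sgn w"] by (simp only: w)
    moreover have "cmod (hpart f m (sgn w)) \<le> C" by (rule C) (simp add: norm_sgn)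
    ultimately show ?thesis
      by (simp add: norm_mult norm_power mult.commute[of C] mult_left_mono)
  qed
  ultimately show thesis using that by blast
qed

text \<open>The slice \<tau> -> f(\<tau> z) is holomorphic on a disc of radius larger than 1, so its
  power series may be evaluated at 1.\<close>

lemma hpart_sums:
  assumes "norm z < 1" shows "(\<lambda>m. hpart f m z) sums f z"
proof -
  define \<rho> where "\<rho> = 2 / (norm z + 1)"
  have \<rho>: "\<rho> > 1" "\<rho> * norm z \<le> 1"
    using add_nonneg_pos[OF norm_ge_zero[of z] zero_less_one] assms by (auto simp: \<rho>_def less_divide_eq_1 divide_le_eq_1)
  have "((\<lambda>n. (deriv ^^ n) (\<lambda>\<tau>. f (\<tau> *s z)) 0 / fact n * (1 - 0) ^ n) sums f (1 *s z))"
    by (rule holomorphic_power_series[OF holomorphic_on_ray[OF \<rho>(2)]]) (use \<rho> in auto)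
  thus ?thesis by (simp add: hpart_def)
qed

end

subsection \<open>Gaussian integrals\<close>

lemma power_le_fact_exp:
  fixes x :: real assumes "x \<ge> 0" shows "x ^ k \<le> fact k * exp x"
proof -
  have "x ^ k /\<^sub>R fact k \<le> (\<Sum>n. x ^ n /\<^sub>R fact n)"
    using sum_le_suminf[OF summable_exp_generic[of x], of "{k}"] assms by auto
  thus ?thesis by (simp add: exp_def field_simps)
qed

text \<open>The exponent is half of that of the Fock weight; the other half absorbs polynomial and
  exponential factors.\<close>

lemma integrable_gaussian:
  "integrable lborel (\<lambda>w :: 'a::euclidean_space. exp (- (norm w)\<^sup>2 / 2))"
proof (rule integrableI_bounded)
  have "integrable lborel (\<lambda>x. sqrt (2 * pi) * std_normal_density x)" by simp
  hence "integrable lborel (\<lambda>x. exp (- x\<^sup>2 / 2) :: real)"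
    by (simp add: std_normal_density_def)
  hence fin: "(\<integral>\<^sup>+x. ennreal (exp (- x\<^sup>2 / 2)) \<partial>lborel) < \<infinity>"
    by (simp add: integrable_iff_bounded)
  have "(\<integral>\<^sup>+w. ennreal (norm (exp (- (norm (w::'a))\<^sup>2 / 2))) \<partial>lborel)
      = (\<integral>\<^sup>+w. (\<Prod>b\<in>Basis. ennreal (exp (- ((w::'a) \<bullet> b)\<^sup>2 / 2))) \<partial>lborel)"
  proof (intro nn_integral_cong)
    fix w :: 'a
    have "(norm w)\<^sup>2 = (\<Sum>b\<in>Basis. (w \<bullet> b)\<^sup>2)"
      unfolding power2_norm_eq_inner by (subst euclidean_inner) (simp add: power2_eq_square)
    thus "ennreal (norm (exp (- (norm w)\<^sup>2 / 2))) = (\<Prod>b\<in>Basis. ennreal (exp (- (w \<bullet> b)\<^sup>2 / 2)))"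
      by (simp add: prod_ennreal exp_sum[symmetric] sum_divide_distrib sum_negf)
  qed
  also have "\<dots> = (\<Prod>b\<in>(Basis::'a set). \<integral>\<^sup>+x. ennreal (exp (- x\<^sup>2 / 2)) \<partial>lborel)"
    by (rule nn_integral_lborel_prod) auto
  also have "\<dots> < \<infinity>" using fin by (simp add: power_less_top_ennreal)
  finally show "(\<integral>\<^sup>+w. ennreal (norm (exp (- (norm (w::'a))\<^sup>2 / 2))) \<partial>lborel) < \<infinity>" .
qed measurable

lemma integrable_gaussian_weight:
  fixes g :: "'a::euclidean_space \<Rightarrow> complex"
  assumes [measurable]: "g \<in> borel_measurable borel"
    and bd: "\<And>w. cmod (g w) \<le> C * norm w ^ k * exp (c * norm w)" and "C \<ge> 0"
  shows "integrable lborel (\<lambda>w. g w * of_real (exp (- (norm w)\<^sup>2)))"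
proof (rule Bochner_Integration.integrable_bound)
  show "integrable lborel (\<lambda>w::'a. C * fact k * exp ((c + 1)\<^sup>2 / 2) * exp (- (norm w)\<^sup>2 / 2))"
    by (intro integrable_mult_right integrable_gaussian)
  show "AE w in lborel. norm (g w * of_real (exp (- (norm w)\<^sup>2)))
      \<le> norm (C * fact k * exp ((c + 1)\<^sup>2 / 2) * exp (- (norm w)\<^sup>2 / 2))"
  proof (intro always_eventually allI)
    fix w :: 'a
    let ?x = "norm w"
    \<comment> \<open>Completing the square gives away half of the quadratic term to dominate the
      linear terms.\<close>
    have "0 \<le> (?x - (c + 1))\<^sup>2 / 2" by simp
    hence e: "?x + c * ?x - ?x\<^sup>2 \<le> (c + 1)\<^sup>2 / 2 + (- ?x\<^sup>2 / 2)"
      by (simp add: power2_eq_square field_simps)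
    have "norm (g w * of_real (exp (- ?x\<^sup>2))) \<le> C * ?x ^ k * exp (c * ?x) * exp (- ?x\<^sup>2)"
      using bd[of w] by (simp add: norm_mult mult_right_mono)
    also have "\<dots> \<le> C * (fact k * exp ?x) * exp (c * ?x) * exp (- ?x\<^sup>2)"
      using power_le_fact_exp[of ?x k] \<open>C \<ge> 0\<close> by (intro mult_right_mono mult_left_mono) auto
    also have "\<dots> = C * fact k * exp (?x + c * ?x - ?x\<^sup>2)"
      by (simp add: exp_add exp_diff exp_minus field_simps)
    also have "\<dots> \<le> C * fact k * exp ((c + 1)\<^sup>2 / 2 + (- ?x\<^sup>2 / 2))"
      using e \<open>C \<ge> 0\<close> by (intro mult_left_mono) auto
    also have "\<dots> \<le> norm (C * fact k * exp ((c + 1)\<^sup>2 / 2) * exp (- ?x\<^sup>2 / 2))"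
      using \<open>C \<ge> 0\<close> by (simp only: exp_add mult.assoc) simp
    finally show "norm (g w * of_real (exp (- ?x\<^sup>2))) \<le> norm (C * fact k * exp ((c + 1)\<^sup>2 / 2) * exp (- ?x\<^sup>2 / 2))" .
  qed
qed measurable

lemma lborel_integral_affine:
  fixes g :: "'a::euclidean_space \<Rightarrow> 'b::{banach, second_countable_topology}"
  assumes [measurable]: "g \<in> borel_measurable borel" and c: "c \<noteq> 0"
  shows "integral\<^sup>L lborel g = \<bar>c\<bar> ^ DIM('a) *\<^sub>R (LINT x|lborel. g (t + c *\<^sub>R x))"
  by (subst lborel_affine[OF c, of t]) (simp add: integral_density integral_distr)

lemma lborel_integrable_affine:
  fixes g :: "'a::euclidean_space \<Rightarrow> 'b::{banach, second_countable_topology}"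
  assumes g: "integrable lborel g" and c: "c \<noteq> 0"
  shows "integrable lborel (\<lambda>x. g (t + c *\<^sub>R x))"
proof -
  have [measurable]: "g \<in> borel_measurable borel" using g by auto
  have "integrable (density (distr lborel borel (\<lambda>x. t + c *\<^sub>R x)) (\<lambda>_. ennreal (\<bar>c\<bar> ^ DIM('a)))) g"
    using g lborel_affine[OF c, of t] by simp
  hence "integrable lborel (\<lambda>x. \<bar>c\<bar> ^ DIM('a) *\<^sub>R g (t + c *\<^sub>R x))"
    by (simp add: integrable_density integrable_distr_eq)
  from integrable_scaleR_right[OF this, of "inverse (\<bar>c\<bar> ^ DIM('a))"] show ?thesis
    using c by simp
qed

lemma AE_notin_sphere: "AE x in lborel. (x :: 'a::euclidean_space) \<notin> sphere a r"
proof -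
  have "sphere a r \<in> null_sets lborel"
    using negligible_sphere[of a r] by (auto simp: null_sets_completion_iff negligible_iff_null_sets)
  thus ?thesis by (rule AE_not_in)
qed

text \<open>Writing \<open>exp (-|w|\<^sup>2)\<close> as the integral of \<open>exp (-s)\<close> over \<open>s \<ge> |w|\<^sup>2\<close> turns a Gaussian
  integral into an integral over balls, which scale by homogeneity.\<close>

lemma gaussian_homogeneous:
  fixes Q :: "'a::euclidean_space \<Rightarrow> complex"
  assumes [measurable]: "Q \<in> borel_measurable borel"
    and hom: "\<And>r w. r > 0 \<Longrightarrow> Q (r *\<^sub>R w) = of_real (r ^ (2 * d)) * Q w"
    and int: "integrable lborel (\<lambda>w. Q w * of_real (exp (- (norm w)\<^sup>2)))"
    and dim: "DIM('a) = 2 * n"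
  shows "(LINT w|lborel. Q w * of_real (exp (- (norm w)\<^sup>2))) = fact (n + d) * (LINT w:ball 0 1|lborel. Q w)"
proof -
  let ?I = "LINT w:ball 0 1|lborel. Q w"
  define k where "k w s = (indicator {(norm w)\<^sup>2..} s * exp (- s)) *\<^sub>R Q w" for w and s :: real
  have tail: "has_bochner_integral lborel (\<lambda>s. indicator {a..} s * exp (- s)) (exp (- a))" for a :: real
  proof -
    have "has_bochner_integral lborel (\<lambda>t. exp (- a) * (t ^ 0 * exp (- t) * indicator {0..} t)) (exp (- a) * fact 0)"
      by (rule has_bochner_integral_mult_right[OF has_bochner_integral_I0i_power_exp_m'])
    moreover have "exp (- a) * (t ^ 0 * exp (- t) * indicator {0..} t) = indicator {a..} (a + 1 * t) * exp (- (a + 1 * t))" for t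
      by (auto simp: indicator_def exp_add exp_diff exp_minus field_simps)
    ultimately have "has_bochner_integral lborel (\<lambda>t. indicator {a..} (a + 1 * t) * exp (- (a + 1 * t))) (exp (- a))"
      by simp
    thus ?thesis
      using lborel_has_bochner_integral_real_affine_iff[of 1 "\<lambda>s. indicator {a..} s * exp (- s)" "exp (- a)" a] by simp
  qed
  have k_int: "integrable lborel (k w)" and k_val: "(LINT s|lborel. k w s) = Q w * of_real (exp (- (norm w)\<^sup>2))" for w
    using has_bochner_integral_scaleR_left[OF tail[of "(norm w)\<^sup>2"], of "Q w"]
    by (auto simp: k_def[abs_def] has_bochner_integral_iff scaleR_conv_of_real mult.commute)
  have k_norm: "(LINT s|lborel. norm (k w s)) = norm (Q w * of_real (exp (- (norm w)\<^sup>2)))" for w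
  proof -
    have "norm (k w s) = (indicator {(norm w)\<^sup>2..} s * exp (- s)) * cmod (Q w)" for s
      by (simp add: k_def abs_mult)
    thus ?thesis
      using has_bochner_integral_mult_left[OF tail[of "(norm w)\<^sup>2"], of "cmod (Q w)"]
      by (auto simp: has_bochner_integral_iff norm_mult mult.commute)
  qed
  have k_if: "k w s = (if (norm w)\<^sup>2 \<le> s then exp (- s) else 0) *\<^sub>R Q w" for w s
    by (simp add: k_def)
  have [measurable]: "cball (0::'a) 1 \<in> sets borel" "ball (0::'a) 1 \<in> sets borel"
    by simp_all
  have [measurable]: "case_prod k \<in> borel_measurable (lborel \<Otimes>\<^sub>M lborel)"
  proof -
    have "case_prod k = (\<lambda>p. (if (norm (fst p))\<^sup>2 \<le> snd p then exp (- snd p) else 0) *\<^sub>R Q (fst p))"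
      by (auto simp: k_if fun_eq_iff)
    thus ?thesis by simp
  qed
  have k2: "integrable (lborel \<Otimes>\<^sub>M lborel) (case_prod k)"
    by (rule lborel_pair.Fubini_integrable) (use int k_int in \<open>auto simp: k_norm intro: integrable_norm\<close>)
  \<comment> \<open>Substituting \<open>sqrt s *\<^sub>R w\<close> yields the Jacobian s^n, the real
    dimension being 2n, and s^d from the degree 2d. For negative \<open>s\<close> the layer is
    empty; \<open>s = 0\<close> is left out as a null set.\<close>
  have scaled: "(LINT w|lborel. k w s) = (s ^ (n + d) * exp (- s) * indicator {0..} s) *\<^sub>R ?I" if "s \<noteq> 0" for s
  proof (cases "s > 0")
    case True
    have e: "k (0 + sqrt s *\<^sub>R w) s = of_real (exp (- s) * s ^ d) * (indicator (cball 0 1) w *\<^sub>R Q w)" for w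
      using True by (simp add: k_if hom indicator_def power_mult_distrib power_mult scaleR_conv_of_real abs_square_le_1)
    have "(\<lambda>w. k w s) \<in> borel_measurable borel"
      by (simp add: k_if)
    hence "(LINT w|lborel. k w s) = \<bar>sqrt s\<bar> ^ DIM('a) *\<^sub>R (LINT w|lborel. k (0 + sqrt s *\<^sub>R w) s)"
      by (rule lborel_integral_affine) (use True in simp)
    also have "(LINT w|lborel. k (0 + sqrt s *\<^sub>R w) s) = of_real (exp (- s) * s ^ d) * (LINT w|lborel. indicator (cball 0 1) w *\<^sub>R Q w)"
      by (simp only: e integral_mult_right_zero)
    \<comment> \<open>The layer |w|^2 <= s rescales to the closed ball, which differs from the open
      one by a null sphere.\<close>
    also have "(LINT w|lborel. indicator (cball 0 1) w *\<^sub>R Q w) = ?I"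
      unfolding set_lebesgue_integral_def
    proof (rule integral_cong_AE)
      show "AE x in lborel. indicator (cball 0 1) x *\<^sub>R Q x = indicator (ball 0 1) x *\<^sub>R Q x"
        using AE_notin_sphere[of 0 1] by eventually_elim (auto simp: indicator_def)
    qed simp_all
    finally show ?thesis using True
      by (simp add: dim power_mult power_add scaleR_conv_of_real)
  next
    case False
    hence "s < (norm w)\<^sup>2" for w :: 'a
      using that by (intro less_le_trans[OF _ zero_le_power2]) auto
    hence "k w s = 0" for w by (simp add: k_if not_le[symmetric] del: not_le)
    thus ?thesis using False that by simp
  qed
  have "(LINT w|lborel. Q w * of_real (exp (- (norm w)\<^sup>2))) = (LINT w|lborel. (LINT s|lborel. k w s))"
    by (simp add: k_val)
  also have "\<dots> = (LINT s|lborel. (LINT w|lborel. k w s))"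
    by (rule lborel_pair.Fubini_integral[OF k2, symmetric])
  also have "\<dots> = (LINT s|lborel. (s ^ (n + d) * exp (- s) * indicator {0..} s) *\<^sub>R ?I)"
  proof (rule integral_cong_AE)
    show "(\<lambda>s. LINT w|lborel. k w s) \<in> borel_measurable lborel"
      using lborel_pair.integrable_snd[OF k2] by auto
    show "AE s in lborel. (LINT w|lborel. k w s) = (s ^ (n + d) * exp (- s) * indicator {0..} s) *\<^sub>R ?I"
      using AE_lborel_singleton[of 0] by eventually_elim (rule scaled)
  qed auto
  also have "\<dots> = fact (n + d) *\<^sub>R ?I"
    using has_bochner_integral_scaleR_left[OF has_bochner_integral_I0i_power_exp_m'[of "n + d"], of ?I]
    by (auto simp: has_bochner_integral_iff)
  finally show ?thesis by (simp add: scaleR_conv_of_real)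
qed

text \<open>Read backwards from the volume of the unit ball: \<open>gaussian_homogeneous\<close> for
  the constant 1 and \<open>d = 0\<close>.\<close>

lemma gaussian_total:
  "(LINT w|lborel. of_real (exp (- (norm (w :: complex^'n))\<^sup>2))) = (of_real (pi ^ CARD('n)) :: complex)"
proof -
  have int: "integrable lborel (\<lambda>w :: complex^'n. 1 * complex_of_real (exp (- (norm w)\<^sup>2)))"
    by (rule integrable_gaussian_weight[where C=1 and k=0 and c=0]) auto
  have "(LINT w|lborel. 1 * complex_of_real (exp (- (norm (w :: complex^'n))\<^sup>2)))
      = fact (CARD('n) + 0) * (LINT w:ball (0 :: complex^'n) 1|lborel. 1)"
    by (rule gaussian_homogeneous) (use int in auto)
  also have "(LINT w:ball (0 :: complex^'n) 1|lborel. 1 :: complex) = of_real (pi ^ CARD('n) / fact CARD('n))"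
    using content_ball[of 1 "0 :: complex^'n"] unit_ball_vol_even[of "CARD('n)"]
    by (simp add: set_lebesgue_integral_def measure_def emeasure_ball scaleR_conv_of_real mult.commute[of _ 2])
  finally show ?thesis by simp
qed

context
  fixes f :: "complex^'n \<Rightarrow> complex"
  assumes f: "cvec_analytic_on f (ball 0 1)"
begin

text \<open>Analyticity of \<open>hpart f m\<close> is bypassed. It is written as an average over
  \<open>s\<close> of values of \<open>f\<close> at points shrunk by \<open>r\<close>, the two
  circle integrals are exchanged, and the mean value property is applied to \<open>f\<close> on a
  complex line. The exponential factor is holomorphic with value 1 at the centre.\<close>

lemma hpart_mean_value:
  "integral {0..1} (\<lambda>t. hpart f m (z + circ t *s y) * exp (- (circ t * b))) = hpart f m z"
proof -
  define r where "r = 1 / (norm z + norm y + 1)"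
  \<comment> \<open>Slightly larger than 1, so that the closed unit disc is inside the domain;
    \<open>\<rho> * norm y < norm y + 1\<close> keeps the shrunk points in the unit ball.\<close>
  define \<rho> where "\<rho> = 1 + 1 / (norm y + 1)"
  have pos: "norm z + norm y + 1 > 0" "norm y + 1 > 0"
    by (auto intro!: add_nonneg_pos add_nonneg_nonneg)
  have r: "r > 0" using pos by (simp add: r_def)
  have \<rho>: "\<rho> > 1" using pos by (simp add: \<rho>_def)
  have cf: "continuous_on (ball 0 1) f" by (rule cvec_analytic_on_continuous[OF f])
  have nb: "r * (norm z + c * norm y) < 1" if "c < \<rho>" "c \<ge> 0" for c
  proof (cases "norm y = 0")
    case False
    hence "c * norm y < \<rho> * norm y" using that by simp
    also have "\<dots> < norm y + 1" using pos by (simp add: \<rho>_def field_simps)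
    finally show ?thesis using pos by (simp add: r_def field_simps)
  qed (use pos in \<open>simp add: r_def\<close>)
  have nr: "cmod (of_real r) = r" using r by simp
  have n1: "norm (of_real r *s (u *s (z + c *s y))) < 1" if "cmod u = 1" "cmod c < \<rho>" for u c
  proof -
    have "norm (of_real r *s (u *s (z + c *s y))) = r * norm (z + c *s y)"
      using that by (simp only: norm_vector_smult nr)
    also have "\<dots> \<le> r * (norm z + cmod c * norm y)"
      using norm_triangle_ineq[of z "c *s y"] r by (simp add: norm_vector_smult)
    finally show ?thesis using nb[OF that(2)] by simp
  qed
  let ?F = "\<lambda>t s. f (of_real r *s (circ s *s (z + circ t *s y))) / circ s ^ m * exp (- (circ t * b))"
  have "of_real r ^ m * integral {0..1} (\<lambda>t. hpart f m (z + circ t *s y) * exp (- (circ t * b)))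
      = integral {0..1} (\<lambda>t. of_real r ^ m * hpart f m (z + circ t *s y) * exp (- (circ t * b)))"
    by (simp add: mult.assoc)
  also have "\<dots> = integral {0..1} (\<lambda>t. integral {0..1} (\<lambda>s. ?F t s))"
  proof (rule integral_cong)
    fix t :: real
    have "r * norm (z + circ t *s y) < 1"
      using n1[of 1 "circ t"] \<rho> r by (simp add: norm_vector_smult del: vector_smult_assoc vector_add_ldistrib)
    from hpart_average_scaled[OF f this r, of m, symmetric]
    show "of_real r ^ m * hpart f m (z + circ t *s y) * exp (- (circ t * b)) = integral {0..1} (\<lambda>s. ?F t s)"
      by (simp only: integral_mult_left)
  qed
  also have "\<dots> = integral {0..1} (\<lambda>s. integral {0..1} (\<lambda>t. ?F t s))"
  proof -
    have "continuous_on (cbox (0,0) (1,1)) (\<lambda>(t, s). ?F t s)"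
      unfolding case_prod_beta
    proof (intro continuous_intros continuous_on_compose2[OF cf])
      show "(\<lambda>x. of_real r *s (circ (snd x) *s (z + circ (fst x) *s y))) ` cbox (0, 0) (1, 1) \<subseteq> ball 0 1"
        using n1 \<rho> by (auto simp del: vector_smult_assoc vector_add_ldistrib)
    qed auto
    from integral_swap_continuous[OF this] show ?thesis by simp
  qed
  also have "\<dots> = integral {0..1} (\<lambda>s. f (of_real r *s (circ s *s z)) / circ s ^ m)"
  proof (rule integral_cong)
    fix s :: real
    define \<phi> where "\<phi> \<tau> = f (of_real r *s (circ s *s z) + \<tau> *s (of_real r *s (circ s *s y))) * exp (- (\<tau> * b))" for \<tau>
    have eq: "of_real r *s (circ s *s (z + \<tau> *s y)) = of_real r *s (circ s *s z) + \<tau> *s (of_real r *s (circ s *s y))" for \<tau>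
      by (simp add: vec_eq_iff algebra_simps)
    have "(\<lambda>\<tau>. f (of_real r *s (circ s *s z) + \<tau> *s (of_real r *s (circ s *s y)))) holomorphic_on ball 0 \<rho>"
      by (rule holomorphic_on_subset[OF cvec_analytic_on_line[OF f]])
         (use n1[of "circ s"] in \<open>auto simp only: eq[symmetric] cmod_circ mem_ball_0 mem_Collect_eq\<close>)
    hence "\<phi> holomorphic_on ball 0 \<rho>"
      unfolding \<phi>_def[abs_def] by (intro holomorphic_intros)
    from circle_average_coeff[OF this \<rho>, of 0]
    have "integral {0..1} (\<lambda>t. \<phi> (circ t)) = f (of_real r *s (circ s *s z))"
      by (simp add: \<phi>_def)
    moreover have "?F t s = \<phi> (circ t) / circ s ^ m" for t
      by (simp only: \<phi>_def eq) simp
    ultimately show "integral {0..1} (\<lambda>t. ?F t s) = f (of_real r *s (circ s *s z)) / circ s ^ m"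
      by simp
  qed
  also have "\<dots> = of_real r ^ m * hpart f m z"
  proof (rule hpart_average_scaled[OF f _ r])
    show "r * norm z < 1" using nb[of 0] \<rho> by simp
  qed
  finally show ?thesis using r by simp
qed

end

subsection \<open>The reproducing kernel\<close>

lemma higher_deriv_exp_mult: "(deriv ^^ m) (\<lambda>\<tau>. exp (c * \<tau>)) = (\<lambda>\<tau>. c ^ m * exp (c * \<tau> :: complex))"
proof (induction m)
  case (Suc m)
  have "deriv (\<lambda>\<tau>. c ^ m * exp (c * \<tau>)) \<tau> = c ^ Suc m * exp (c * \<tau>)" for \<tau>
    by (rule DERIV_imp_deriv) (auto intro!: derivative_eq_intros)
  thus ?case by (auto simp: Suc)
qed auto

text \<open>Integrating against a power of \<open>circ t\<close> extracts one Taylor coefficient of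
  exp. The rotation enters conjugated, because \<open>herm\<close> is conjugate linear in its second
  argument, hence the detour through \<open>cnj\<close>.\<close>

lemma circle_average_exp:
  "integral {0..1} (\<lambda>t. circ t ^ m * exp (cnj (circ t) * x)) = x ^ m / fact m"
proof -
  have "integral {0..1} (\<lambda>t. exp (cnj x * circ t) / circ t ^ m) = cnj x ^ m / fact m"
    by (subst circle_average_coeff[where \<rho>=2])
       (auto intro!: holomorphic_intros simp: higher_deriv_exp_mult)
  hence "cnj (integral {0..1} (\<lambda>t. exp (cnj x * circ t) / circ t ^ m)) = x ^ m / fact m"
    by simp
  thus ?thesis
    by (simp add: integral_cnj exp_cnj cnj_circ field_simps)
qed

lemma set_integrable_mult_bounded:
  fixes f h :: "'a::euclidean_space \<Rightarrow> complex"
  assumes f: "set_integrable lborel B f" and h: "continuous_on B h" and B: "B \<in> sets borel"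
    and bd: "\<And>x. x \<in> B \<Longrightarrow> cmod (h x) \<le> K"
  shows "set_integrable lborel B (\<lambda>x. f x * h x)"
proof -
  have "integrable lborel (\<lambda>x. (indicator B x *\<^sub>R f x) * (indicator B x *\<^sub>R h x))"
  proof (rule Bochner_Integration.integrable_bound)
    show "integrable lborel (\<lambda>x. K *\<^sub>R (indicator B x *\<^sub>R f x))"
      using f unfolding set_integrable_def by (rule integrable_scaleR_right)
    have "(\<lambda>x. indicator B x *\<^sub>R h x) \<in> borel_measurable borel"
      using h B by (simp add: borel_measurable_continuous_on_indicator)
    thus "(\<lambda>x. (indicator B x *\<^sub>R f x) * (indicator B x *\<^sub>R h x)) \<in> borel_measurable lborel"
      using borel_measurable_integrable[OF f[unfolded set_integrable_def]]
      by (intro borel_measurable_times) simp_all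
    show "AE x in lborel. norm ((indicator B x *\<^sub>R f x) * (indicator B x *\<^sub>R h x))
        \<le> norm (K *\<^sub>R (indicator B x *\<^sub>R f x))"
    proof (intro always_eventually allI)
      fix x
      show "norm ((indicator B x *\<^sub>R f x) * (indicator B x *\<^sub>R h x)) \<le> norm (K *\<^sub>R (indicator B x *\<^sub>R f x))"
      proof (cases "x \<in> B")
        case True
        have "cmod (h x) \<le> \<bar>K\<bar>" using bd[OF True] by simp
        thus ?thesis using True by (simp add: norm_mult mult.commute[of "\<bar>K\<bar>"] mult_left_mono)
      qed simp
    qed
  qed
  moreover have "(\<lambda>x. (indicator B x *\<^sub>R f x) * (indicator B x *\<^sub>R h x)) = (\<lambda>x. indicator B x *\<^sub>R (f x * h x))"
    by (auto simp: indicator_def)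
  ultimately show ?thesis by (simp add: set_integrable_def)
qed

lemma negative_binomial_sums:
  fixes x :: complex assumes "cmod x < 1"
  shows "(\<lambda>m. of_nat ((n + m) choose m) * x ^ m) sums (1 / (1 - x) ^ Suc n)"
proof -
  have "(\<lambda>m. ((- of_nat (Suc n)) gchoose m) * (- x) ^ m) sums (1 + (- x)) powr (- of_nat (Suc n))"
    by (rule gen_binomial_complex) (use assms in simp)
  moreover have "((- of_nat (Suc n)) gchoose m) * (- x) ^ m = of_nat ((n + m) choose m) * x ^ m" for m
  proof -
    have "((- of_nat (Suc n) :: complex) gchoose m) = (-1) ^ m * (of_nat (n + m) gchoose m)"
      by (subst gbinomial_minus) simp
    moreover have "(-1) ^ m * (- x) ^ m = x ^ m"
      by (simp flip: power_mult_distrib)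
    ultimately show ?thesis by (simp add: binomial_gbinomial mult_ac)
  qed
  moreover have "(1 + (- x)) powr (- of_nat (Suc n)) = 1 / (1 - x) ^ Suc n"
    using assms by (subst powr_minus, subst powr_nat') (auto simp: inverse_eq_divide)
  ultimately show ?thesis by simp
qed

context
  fixes f :: "complex^'n \<Rightarrow> complex"
  assumes f: "cvec_analytic_on f (ball 0 1)"
begin

lemma measurable_hpart [measurable]: "hpart f m \<in> borel_measurable borel"
  using continuous_on_hpart[OF f] by (rule borel_measurable_continuous_onI)

text \<open>Used twice: \<open>k = 0\<close>, \<open>b = 1\<close> for the Fock integrand, and
  \<open>k = m\<close>, \<open>b = 0\<close> for the homogeneous integrand left after
  averaging.\<close>

lemma integrable_hpart_gaussian:
  "integrable lborel (\<lambda>w. hpart f m w * herm z w ^ k * exp (b * herm z w) * of_real (exp (- (norm w)\<^sup>2)))"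
proof -
  obtain C where C: "C \<ge> 0" "\<And>w. cmod (hpart f m w) \<le> C * norm w ^ m"
    using hpart_bound[OF f] by blast
  show ?thesis
  proof (rule integrable_gaussian_weight)
    fix w :: "complex^'n"
    have "cmod (exp (b * herm z w)) \<le> exp (cmod (b * herm z w))"
      by (rule norm_exp)
    also have "\<dots> \<le> exp (cmod b * norm z * norm w)"
      using norm_herm_le[of z w] by (simp add: norm_mult mult.assoc mult_left_mono)
    finally have e: "cmod (exp (b * herm z w)) \<le> exp (cmod b * norm z * norm w)" .
    have "cmod (hpart f m w * herm z w ^ k * exp (b * herm z w))
        \<le> (C * norm w ^ m) * (norm z * norm w) ^ k * exp (cmod b * norm z * norm w)"
      unfolding norm_mult norm_power
      by (intro mult_mono C e power_mono norm_herm_le) (use C in auto)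
    also have "\<dots> = (C * norm z ^ k) * norm w ^ (m + k) * exp (cmod b * norm z * norm w)"
      by (simp add: power_add power_mult_distrib)
    finally show "cmod (hpart f m w * herm z w ^ k * exp (b * herm z w))
       \<le> (C * norm z ^ k) * norm w ^ (m + k) * exp (cmod b * norm z * norm w)" .
  qed (use C in auto)
qed

lemma fock_reproducing:
  "(LINT w|lborel. hpart f m w * exp (herm z w) * of_real (exp (- (norm w)\<^sup>2))) = of_real (pi ^ CARD('n)) * hpart f m z"
proof -
  define g where "g w = hpart f m w * exp (herm z w) * of_real (exp (- (norm w)\<^sup>2))" for w
  define h where "h y = hpart f m (z + y) * exp (- herm y z) * of_real (exp (- (norm y)\<^sup>2))" for y
  \<comment> \<open>Expanding |z + y|^2 cancels all terms in which \<open>y\<close> enters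
    conjugated, up to |y|^2. What remains, exp(-<y,z>), is holomorphic in \<open>y\<close>, as the
    mean value property requires.\<close>
  have gh: "g (z + 1 *\<^sub>R y) = h y" for y
  proof -
    have "exp (herm z (z + y)) * of_real (exp (- (norm (z + y))\<^sup>2)) = exp (- herm y z) * complex_of_real (exp (- (norm y)\<^sup>2))"
      unfolding exp_of_real[symmetric] of_real_minus herm_self[symmetric] mult_exp_exp
      by (simp add: herm_add_left herm_add_right algebra_simps)
    thus ?thesis by (simp add: g_def h_def mult.assoc)
  qed
  have gi: "integrable lborel g"
    using integrable_hpart_gaussian[of m z 0 1] by (simp add: g_def[abs_def])
  have hi: "integrable lborel h"
    using lborel_integrable_affine[OF gi, of 1 z] by (simp only: gh)
  have inner: "integral {0..1} (\<lambda>t. h (circ t *s y)) = hpart f m z * of_real (exp (- (norm y)\<^sup>2))" for y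
  proof -
    have "h (circ t *s y) = hpart f m (z + circ t *s y) * exp (- (circ t * herm y z)) * of_real (exp (- (norm y)\<^sup>2))" for t
      by (simp add: h_def herm_smult_left norm_vector_smult)
    thus ?thesis by (simp only: integral_mult_left hpart_mean_value[OF f])
  qed
  have "integral\<^sup>L lborel g = (LINT y|lborel. g (z + 1 *\<^sub>R y))"
    using lborel_integral_affine[of g 1 z] gi by simp
  also have "\<dots> = integral\<^sup>L lborel h"
    by (simp only: gh)
  also have "\<dots> = (LINT y|lborel. integral {0..1} (\<lambda>t. h (circ t *s y)))"
  proof (rule integral_circle_average[OF hi])
    fix w
    show "continuous_on {0..1} (\<lambda>t. h (circ t *s w))"
      unfolding h_def
      by (intro continuous_intros continuous_on_compose2[OF continuous_on_hpart[OF f]]) auto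
  qed
  also have "\<dots> = hpart f m z * of_real (pi ^ CARD('n))"
    by (simp only: inner integral_mult_right_zero gaussian_total)
  finally show ?thesis by (simp add: g_def[abs_def] mult.commute)
qed

text \<open>Averaging over rotations keeps of the exponential series only the term of order
  \<open>m\<close>. The integrand is then homogeneous of real degree 2m apart from the weight, so
  the Gaussian can be traded for the ball.\<close>

lemma hpart_moment:
  "(LINT w:ball 0 1|lborel. hpart f m w * herm z w ^ m) = of_real (pi ^ CARD('n) * fact m / fact (CARD('n) + m)) * hpart f m z"
proof -
  define g where "g w = hpart f m w * exp (herm z w) * of_real (exp (- (norm w)\<^sup>2))" for w
  have gi: "integrable lborel g"
    using integrable_hpart_gaussian[of m z 0 1] by (simp add: g_def[abs_def])
  have inner: "integral {0..1} (\<lambda>t. g (circ t *s w))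
      = hpart f m w * herm z w ^ m * of_real (exp (- (norm w)\<^sup>2)) * (1 / fact m)" for w
  proof -
    have "g (circ t *s w) = (circ t ^ m * exp (cnj (circ t) * herm z w)) * (hpart f m w * of_real (exp (- (norm w)\<^sup>2)))" for t
      by (simp add: g_def herm_smult_right norm_vector_smult hpart_smult[OF f])
    thus ?thesis by (simp only: integral_mult_left circle_average_exp) simp
  qed
  have "of_real (pi ^ CARD('n)) * hpart f m z = integral\<^sup>L lborel g"
    using fock_reproducing[of m z] by (simp add: g_def[abs_def])
  also have "\<dots> = (LINT w|lborel. integral {0..1} (\<lambda>t. g (circ t *s w)))"
  proof (rule integral_circle_average[OF gi])
    fix w
    show "continuous_on {0..1} (\<lambda>t. g (circ t *s w))"
      unfolding g_def
      by (intro continuous_intros continuous_on_compose2[OF continuous_on_hpart[OF f]]) auto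
  qed
  also have "\<dots> = (LINT w|lborel. hpart f m w * herm z w ^ m * of_real (exp (- (norm w)\<^sup>2))) * (1 / fact m)"
    by (simp only: inner integral_mult_left_zero)
  also have "(LINT w|lborel. hpart f m w * herm z w ^ m * of_real (exp (- (norm w)\<^sup>2)))
      = fact (CARD('n) + m) * (LINT w:ball 0 1|lborel. hpart f m w * herm z w ^ m)"
  proof (rule gaussian_homogeneous)
    show "integrable lborel (\<lambda>w. hpart f m w * herm z w ^ m * complex_of_real (exp (- (norm w)\<^sup>2)))"
      using integrable_hpart_gaussian[of m z m 0] by simp
    show "hpart f m (r *\<^sub>R w) * herm z (r *\<^sub>R w) ^ m = complex_of_real (r ^ (2 * m)) * (hpart f m w * herm z w ^ m)" for r w
      by (simp add: hpart_scaleR[OF f] herm_scaleR_right power_mult_distrib mult_2 power_add)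
  qed auto
  finally show ?thesis by (simp add: field_simps)
qed

text \<open>The weight \<open>herm z w ^ m\<close> turns under rotation by the inverse of
  \<open>circ t ^ m\<close>, so the average over rotations replaces \<open>f\<close> by its
  homogeneous part of degree \<open>m\<close>.\<close>

lemma moment:
  assumes fi: "set_integrable lborel (ball 0 1) f"
  shows "(LINT w:ball 0 1|lborel. f w * herm z w ^ m)
    = of_real (pi ^ CARD('n) * fact m / fact (CARD('n) + m)) * hpart f m z"
proof -
  define g where "g w = indicator (ball 0 1) w *\<^sub>R (f w * herm z w ^ m)" for w
  have gi: "integrable lborel g"
    unfolding g_def[abs_def] set_integrable_def[symmetric]
  proof (rule set_integrable_mult_bounded[OF fi])
    fix x :: "complex^'n" assume "x \<in> ball 0 1"
    hence "norm z * norm x \<le> norm z * 1" by (intro mult_left_mono) auto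
    hence "cmod (herm z x) \<le> norm z" using norm_herm_le[of z x] by simp
    thus "cmod (herm z x ^ m) \<le> norm z ^ m" by (simp add: norm_power power_mono)
  qed (auto intro!: continuous_intros)
  have cf: "continuous_on (ball 0 1) f" by (rule cvec_analytic_on_continuous[OF f])
  have gc: "g (circ t *s w) = indicator (ball 0 1) w *\<^sub>R (f (circ t *s w) / circ t ^ m * herm z w ^ m)" for t w
    by (simp add: g_def indicator_def norm_vector_smult herm_smult_right cnj_circ field_simps)
  have inner: "integral {0..1} (\<lambda>t. g (circ t *s w)) = indicator (ball 0 1) w *\<^sub>R (hpart f m w * herm z w ^ m)" for w
  proof (cases "w \<in> ball 0 1")
    case True
    hence "integral {0..1} (\<lambda>t. f (circ t *s w) / circ t ^ m * herm z w ^ m) = hpart f m w * herm z w ^ m"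
      by (simp only: integral_mult_left hpart_average[OF f] mem_ball_0)
    thus ?thesis using True unfolding gc by (simp only: indicator_simps scaleR_one)
  qed (simp add: gc)
  have "(LINT w:ball 0 1|lborel. f w * herm z w ^ m) = integral\<^sup>L lborel g"
    by (simp add: g_def[abs_def] set_lebesgue_integral_def)
  also have "\<dots> = (LINT w|lborel. integral {0..1} (\<lambda>t. g (circ t *s w)))"
  proof (rule integral_circle_average[OF gi])
    fix w :: "complex^'n"
    show "continuous_on {0..1} (\<lambda>t. g (circ t *s w))"
    proof (cases "w \<in> ball 0 1")
      case True
      thus ?thesis unfolding gc
        by (intro continuous_intros continuous_on_compose2[OF cf]) (auto simp: norm_vector_smult)
    qed (simp add: gc)
  qed
  also have "\<dots> = (LINT w:ball 0 1|lborel. hpart f m w * herm z w ^ m)"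
    by (simp only: inner set_lebesgue_integral_def)
  finally show ?thesis by (simp only: hpart_moment)
qed

theorem reproducing:
  assumes fi: "set_integrable lborel (ball 0 1) f" and z: "norm z < 1"
  shows "(LINT w:ball 0 1|lborel. f w / (1 - herm z w) ^ Suc CARD('n)) = of_real (pi ^ CARD('n) / fact CARD('n)) * f z"
proof -
  let ?n = "CARD('n)"
  define F where "F m w = indicator (ball 0 1) w *\<^sub>R (f w * (of_nat ((?n + m) choose m) * herm z w ^ m))" for m w
  have lt: "cmod (herm z w) \<le> norm z" if "w \<in> ball 0 1" for w
  proof -
    have "norm z * norm w \<le> norm z * 1" using that by (intro mult_left_mono) auto
    thus ?thesis using norm_herm_le[of z w] by simp
  qed
  have summ: "summable (\<lambda>m. of_nat ((?n + m) choose m) * norm z ^ m)"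
  proof -
    have "(\<lambda>m. of_nat ((?n + m) choose m) * complex_of_real (norm z) ^ m) sums (1 / (1 - of_real (norm z)) ^ Suc ?n)"
      by (rule negative_binomial_sums) (use z in simp)
    hence "summable (\<lambda>m. complex_of_real (of_nat ((?n + m) choose m) * norm z ^ m))"
      by (simp add: sums_iff)
    thus ?thesis by (simp only: summable_complex_of_real)
  qed
  \<comment> \<open>Uniform domination on the ball: |<z,w>| <= |z| < 1 there, and the same binomial
    series converges at |z|.\<close>
  have bd: "norm (F m w) \<le> norm (indicator (ball 0 1) w *\<^sub>R f w) * (of_nat ((?n + m) choose m) * norm z ^ m)" for m w
  proof (cases "w \<in> ball 0 1")
    case True
    thus ?thesis using power_mono[OF lt[OF True], of m]
      by (simp add: F_def norm_mult norm_power mult_left_mono)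
  qed (simp add: F_def)
  have Fi: "integrable lborel (F m)" for m
    unfolding F_def[abs_def] set_integrable_def[symmetric]
  proof (rule set_integrable_mult_bounded[OF fi])
    fix x :: "complex^'n" assume "x \<in> ball 0 1"
    from power_mono[OF lt[OF this], of m]
    show "cmod (of_nat ((?n + m) choose m) * herm z x ^ m) \<le> of_nat ((?n + m) choose m) * norm z ^ m"
      by (simp add: norm_mult norm_power mult_left_mono)
  qed (auto intro!: continuous_intros)
  have fn: "integrable lborel (\<lambda>w. norm (indicator (ball 0 1) w *\<^sub>R f w))"
    using fi unfolding set_integrable_def by (rule integrable_norm)
  have "(\<lambda>m. integral\<^sup>L lborel (F m)) sums (LINT w|lborel. (\<Sum>m. F m w))"
  proof (rule sums_integral[OF Fi])
    show "AE w in lborel. summable (\<lambda>m. norm (F m w))"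
      by (intro always_eventually allI summable_comparison_test'[OF summable_mult[OF summ] ])
         (use bd in auto)
    show "summable (\<lambda>m. LINT w|lborel. norm (F m w))"
    proof (rule summable_comparison_test'[OF summable_mult[OF summ]])
      fix m
      have "(LINT w|lborel. norm (F m w)) \<le> (LINT w|lborel. norm (indicator (ball 0 1) w *\<^sub>R f w) * (of_nat ((?n + m) choose m) * norm z ^ m))"
        by (intro integral_mono integrable_norm Fi integrable_mult_left fn bd)
      thus "norm (LINT w|lborel. norm (F m w)) \<le> (LINT w|lborel. norm (indicator (ball 0 1) w *\<^sub>R f w)) * (of_nat ((?n + m) choose m) * norm z ^ m)"
        by simp
    qed
  qed
  moreover have "(\<Sum>m. F m w) = indicator (ball 0 1) w *\<^sub>R (f w / (1 - herm z w) ^ Suc ?n)" for w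
  proof (cases "w \<in> ball 0 1")
    case True
    have "(\<lambda>m. f w * (of_nat ((?n + m) choose m) * herm z w ^ m)) sums (f w * (1 / (1 - herm z w) ^ Suc ?n))"
      by (intro sums_mult negative_binomial_sums) (use lt[OF True] z in simp)
    thus ?thesis using True by (simp add: F_def sums_iff)
  qed (simp add: F_def)
  moreover have "integral\<^sup>L lborel (F m) = of_real (pi ^ ?n / fact ?n) * hpart f m z" for m
  proof -
    have "integral\<^sup>L lborel (F m) = of_nat ((?n + m) choose m) * (LINT w:ball 0 1|lborel. f w * herm z w ^ m)"
      unfolding F_def set_lebesgue_integral_def
      by (subst integral_mult_right_zero[symmetric]) (intro Bochner_Integration.integral_cong, auto)
    also have "\<dots> = of_real (of_nat ((?n + m) choose m) * (pi ^ ?n * fact m / fact (?n + m))) * hpart f m z"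
      by (simp add: moment[OF fi])
    \<comment> \<open>This cancellation fixes the kernel: the moment constants are, up to the volume
      of the ball, the reciprocals of the coefficients of (1 - x)^-(n+1).\<close>
    also have "of_nat ((?n + m) choose m) * (pi ^ ?n * fact m / fact (?n + m)) = pi ^ ?n / fact ?n"
      using binomial_fact[of m "?n + m", where ?'a=real] by simp
    finally show ?thesis .
  qed
  ultimately have "(\<lambda>m. of_real (pi ^ ?n / fact ?n) * hpart f m z) sums (LINT w:ball 0 1|lborel. f w / (1 - herm z w) ^ Suc ?n)"
    by (simp add: set_lebesgue_integral_def)
  from sums_unique2[OF this sums_mult[OF hpart_sums[OF f z]]] show ?thesis .
qed

end

subsection \<open>Derivatives of the reproducing formula\<close>

text \<open>The factor is the reciprocal of the volume of the unit ball, so the reproducing formula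
  holds with constant 1.\<close>

definition ball_mean :: "(complex^'n \<Rightarrow> complex) \<Rightarrow> complex"
  where "ball_mean g = of_real (fact CARD('n) / pi ^ CARD('n)) * (LINT w:ball 0 1|lborel. g w)"

lemma ball_mean_cong:
  assumes "\<And>w. norm w < 1 \<Longrightarrow> f w = g w" shows "ball_mean f = ball_mean g"
  unfolding ball_mean_def set_lebesgue_integral_def
  by (intro arg_cong2[where f="(*)"] Bochner_Integration.integral_cong refl) (auto simp: assms indicator_def)

lemma ball_mean_cmult: "ball_mean (\<lambda>w. c * f w) = c * ball_mean f"
  by (simp add: ball_mean_def)

lemma ball_mean_add:
  assumes "set_integrable lborel (ball 0 1) f" "set_integrable lborel (ball 0 1) g"
  shows "ball_mean (\<lambda>w. f w + g w) = ball_mean f + ball_mean g"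
  using set_integral_add(2)[OF assms] by (simp add: ball_mean_def algebra_simps)

lemma ball_mean_diff:
  assumes "set_integrable lborel (ball 0 1) f" "set_integrable lborel (ball 0 1) g"
  shows "ball_mean (\<lambda>w. f w - g w) = ball_mean f - ball_mean g"
  using set_integral_diff(2)[OF assms] by (simp add: ball_mean_def right_diff_distrib diff_divide_distrib)

lemma set_integrable_mult_continuous:
  fixes f h :: "complex^'n \<Rightarrow> complex"
  assumes f: "set_integrable lborel (ball 0 1) f" and h: "continuous_on (cball 0 1) h"
  shows "set_integrable lborel (ball 0 1) (\<lambda>x. f x * h x)"
proof -
  have "compact (h ` cball 0 1)" using h by (simp add: compact_continuous_image)
  then obtain K where "\<forall>y\<in>h ` cball 0 1. cmod y \<le> K"
    using compact_imp_bounded bounded_iff by blast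
  hence "cmod (h x) \<le> K" if "x \<in> ball 0 1" for x using that by simp
  moreover have "continuous_on (ball 0 1) h"
    using h ball_subset_cball by (rule continuous_on_subset)
  ultimately show ?thesis using f by (intro set_integrable_mult_bounded) auto
qed

text \<open>A bound on the real part rather than the modulus, because a half-plane is convex and
  Taylor's formula can be used on it.\<close>

lemma kernel_base_ge: "Re (1 - herm y w) \<ge> 1 - norm y" if "norm w \<le> 1"
proof -
  have "Re (herm y w) \<le> norm y * norm w"
    using complex_Re_le_cmod[of "herm y w"] norm_herm_le[of y w] by linarith
  also have "\<dots> \<le> norm y" using that by (simp add: mult_left_le)
  finally show ?thesis by simp
qed

lemma kernel_base_nonzero: "1 - herm y w \<noteq> 0" if "norm w \<le> 1" "norm y < 1"
  using kernel_base_ge[OF that(1), of y] that(2) by auto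

lemma kernel_base_nonzero': "1 - herm w y \<noteq> 0" if "norm w \<le> 1" "norm y < 1"
proof
  assume "1 - herm w y = 0"
  hence "1 - herm y w = 0" by (metis cnj_herm complex_cnj_one eq_iff_diff_eq_0)
  thus False using kernel_base_nonzero[OF that] by simp
qed

lemma continuous_on_kernel:
  "continuous_on (cball 0 1) (\<lambda>w :: complex^'n. 1 / (1 - herm y w) ^ j)" if "norm y < 1"
proof -
  have "(1 - herm y w) ^ j \<noteq> 0" if "w \<in> cball 0 1" for w
    using kernel_base_nonzero[of w y] that \<open>norm y < 1\<close> by simp
  thus ?thesis by (intro continuous_intros) auto
qed

lemma set_integrable_kernel:
  fixes g :: "complex^'n \<Rightarrow> complex"
  assumes "set_integrable lborel (ball 0 1) g" "norm y < 1"
  shows "set_integrable lborel (ball 0 1) (\<lambda>w. g w / (1 - herm y w) ^ j)"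
  using set_integrable_mult_continuous[OF assms(1) continuous_on_kernel[OF assms(2)], of j] by simp

lemma DERIV_inverse_power:
  fixes x :: complex assumes x: "x \<noteq> 0"
  shows "((\<lambda>x. 1 / x ^ j) has_field_derivative - of_nat j / x ^ Suc j) (at x)"
proof (induction j)
  case (Suc j)
  have "((\<lambda>x. 1 / x ^ j * (1 / x)) has_field_derivative
      1 / x ^ j * (- 1 / x\<^sup>2) + (- of_nat j / x ^ Suc j) * (1 / x)) (at x)"
    using x by (intro DERIV_mult' Suc) (auto intro!: derivative_eq_intros simp: power2_eq_square)
  thus ?case using x by (simp add: field_simps power2_eq_square)
qed auto

lemma inverse_power_taylor:
  fixes a b :: complex
  assumes e: "\<epsilon> > 0" and a: "Re a \<ge> \<epsilon>" and b: "Re b \<ge> \<epsilon>"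
  shows "cmod (1 / b ^ j - 1 / a ^ j + of_nat j * (b - a) / a ^ Suc j)
    \<le> real (j * Suc j) / \<epsilon> ^ (j + 2) * (cmod (b - a))\<^sup>2"
proof -
  define F where "F i x = (if i = 0 then 1 / x ^ j else if i = 1 then - of_nat j / x ^ Suc j
      else of_nat (j * Suc j) / x ^ Suc (Suc j))" for i :: nat and x :: complex
  have nz: "x \<noteq> 0" if "Re x \<ge> \<epsilon>" for x using that e by auto
  have "cmod (F 0 b - (\<Sum>i\<le>1. F i a * (b - a) ^ i / fact i))
      \<le> real (j * Suc j) / \<epsilon> ^ (j + 2) * cmod (b - a) ^ Suc 1 / fact 1"
  proof (rule complex_Taylor)
    show "convex {x. Re x \<ge> \<epsilon>}" by (rule convex_halfspace_Re_ge)
    show "a \<in> {x. Re x \<ge> \<epsilon>}" "b \<in> {x. Re x \<ge> \<epsilon>}" using a b by auto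
  next
    fix i x assume "x \<in> {x. Re x \<ge> \<epsilon>}" and i: "i \<le> (1::nat)"
    hence x: "x \<noteq> 0" using nz by auto
    consider "i = 0" | "i = 1" using i by linarith
    thus "(F i has_field_derivative F (Suc i) x) (at x within {x. Re x \<ge> \<epsilon>})"
    proof cases
      case 1
      show ?thesis using DERIV_inverse_power[OF x, of j] 1 by (simp add: F_def[abs_def] has_field_derivative_at_within)
    next
      case 2
      have "((\<lambda>x. - of_nat j / x ^ Suc j) has_field_derivative of_nat (j * Suc j) / x ^ Suc (Suc j)) (at x)"
      proof -
        have "(\<lambda>x. - of_nat j * (1 / x ^ Suc j)) = (\<lambda>x :: complex. - of_nat j / x ^ Suc j)"
          and "- of_nat j * (- of_nat (Suc j) / x ^ Suc (Suc j)) = of_nat (j * Suc j) / x ^ Suc (Suc j)"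
          by (auto simp: algebra_simps)
        thus ?thesis
          using DERIV_cmult[OF DERIV_inverse_power[OF x, of "Suc j"], of "- of_nat j"] by (simp only:)
      qed
      thus ?thesis using 2 by (simp add: F_def[abs_def] has_field_derivative_at_within)
    qed
  next
    fix x assume "x \<in> {x. Re x \<ge> \<epsilon>}"
    hence "cmod x \<ge> \<epsilon>" using complex_Re_le_cmod[of x] by auto
    moreover from this have "cmod x > 0" using e by linarith
    ultimately have "\<epsilon> ^ (j + 2) \<le> cmod x ^ (j + 2)" and "cmod x > 0"
      using e power_mono[of \<epsilon> "cmod x" "j + 2"] by auto
    hence "real (j * Suc j) / cmod x ^ (j + 2) \<le> real (j * Suc j) / \<epsilon> ^ (j + 2)"
      using e by (intro divide_left_mono mult_pos_pos zero_less_power) auto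
    moreover have "F (Suc 1) x = of_nat (j * Suc j) / x ^ (j + 2)" by (simp add: F_def)
    ultimately show "cmod (F (Suc 1) x) \<le> real (j * Suc j) / \<epsilon> ^ (j + 2)"
      by (simp only: norm_divide norm_power norm_of_nat)
  qed
  thus ?thesis by (simp add: F_def power2_eq_square algebra_simps)
qed

lemma has_vector_derivative_quadratic_error:
  fixes I :: "real \<Rightarrow> 'a::real_normed_vector"
  assumes "e > 0" and bd: "\<And>t. \<bar>t\<bar> < e \<Longrightarrow> norm (I t - I 0 - t *\<^sub>R D) \<le> M * t\<^sup>2"
  shows "(I has_vector_derivative D) (at 0)"
  unfolding has_vector_derivative_def
proof (rule has_derivativeI_sandwich[OF \<open>e > 0\<close>])
  show "((\<lambda>t. M * \<bar>t\<bar>) \<longlongrightarrow> 0) (at 0)"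
    by (auto intro!: tendsto_eq_intros)
  fix t :: real assume "t \<in> UNIV" "t \<noteq> 0" "dist t 0 < e"
  thus "norm (I t - I 0 - (t - 0) *\<^sub>R D) / norm (t - 0) \<le> M * \<bar>t\<bar>"
    using bd[of t] by (simp add: divide_le_eq power2_eq_square mult.assoc abs_mult_self_eq)
qed (simp add: bounded_linear_scaleR_left)

text \<open>Differentiation under the integral sign by a quadratic remainder that is uniform in
  \<open>w\<close>, taken from \<open>inverse_power_taylor\<close>. As \<open>g\<close> need only be
  integrable, the lemma applies again after \<open>g\<close> has been multiplied by a factor
  \<open>herm v w\<close>.\<close>

lemma kernel_derivative:
  fixes g :: "complex^'n \<Rightarrow> complex"
  assumes g: "set_integrable lborel (ball 0 1) g" and z: "norm z < 1"
  shows "((\<lambda>t. ball_mean (\<lambda>w. g w / (1 - herm (z + t *\<^sub>R v) w) ^ j)) has_vector_derivative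
    ball_mean (\<lambda>w. g w * (of_nat j * herm v w) / (1 - herm z w) ^ Suc j)) (at 0)"
proof -
  \<comment> \<open>Half the distance from \<open>z\<close> to the unit sphere; the perturbed points
    keep the other half.\<close>
  define \<epsilon> where "\<epsilon> = (1 - norm z) / 2"
  define C where "C = real (j * Suc j) / \<epsilon> ^ (j + 2) * (norm v)\<^sup>2"
  define c where "c = fact CARD('n) / pi ^ CARD('n)"
  have \<epsilon>: "\<epsilon> > 0" using z by (simp add: \<epsilon>_def)
  have c: "c \<ge> 0" by (simp add: c_def)
  have bm: "cmod (ball_mean R) \<le> c * (LINT w|lborel. cmod (indicator (ball 0 1) w *\<^sub>R R w))" for R :: "complex^'n \<Rightarrow> complex"
  proof -
    have "cmod (of_real (fact CARD('n) / pi ^ CARD('n))) = c"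
      by (simp add: c_def norm_divide norm_power)
    thus ?thesis unfolding ball_mean_def set_lebesgue_integral_def norm_mult
      by (simp only: mult_left_mono[OF integral_norm_bound c])
  qed
  have gh: "set_integrable lborel (ball 0 1) (\<lambda>w. g w * (of_nat j * herm v w) / (1 - herm z w) ^ Suc j)"
    by (intro set_integrable_kernel set_integrable_mult_continuous g z continuous_intros)
  have gn: "integrable lborel (\<lambda>w. cmod (indicator (ball 0 1) w *\<^sub>R g w))"
    using g unfolding set_integrable_def by (rule integrable_norm)
  let ?I = "\<lambda>t. ball_mean (\<lambda>w. g w / (1 - herm (z + t *\<^sub>R v) w) ^ j)"
  let ?D = "ball_mean (\<lambda>w. g w * (of_nat j * herm v w) / (1 - herm z w) ^ Suc j)"
  let ?M = "c * (C * (LINT w|lborel. cmod (indicator (ball 0 1) w *\<^sub>R g w)))"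
  show ?thesis
  proof (rule has_vector_derivative_quadratic_error)
    show "\<epsilon> / (norm v + 1) > 0" using \<epsilon> by (simp add: add_nonneg_pos)
    fix t :: real assume "\<bar>t\<bar> < \<epsilon> / (norm v + 1)"
    hence "\<bar>t\<bar> * (norm v + 1) < \<epsilon>"
      using add_nonneg_pos[OF norm_ge_zero[of v] zero_less_one] by (simp add: less_divide_eq)
    hence tv: "\<bar>t\<bar> * norm v < \<epsilon>" by (simp add: algebra_simps)
    have nt: "norm (z + t *\<^sub>R v) \<le> 1 - \<epsilon>"
    proof -
      have "norm (z + t *\<^sub>R v) \<le> norm z + \<bar>t\<bar> * norm v"
        using norm_triangle_ineq[of z "t *\<^sub>R v"] by simp
      also have "\<dots> \<le> norm z + \<epsilon>" using tv by simp
      also have "norm z = 1 - 2 * \<epsilon>" by (simp add: \<epsilon>_def field_simps)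
      finally show ?thesis by simp
    qed
    have zt: "norm (z + t *\<^sub>R v) < 1" using nt \<epsilon> by simp
    note i1 = set_integrable_kernel[OF g zt, of j] and i2 = set_integrable_kernel[OF g z, of j]
    let ?R = "\<lambda>w. g w / (1 - herm (z + t *\<^sub>R v) w) ^ j - g w / (1 - herm z w) ^ j
      - of_real t * (g w * (of_nat j * herm v w) / (1 - herm z w) ^ Suc j)"
    have i3: "set_integrable lborel (ball 0 1) (\<lambda>w. of_real t * (g w * (of_nat j * herm v w) / (1 - herm z w) ^ Suc j))"
      using gh by (intro set_integrable_mult_right) auto
    have "?I t - ?I 0 - t *\<^sub>R ?D = ball_mean ?R"
      (is "?lhs = _")
      unfolding scaleR_conv_of_real[where 'a=complex] ball_mean_cmult[symmetric]
      by (subst ball_mean_diff, rule set_integral_diff(1)[OF i1 i2], rule i3)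
         (simp add: ball_mean_diff[OF i1 i2])
    hence "cmod ?lhs = cmod (ball_mean ?R)" by (rule arg_cong)
    also have "\<dots> \<le> c * (LINT w|lborel. cmod (indicator (ball 0 1) w *\<^sub>R ?R w))"
      by (rule bm)
    also have "\<dots> \<le> c * (LINT w|lborel. (C * t\<^sup>2) * cmod (indicator (ball 0 1) w *\<^sub>R g w))"
    proof (rule mult_left_mono[OF integral_mono c])
      show "integrable lborel (\<lambda>w. cmod (indicator (ball 0 1) w *\<^sub>R ?R w))"
        using set_integral_diff(1)[OF set_integral_diff(1)[OF i1 i2] i3]
        unfolding set_integrable_def by (rule integrable_norm)
      show "integrable lborel (\<lambda>w. (C * t\<^sup>2) * cmod (indicator (ball 0 1) w *\<^sub>R g w))"
        using gn by (rule integrable_mult_right)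
      fix w :: "complex^'n"
      show "cmod (indicator (ball 0 1) w *\<^sub>R ?R w) \<le> (C * t\<^sup>2) * cmod (indicator (ball 0 1) w *\<^sub>R g w)"
      proof (cases "w \<in> ball 0 1")
        case True
        hence w: "norm w \<le> 1" by simp
        define a where "a = 1 - herm z w"
        define b where "b = 1 - herm (z + t *\<^sub>R v) w"
        have ra: "Re a \<ge> \<epsilon>" unfolding a_def
          using kernel_base_ge[OF w, of z] \<epsilon> by (simp add: \<epsilon>_def)
        have rb: "Re b \<ge> \<epsilon>" unfolding b_def
          using kernel_base_ge[OF w, of "z + t *\<^sub>R v"] nt by linarith
        have ba: "b - a = - of_real t * herm v w"
          by (simp add: a_def b_def herm_add_left herm_scaleR_left)
        have "?R w = g w * (1 / b ^ j - 1 / a ^ j + of_nat j * (b - a) / a ^ Suc j)"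
          unfolding ba a_def[symmetric] b_def[symmetric] by (simp add: algebra_simps diff_divide_distrib)
        hence "cmod (?R w) = cmod (g w) * cmod (1 / b ^ j - 1 / a ^ j + of_nat j * (b - a) / a ^ Suc j)"
          by (simp only: norm_mult)
        also have "\<dots> \<le> cmod (g w) * (real (j * Suc j) / \<epsilon> ^ (j + 2) * (cmod (b - a))\<^sup>2)"
          by (intro mult_left_mono inverse_power_taylor[OF \<epsilon> ra rb]) simp
        also have "\<dots> \<le> cmod (g w) * (real (j * Suc j) / \<epsilon> ^ (j + 2) * (\<bar>t\<bar> * norm v)\<^sup>2)"
        proof -
          have "cmod (herm v w) \<le> norm v"
            using norm_herm_le[of v w] mult_left_mono[OF w, of "norm v"] by simp
          hence "cmod (b - a) \<le> \<bar>t\<bar> * norm v"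
            by (simp add: ba norm_mult mult_left_mono)
          thus ?thesis using \<epsilon> by (intro mult_left_mono power_mono) auto
        qed
        also have "\<dots> = (C * t\<^sup>2) * cmod (g w)"
          by (simp add: C_def power_mult_distrib)
        finally show ?thesis using True by simp
      qed simp
    qed
    also have "\<dots> = ?M * t\<^sup>2"
      by (simp only: integral_mult_right_zero mult_ac)
    finally show "norm (?I t - ?I 0 - t *\<^sub>R ?D) \<le> ?M * t\<^sup>2" .
  qed
qed

section \<open>Analyticity of the representing functions\<close>

lemma cvec_analytic_on_diff:
  assumes "cvec_analytic_on f S" "cvec_analytic_on g S"
  shows "cvec_analytic_on (\<lambda>w. f w - g w) S"
  unfolding cvec_analytic_on_def
proof (intro conjI ballI)
  show "open S" using assms by (simp add: cvec_analytic_on_def)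
  fix z assume "z \<in> S"
  then obtain L M where "(f has_derivative L) (at z)" "\<And>c v. L (c *s v) = c * L v"
    "(g has_derivative M) (at z)" "\<And>c v. M (c *s v) = c * M v"
    using assms unfolding cvec_analytic_on_def by meson
  thus "\<exists>L. ((\<lambda>w. f w - g w) has_derivative L) (at z) \<and> (\<forall>c v. L (c *s v) = c * L v)"
    by (intro exI[of _ "\<lambda>v. L v - M v"]) (auto intro!: has_derivative_diff simp: algebra_simps)
qed

lemma cvec_analytic_on_mult:
  assumes "cvec_analytic_on f S" "cvec_analytic_on g S"
  shows "cvec_analytic_on (\<lambda>w. f w * g w) S"
  unfolding cvec_analytic_on_def
proof (intro conjI ballI)
  show "open S" using assms by (simp add: cvec_analytic_on_def)
  fix z assume "z \<in> S"
  then obtain L M where "(f has_derivative L) (at z)" "\<And>c v. L (c *s v) = c * L v"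
    "(g has_derivative M) (at z)" "\<And>c v. M (c *s v) = c * M v"
    using assms unfolding cvec_analytic_on_def by meson
  thus "\<exists>L. ((\<lambda>w. f w * g w) has_derivative L) (at z) \<and> (\<forall>c v. L (c *s v) = c * L v)"
    by (intro exI[of _ "\<lambda>v. f z * M v + L v * g z"] conjI has_derivative_mult) (auto simp: algebra_simps)
qed

lemma bounded_linear_herm: "bounded_linear (\<lambda>w. herm w v)"
  by (rule bounded_linear_intro[of _ "norm v"])
     (simp_all add: herm_add_left herm_scaleR_left scaleR_conv_of_real[where 'a=complex] norm_herm_le)

lemma cvec_analytic_on_herm:
  assumes "open S" "\<And>w. w \<in> S \<Longrightarrow> (\<phi> has_field_derivative \<phi>' w) (at (herm w v))"
  shows "cvec_analytic_on (\<lambda>w. \<phi> (herm w v)) S"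
  unfolding cvec_analytic_on_def
proof (intro conjI ballI \<open>open S\<close>)
  fix z assume z: "z \<in> S"
  have "((\<lambda>w. herm w v) has_derivative (\<lambda>w. herm w v)) (at z)"
    by (rule bounded_linear_imp_has_derivative[OF bounded_linear_herm])
  from diff_chain_at[OF this, of \<phi> "(*) (\<phi>' z)"] assms(2)[OF z]
  have "((\<lambda>w. \<phi> (herm w v)) has_derivative (\<lambda>u. \<phi>' z * herm u v)) (at z)"
    by (simp add: o_def has_field_derivative_def)
  thus "\<exists>L. ((\<lambda>w. \<phi> (herm w v)) has_derivative L) (at z) \<and> (\<forall>c v. L (c *s v) = c * L v)"
    by (intro exI[of _ "\<lambda>u. \<phi>' z * herm u v"]) (simp add: herm_smult_left)
qed

text \<open>The kernel is conjugate analytic in \<open>w\<close>; its conjugate, with swapped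
  arguments, is analytic, so the reproducing formula can be applied to it as well.\<close>

lemma cvec_analytic_on_conj_kernel:
  fixes z :: "complex^'n"
  assumes "norm z < 1"
  shows "cvec_analytic_on (\<lambda>w. 1 / (1 - herm w z) ^ j) (ball 0 1)"
proof (rule cvec_analytic_on_herm[where \<phi>="\<lambda>x. 1 / (1 - x) ^ j"])
  fix w assume "w \<in> ball (0 :: complex^'n) 1"
  hence nz: "1 - herm w z \<noteq> 0" using kernel_base_nonzero'[of w z] assms by auto
  have "((\<lambda>x. 1 - x) has_field_derivative -1) (at (herm w z))"
    by (auto intro!: derivative_eq_intros)
  from DERIV_chain2[OF DERIV_inverse_power[OF nz] this]
  show "((\<lambda>x. 1 / (1 - x) ^ j) has_field_derivative
      - of_nat j / (1 - herm w z) ^ Suc j * -1) (at (herm w z))" .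
qed simp

lemma cvec_analytic_on_herm_power:
  "cvec_analytic_on (\<lambda>w. c * herm w v ^ k) (ball 0 1)"
proof (rule cvec_analytic_on_herm[where \<phi>="\<lambda>x. c * x ^ k"])
  show "((\<lambda>x. c * x ^ k) has_field_derivative c * (of_nat k * herm w v ^ (k - 1))) (at (herm w v))" for w
    by (auto intro!: derivative_eq_intros)
qed simp

lemma set_integrable_continuous:
  assumes "continuous_on (cball 0 1) h"
  shows "set_integrable lborel (ball (0 :: complex^'n) 1) (h :: _ \<Rightarrow> complex)"
proof -
  have "set_integrable lborel (ball (0 :: complex^'n) 1) (\<lambda>_. 1 :: complex)"
    by (simp add: set_integrable_def emeasure_ball)
  from set_integrable_mult_continuous[OF this assms] show ?thesis by simp
qed

subsection \<open>First and second derivatives through the kernel\<close>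

abbreviation kexp :: "'n itself \<Rightarrow> nat" where "kexp _ \<equiv> Suc CARD('n)"

text \<open>The directional derivative, taken as the differentiated reproducing formula: in this
  form it is an integral of \<open>f\<close> against an explicit function, ready for
  Cauchy-Schwarz.\<close>

definition D1 :: "(complex^'n \<Rightarrow> complex) \<Rightarrow> complex^'n \<Rightarrow> complex^'n \<Rightarrow> complex"
  where "D1 f z v = ball_mean (\<lambda>w. f w * (of_nat (kexp TYPE('n)) * herm v w) / (1 - herm z w) ^ Suc (kexp TYPE('n)))"

definition D2 :: "(complex^'n \<Rightarrow> complex) \<Rightarrow> complex^'n \<Rightarrow> complex^'n \<Rightarrow> complex^'n \<Rightarrow> complex"
  where "D2 f z u v = ball_mean (\<lambda>w. f w * (of_nat (kexp TYPE('n)) * herm v w)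
    * (of_nat (Suc (kexp TYPE('n))) * herm u w) / (1 - herm z w) ^ Suc (Suc (kexp TYPE('n))))"

context
  fixes f :: "complex^'n \<Rightarrow> complex"
  assumes f: "cvec_analytic_on f (ball 0 1)" and fi: "set_integrable lborel (ball 0 1) f"
begin

lemma reproducing_mean:
  assumes "norm z < 1"
  shows "ball_mean (\<lambda>w. f w / (1 - herm z w) ^ kexp TYPE('n)) = f z"
  using reproducing[OF f fi assms] by (simp add: ball_mean_def)

lemma line_in_ball:
  assumes "norm z < 1"
  obtains e where "e > 0" "\<And>t. \<bar>t\<bar> < e \<Longrightarrow> norm (z + t *\<^sub>R v :: complex^'n) < 1"
proof
  show "(1 - norm z) / (norm v + 1) > 0" using assms by (simp add: add_nonneg_pos)
  fix t :: real assume "\<bar>t\<bar> < (1 - norm z) / (norm v + 1)"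
  hence "\<bar>t\<bar> * (norm v + 1) < 1 - norm z"
    using add_nonneg_pos[OF norm_ge_zero[of v] zero_less_one] by (simp add: less_divide_eq)
  hence "\<bar>t\<bar> * norm v < 1 - norm z" by (simp add: algebra_simps)
  thus "norm (z + t *\<^sub>R v) < 1" using norm_triangle_ineq[of z "t *\<^sub>R v"] by simp
qed

lemma D1_derivative:
  assumes z: "norm z < 1"
  shows "((\<lambda>t. f (z + t *\<^sub>R v)) has_vector_derivative D1 f z v) (at 0)"
proof -
  obtain e where e: "e > 0" "\<And>t. \<bar>t\<bar> < e \<Longrightarrow> norm (z + t *\<^sub>R v) < 1"
    using line_in_ball[OF z] by blast
  show ?thesis
  proof (rule has_vector_derivative_transform_within[OF _ \<open>e > 0\<close>])
    show "((\<lambda>t. ball_mean (\<lambda>w. f w / (1 - herm (z + t *\<^sub>R v) w) ^ kexp TYPE('n))) has_vector_derivative D1 f z v) (at 0)"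
      unfolding D1_def by (rule kernel_derivative[OF fi z])
  qed (use e reproducing_mean in \<open>auto simp: dist_real_def\<close>)
qed

lemma D2_derivative:
  assumes z: "norm z < 1"
  shows "((\<lambda>t. D1 f (z + t *\<^sub>R u) v) has_vector_derivative D2 f z u v) (at 0)"
  unfolding D1_def D2_def
  by (intro kernel_derivative z set_integrable_mult_continuous fi continuous_intros)

text \<open>The integrand contains \<open>u\<close> and \<open>v\<close> through a symmetric
  product, so the diagonal, which is all that Cauchy-Schwarz will estimate, determines the
  rest.\<close>

lemma D2_polarization:
  assumes z: "norm z < 1"
  shows "D2 f z u v = (D2 f z (u + v) (u + v) - D2 f z (u - v) (u - v)) / 4"
proof -
  let ?N = "kexp TYPE('n)"
  have int: "set_integrable lborel (ball 0 1) (\<lambda>w. f w * (of_nat ?N * herm a w) * (of_nat (Suc ?N) * herm a w)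
      / (1 - herm z w) ^ Suc (Suc ?N))" for a
    by (intro set_integrable_kernel set_integrable_mult_continuous fi z continuous_intros)
  have "herm (u - v) w = herm u w - herm v w" for w
    by (simp add: herm_def algebra_simps sum_subtractf)
  moreover have "a * (n * (X + Y)) * (m * (X + Y)) / D - a * (n * (X - Y)) * (m * (X - Y)) / D
      = 4 * (a * (n * Y) * (m * X) / D)" for a n m X Y D :: complex
    unfolding diff_divide_distrib[symmetric] times_divide_eq_right
    by (rule arg_cong[where f="\<lambda>x. x / D"]) algebra
  ultimately have "D2 f z (u + v) (u + v) - D2 f z (u - v) (u - v) = ball_mean (\<lambda>w. 4 * (f w * (of_nat ?N * herm v w)
    * (of_nat (Suc ?N) * herm u w) / (1 - herm z w) ^ Suc (Suc ?N)))"
    unfolding D2_def ball_mean_diff[OF int int, symmetric]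
    by (intro ball_mean_cong) (simp only: herm_add_left)
  also have "\<dots> = 4 * D2 f z u v"
    by (simp only: ball_mean_cmult D2_def)
  finally show ?thesis by simp
qed

lemma D2_scaleR: "D2 f z (r *\<^sub>R v) (r *\<^sub>R v) = of_real (r\<^sup>2) * D2 f z v v"
  unfolding D2_def ball_mean_cmult[symmetric]
  by (intro ball_mean_cong) (simp add: herm_scaleR_left power2_eq_square mult_ac)

lemma D1_scaleR: "D1 f z (r *\<^sub>R v) = of_real r * D1 f z v"
  unfolding D1_def ball_mean_cmult[symmetric]
  by (intro ball_mean_cong) (simp add: herm_scaleR_left mult_ac)

end

text \<open>The squared Bergman norm on the unit ball.\<close>

definition l2sq :: "(complex^'n \<Rightarrow> complex) \<Rightarrow> real"
  where "l2sq f = Re (ball_mean (\<lambda>w. f w * cnj (f w)))"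

lemma ball_mean_Re_nonneg:
  assumes "\<And>w. norm w < 1 \<Longrightarrow> Re (g w) \<ge> 0" "set_integrable lborel (ball 0 1) g"
  shows "Re (ball_mean g) \<ge> 0"
proof -
  have "Re (LINT w:ball 0 1|lborel. g w) = (LINT w:ball 0 1|lborel. Re (g w))"
    using integral_Re[OF assms(2)[unfolded set_integrable_def]]
    unfolding set_lebesgue_integral_def by simp
  also have "\<dots> \<ge> 0"
    unfolding set_lebesgue_integral_def
    by (rule Bochner_Integration.integral_nonneg) (use assms(1) in \<open>auto simp: indicator_def\<close>)
  finally show ?thesis
    unfolding ball_mean_def times_complex.sel Re_complex_of_real Im_complex_of_real by simp
qed

text \<open>The mean of |f - s a h|^2 is nonnegative for all real \<open>s\<close>, where
  \<open>a\<close> is the pairing of \<open>f\<close> with \<open>h\<close>; the phase of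
  \<open>a\<close> makes the cross term real.\<close>

lemma cauchy_schwarz_mean:
  fixes f h :: "complex^'n \<Rightarrow> complex"
  assumes fi: "set_integrable lborel (ball 0 1) f"
    and f2: "set_integrable lborel (ball 0 1) (\<lambda>w. f w * cnj (f w))"
    and h: "continuous_on (cball 0 1) h"
  shows "(cmod (ball_mean (\<lambda>w. f w * cnj (h w))))\<^sup>2 \<le> l2sq f * l2sq h"
proof -
  define a where "a = ball_mean (\<lambda>w. f w * cnj (h w))"
  define A where "A = (cmod a)\<^sup>2"
  have i1: "set_integrable lborel (ball 0 1) (\<lambda>w. f w * cnj (h w))"
    by (intro set_integrable_mult_continuous fi continuous_intros h)
  have i2: "set_integrable lborel (ball 0 1) (\<lambda>w. h w * cnj (h w))"
    by (intro set_integrable_continuous continuous_intros h)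
  have A: "cnj a * a = of_real A" using complex_norm_square[of a] by (simp add: A_def mult.commute)
  have nonneg: "0 \<le> l2sq f - 2 * s * A + s\<^sup>2 * A * l2sq h" for s :: real
  proof -
    let ?g = "\<lambda>w. (f w * cnj (f w) - (2 * of_real s * cnj a) * (f w * cnj (h w))) + (of_real (s\<^sup>2) * (cnj a * a)) * (h w * cnj (h w))"
    have "Re (?g w) = (cmod (f w - of_real s * a * h w))\<^sup>2" for w
      unfolding cmod_power2 by (simp add: power2_eq_square algebra_simps)
    moreover have int: "set_integrable lborel (ball 0 1) ?g"
      by (intro set_integral_add set_integral_diff set_integrable_mult_right f2 impI i1 i2)
    ultimately have "0 \<le> Re (ball_mean ?g)"
      by (intro ball_mean_Re_nonneg) auto
    also have "ball_mean ?g = ball_mean (\<lambda>w. f w * cnj (f w)) - (2 * of_real s * cnj a) * a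
        + (of_real (s\<^sup>2) * (cnj a * a)) * ball_mean (\<lambda>w. h w * cnj (h w))"
      unfolding a_def ball_mean_cmult[symmetric]
      by (subst ball_mean_add, intro set_integral_diff set_integrable_mult_right f2 impI i1,
          intro set_integrable_mult_right impI i2, subst ball_mean_diff[OF f2], intro set_integrable_mult_right impI i1) simp
    also have "\<dots> = ball_mean (\<lambda>w. f w * cnj (f w)) - of_real (2 * s * A) + of_real (s\<^sup>2 * A) * ball_mean (\<lambda>w. h w * cnj (h w))"
      by (simp only: mult.assoc A) simp
    finally show ?thesis by (simp add: l2sq_def)
  qed
  have H: "l2sq h \<ge> 0" unfolding l2sq_def
    by (rule ball_mean_Re_nonneg[OF _ i2]) (simp add: complex_mult_cnj)
  have "A \<ge> 0" by (simp add: A_def)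
  have "A \<le> l2sq f * l2sq h"
  \<comment> \<open>The optimal \<open>s\<close> is the reciprocal of \<open>l2sq h\<close>. If
    \<open>l2sq h\<close> vanishes while \<open>A\<close> does not, the quadratic is affine in
    \<open>s\<close> and becomes negative.\<close>
  proof (cases "l2sq h = 0 \<or> A = 0")
    case False
    hence "0 \<le> l2sq f - A / l2sq h"
      using nonneg[of "1 / l2sq h"] by (simp add: power2_eq_square field_simps)
    thus ?thesis using False H by (simp add: field_simps)
  next
    case True
    have "A = 0"
    proof (rule ccontr)
      assume "A \<noteq> 0"
      with True have "l2sq h = 0" by simp
      with nonneg[of "(l2sq f + 1) / (2 * A)"] nonneg[of 0] \<open>A \<noteq> 0\<close> show False by simp
    qed
    thus ?thesis using nonneg[of 0] H by simp
  qed
  thus ?thesis by (simp add: A_def a_def)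
qed

subsection \<open>Sharp bounds at a point\<close>

text \<open>On the line z + t v with |v| = 1, \<open>herm w v\<close> becomes \<beta> + t and
  \<open>1 - herm w z\<close> becomes \<delta> - t \<alpha>; the representing functions restrict to
  combinations of such quotients.\<close>

lemma DERIV_kernel_line:
  fixes x \<alpha> \<beta> t :: complex
  assumes "x - t * \<alpha> \<noteq> 0"
  shows "((\<lambda>t. (\<beta> + t) ^ k * (1 / (x - t * \<alpha>) ^ j)) has_field_derivative
    of_nat k * (\<beta> + t) ^ (k - 1) * (1 / (x - t * \<alpha>) ^ j) + (\<beta> + t) ^ k * (of_nat j * \<alpha> / (x - t * \<alpha>) ^ Suc j)) (at t)"
proof -
  have "((\<lambda>t. x - t * \<alpha>) has_field_derivative - \<alpha>) (at t)"
    by (auto intro!: derivative_eq_intros)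
  from DERIV_chain2[OF DERIV_inverse_power[OF assms] this]
  have 1: "((\<lambda>t. 1 / (x - t * \<alpha>) ^ j) has_field_derivative of_nat j * \<alpha> / (x - t * \<alpha>) ^ Suc j) (at t)"
    by simp
  have "((\<lambda>t. (\<beta> + t) ^ k) has_field_derivative of_nat k * (\<beta> + t) ^ (k - 1)) (at t)"
    by (auto intro!: derivative_eq_intros)
  from DERIV_mult'[OF this 1] show ?thesis by (simp add: add.commute)
qed

lemma has_vector_derivative_of_real_shift:
  assumes "(E has_field_derivative D) (at (of_real t))"
  shows "((\<lambda>s. E (of_real (t + s) :: complex)) has_vector_derivative D) (at 0)"
proof -
  have "((\<lambda>s. of_real t + s) has_field_derivative 1) (at (of_real 0 :: complex))"
    by (auto intro!: derivative_eq_intros)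
  moreover have "(E has_field_derivative D) (at (of_real t + of_real 0))" using assms by simp
  ultimately have "((\<lambda>s. E (of_real t + s)) has_field_derivative D * 1) (at (of_real 0))"
    by (rule DERIV_chain2[rotated])
  from has_vector_derivative_real_field[OF this, of UNIV] show ?thesis by simp
qed

context
  fixes z v :: "complex^'n" and \<delta> :: real and \<alpha> \<beta> :: complex and N :: nat and a :: real
  assumes z: "norm z < 1" and v: "norm v = 1"
  defines "\<delta> \<equiv> 1 - (norm z)\<^sup>2" and "\<alpha> \<equiv> herm v z" and "\<beta> \<equiv> herm z v" and "a \<equiv> (cmod (herm z v))\<^sup>2"
    and "N \<equiv> Suc CARD('n)"
begin

lemma \<delta>_pos: "\<delta> > 0" and \<delta>_le: "\<delta> \<le> 1"
  using z by (auto simp: \<delta>_def abs_square_less_1)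

lemma a_bounds: "0 \<le> a" "a \<le> 1 - \<delta>"
proof -
  have "cmod (herm z v) \<le> norm z" using norm_herm_le[of z v] v by simp
  hence "a \<le> (norm z)\<^sup>2" unfolding a_def by (intro power_mono) auto
  thus "a \<le> 1 - \<delta>" by (simp add: \<delta>_def)
qed (simp add: a_def)

lemma \<alpha>\<beta>: "\<alpha> * \<beta> = of_real a"
  using complex_norm_square[of "herm z v"] by (simp add: a_def \<alpha>_def \<beta>_def cnj_herm mult.commute)

lemma herm_line: "herm (z + t *\<^sub>R v) v = \<beta> + of_real t"
  by (simp add: herm_add_left herm_scaleR_left \<beta>_def herm_self v)

lemma kernel_line: "1 - herm (z + t *\<^sub>R v) z = of_real \<delta> - of_real t * \<alpha>"
  by (simp add: herm_add_left herm_scaleR_left \<alpha>_def herm_self \<delta>_def)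

lemma D1_bound_unit:
  assumes f: "cvec_analytic_on f (ball 0 1)" and fi: "set_integrable lborel (ball 0 1) f"
    and f2: "set_integrable lborel (ball 0 1) (\<lambda>w. f w * cnj (f w))"
  shows "(cmod (D1 f z v))\<^sup>2 \<le> l2sq f * (real (N * Suc N) / \<delta> ^ (N + 2))"
proof -
  \<comment> \<open>The representing function: \<open>cnj (h w)\<close> is the weight in
    \<open>D1\<close>. Hence its squared norm is \<open>D1 h z v\<close>, an ordinary derivative of
    the explicit function \<open>E\<close>.\<close>
  define h where "h w = (of_nat N * herm w v ^ 1) * (1 / (1 - herm w z) ^ Suc N)" for w
  have nz: "1 - herm w z \<noteq> 0" if "w \<in> cball 0 1" for w
    using kernel_base_nonzero'[of w z] that z by auto
  have ha: "cvec_analytic_on h (ball 0 1)"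
    unfolding h_def[abs_def]
    by (intro cvec_analytic_on_mult cvec_analytic_on_herm_power cvec_analytic_on_conj_kernel z)
  have hc: "continuous_on (cball 0 1) h"
    unfolding h_def by (intro continuous_intros) (use nz in auto)
  have hi: "set_integrable lborel (ball 0 1) h" by (rule set_integrable_continuous[OF hc])
  have cnjh: "g w * cnj (h w) = g w * (of_nat N * herm v w) / (1 - herm z w) ^ Suc N" for g :: "complex^'n \<Rightarrow> complex" and w
    by (simp add: h_def cnj_herm)
  have D: "ball_mean (\<lambda>w. g w * cnj (h w)) = D1 g z v" for g
    by (simp only: D1_def cnjh N_def)
  define E where "E t = of_nat N * ((\<beta> + t) ^ 1 * (1 / (of_real \<delta> - t * \<alpha>) ^ Suc N))" for t
  have "D1 h z v = of_nat N * (of_nat 1 * (\<beta> + 0) ^ (1 - 1) * (1 / (of_real \<delta> - 0 * \<alpha>) ^ Suc N)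
      + (\<beta> + 0) ^ 1 * (of_nat (Suc N) * \<alpha> / (of_real \<delta> - 0 * \<alpha>) ^ Suc (Suc N)))" (is "_ = ?E1")
  proof (rule vector_derivative_unique_at[OF D1_derivative[OF ha hi z]])
    have "(E has_field_derivative ?E1) (at (of_real 0))"
      unfolding E_def of_real_0 by (intro DERIV_cmult DERIV_kernel_line) (use \<delta>_pos in simp)
    from has_vector_derivative_of_real_shift[OF this]
    show "((\<lambda>t. h (z + t *\<^sub>R v)) has_vector_derivative ?E1) (at 0)"
      by (simp add: h_def E_def herm_line kernel_line mult.assoc)
  qed
  also have "\<dots> = of_nat N * (of_real \<delta> + of_nat (Suc N) * (\<alpha> * \<beta>)) / of_real \<delta> ^ (N + 2)"
    using \<delta>_pos by (simp add: field_simps)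
  also have "\<dots> = of_real (real N * (\<delta> + real (Suc N) * a) / \<delta> ^ (N + 2))"
    by (simp add: \<alpha>\<beta>)
  finally have "l2sq h = real N * (\<delta> + real (Suc N) * a) / \<delta> ^ (N + 2)"
    by (simp only: l2sq_def D Re_complex_of_real)
  also have "\<dots> \<le> real N * real (Suc N) / \<delta> ^ (N + 2)"
  proof (intro divide_right_mono mult_left_mono)
    have "real (Suc N) * a \<le> real (Suc N) * (1 - \<delta>)" using a_bounds by (intro mult_left_mono) auto
    moreover have "\<delta> * real N \<ge> 0" using \<delta>_pos by simp
    ultimately show "\<delta> + real (Suc N) * a \<le> real (Suc N)" by (simp add: algebra_simps)
  qed (use \<delta>_pos in auto)
  finally have H: "l2sq h \<le> real (N * Suc N) / \<delta> ^ (N + 2)" by (simp only: of_nat_mult)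
  have "l2sq f \<ge> 0" unfolding l2sq_def
    by (rule ball_mean_Re_nonneg[OF _ f2]) (simp add: complex_mult_cnj)
  hence "l2sq f * l2sq h \<le> l2sq f * (real (N * Suc N) / \<delta> ^ (N + 2))"
    by (rule mult_left_mono[OF H])
  thus ?thesis using cauchy_schwarz_mean[OF fi f2 hc] by (simp only: D)
qed

text \<open>The multiple of \<open>f z\<close> that is subtracted makes the representing function of the
  functional vanish at \<open>z\<close>.\<close>

definition "pcoeff = of_nat (N * Suc N) * \<alpha>\<^sup>2 / of_real \<delta> ^ 2"

lemma norm_pcoeff: "cmod pcoeff \<le> real (N * Suc N) / \<delta>\<^sup>2"
proof -
  have "cmod \<alpha> = cmod (herm z v)" unfolding \<alpha>_def by (metis cnj_herm complex_mod_cnj)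
  hence "(cmod \<alpha>)\<^sup>2 = a" by (simp add: a_def)
  hence "cmod pcoeff = real (N * Suc N) * a / \<delta>\<^sup>2"
    using \<delta>_pos unfolding pcoeff_def norm_divide norm_mult norm_power norm_of_nat by simp
  also have "\<dots> \<le> real (N * Suc N) * 1 / \<delta>\<^sup>2"
    using a_bounds \<delta>_pos by (intro divide_right_mono mult_left_mono) auto
  finally show ?thesis by simp
qed

text \<open>The function \<open>h\<close> representing the corrected functional is the orthogonal
  projection of the one representing \<open>D2\<close> onto the functions that vanish at
  \<open>z\<close>. Since \<open>h z = 0\<close>, its squared norm is \<open>D2 h z v v\<close>
  alone.\<close>

lemma D2_bound_unit:
  assumes f: "cvec_analytic_on f (ball 0 1)" and fi: "set_integrable lborel (ball 0 1) f"
    and f2: "set_integrable lborel (ball 0 1) (\<lambda>w. f w * cnj (f w))"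
  shows "(cmod (D2 f z v v - pcoeff * f z))\<^sup>2 \<le> l2sq f * (real (N * Suc N * (4 * N + 6)) / \<delta> ^ (N + 4))"
proof -
  define K :: complex where "K = of_nat (N * Suc N)"
  define c where "c = K * \<beta>\<^sup>2 / of_real \<delta> ^ 2"
  define h where "h w = (K * herm w v ^ 2) * (1 / (1 - herm w z) ^ (N + 2)) - (c * herm w v ^ 0) * (1 / (1 - herm w z) ^ N)" for w
  have cnjc: "cnj c = pcoeff" by (simp add: c_def pcoeff_def K_def \<alpha>_def \<beta>_def cnj_herm)
  have nz: "1 - herm w z \<noteq> 0" if "w \<in> cball 0 1" for w
    using kernel_base_nonzero'[of w z] that z by auto
  have ha: "cvec_analytic_on h (ball 0 1)"
    unfolding h_def[abs_def]
    by (intro cvec_analytic_on_diff cvec_analytic_on_mult cvec_analytic_on_herm_power cvec_analytic_on_conj_kernel z)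
  have hc: "continuous_on (cball 0 1) h"
    unfolding h_def by (intro continuous_intros) (use nz in auto)
  have hi: "set_integrable lborel (ball 0 1) h" by (rule set_integrable_continuous[OF hc])
  have cnjh: "g w * cnj (h w) = g w * (of_nat N * herm v w) * (of_nat (Suc N) * herm v w) / (1 - herm z w) ^ Suc (Suc N)
      - pcoeff * (g w / (1 - herm z w) ^ N)" for g :: "complex^'n \<Rightarrow> complex" and w
  proof -
    have "cnj (h w) = (K * herm v w ^ 2) * (1 / (1 - herm z w) ^ (N + 2)) - pcoeff * (1 / (1 - herm z w) ^ N)"
      by (simp add: h_def cnj_herm cnjc K_def)
    thus ?thesis by (simp add: K_def right_diff_distrib power2_eq_square mult_ac) (auto simp: algebra_simps)
  qed
  have D: "ball_mean (\<lambda>w. g w * cnj (h w)) = D2 g z v v - pcoeff * g z"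
    if g: "cvec_analytic_on g (ball 0 1)" and gi: "set_integrable lborel (ball 0 1) g" for g
  proof -
    have "ball_mean (\<lambda>w. g w * cnj (h w)) = ball_mean (\<lambda>w. g w * (of_nat N * herm v w) * (of_nat (Suc N) * herm v w) / (1 - herm z w) ^ Suc (Suc N))
       - ball_mean (\<lambda>w. pcoeff * (g w / (1 - herm z w) ^ N))"
      unfolding cnjh
      by (intro ball_mean_diff set_integrable_mult_right set_integrable_kernel set_integrable_mult_continuous gi z continuous_intros impI)
    thus ?thesis
      unfolding ball_mean_cmult using reproducing_mean[OF g gi z] by (simp only: D2_def N_def)
  qed
  have hz: "h z = 0"
  proof -
    have "1 - herm z z = of_real \<delta>" by (simp add: herm_self \<delta>_def)
    thus ?thesis using \<delta>_pos by (simp add: h_def c_def \<beta>_def power_add power2_eq_square)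
  qed
  define E where "E t = K * ((\<beta> + t) ^ 2 * (1 / (of_real \<delta> - t * \<alpha>) ^ (N + 2)))
     - c * ((\<beta> + t) ^ 0 * (1 / (of_real \<delta> - t * \<alpha>) ^ N))" for t
  \<comment> \<open>\<open>E\<close> is \<open>h\<close> on the line, \<open>E1\<close> its
    derivative and \<open>E2\<close> the second derivative at 0, in the raw form in which
    \<open>DERIV_kernel_line\<close> yields them.\<close>
  define E1 where "E1 t = K * (of_nat 2 * (\<beta> + t) ^ (2 - 1) * (1 / (of_real \<delta> - t * \<alpha>) ^ (N + 2))
       + (\<beta> + t) ^ 2 * (of_nat (N + 2) * \<alpha> / (of_real \<delta> - t * \<alpha>) ^ Suc (N + 2)))
     - c * (of_nat 0 * (\<beta> + t) ^ (0 - 1) * (1 / (of_real \<delta> - t * \<alpha>) ^ N)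
       + (\<beta> + t) ^ 0 * (of_nat N * \<alpha> / (of_real \<delta> - t * \<alpha>) ^ Suc N))" for t
  define E2 where "E2 = 2 * K * (of_nat 1 * (\<beta> + 0) ^ (1 - 1) * (1 / (of_real \<delta> - 0 * \<alpha>) ^ (N + 2))
       + (\<beta> + 0) ^ 1 * (of_nat (N + 2) * \<alpha> / (of_real \<delta> - 0 * \<alpha>) ^ Suc (N + 2)))
     + (K * of_nat (N + 2) * \<alpha>) * (of_nat 2 * (\<beta> + 0) ^ (2 - 1) * (1 / (of_real \<delta> - 0 * \<alpha>) ^ Suc (N + 2))
       + (\<beta> + 0) ^ 2 * (of_nat (Suc (N + 2)) * \<alpha> / (of_real \<delta> - 0 * \<alpha>) ^ Suc (Suc (N + 2))))
     - (c * of_nat N * \<alpha>) * (of_nat 0 * (\<beta> + 0) ^ (0 - 1) * (1 / (of_real \<delta> - 0 * \<alpha>) ^ Suc N)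
       + (\<beta> + 0) ^ 0 * (of_nat (Suc N) * \<alpha> / (of_real \<delta> - 0 * \<alpha>) ^ Suc (Suc N)))"
  have E: "(E has_field_derivative E1 t) (at t)" if "of_real \<delta> - t * \<alpha> \<noteq> 0" for t
    unfolding E_def E1_def by (intro DERIV_diff DERIV_cmult DERIV_kernel_line that)
  have E1': "(E1 has_field_derivative E2) (at 0)"
  proof -
    have "E1 = (\<lambda>t. 2 * K * ((\<beta> + t) ^ 1 * (1 / (of_real \<delta> - t * \<alpha>) ^ (N + 2)))
      + (K * of_nat (N + 2) * \<alpha>) * ((\<beta> + t) ^ 2 * (1 / (of_real \<delta> - t * \<alpha>) ^ Suc (N + 2)))
      - (c * of_nat N * \<alpha>) * ((\<beta> + t) ^ 0 * (1 / (of_real \<delta> - t * \<alpha>) ^ Suc N)))"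
      by (rule ext) (simp add: E1_def algebra_simps)
    thus ?thesis unfolding E2_def
      by (simp only:) (intro DERIV_diff DERIV_add DERIV_cmult DERIV_kernel_line, use \<delta>_pos in auto)
  qed
  have hE: "h (z + t *\<^sub>R v) = E (of_real t)" for t
    by (simp add: h_def E_def herm_line kernel_line mult.assoc)
  obtain e where e: "e > 0" "\<And>t. \<bar>t\<bar> < e \<Longrightarrow> norm (z + t *\<^sub>R v) < 1"
    using line_in_ball[OF ha hi z] by blast
  \<comment> \<open>Needed for all small \<open>t\<close>, not just at 0, because \<open>D2\<close>
    is the derivative of \<open>D1\<close> along the line.\<close>
  have D1E: "E1 (of_real t) = D1 h (z + t *\<^sub>R v) v" if "\<bar>t\<bar> < e" for t
  proof (rule vector_derivative_unique_at[OF _ D1_derivative[OF ha hi e(2)[OF that]]])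
    have "1 - herm (z + t *\<^sub>R v) z \<noteq> 0" by (rule nz) (use e(2)[OF that] in simp)
    hence "of_real \<delta> - of_real t * \<alpha> \<noteq> 0" unfolding kernel_line .
    from has_vector_derivative_of_real_shift[OF E[OF this]]
    have "((\<lambda>s. E (of_real (t + s))) has_vector_derivative E1 (of_real t)) (at 0)" .
    moreover have "E (of_real (t + s)) = h (z + t *\<^sub>R v + s *\<^sub>R v)" for s
      by (simp only: hE[symmetric] scaleR_add_left add.assoc)
    ultimately show "((\<lambda>s. h (z + t *\<^sub>R v + s *\<^sub>R v)) has_vector_derivative E1 (of_real t)) (at 0)"
      by (simp only:)
  qed
  have "D2 h z v v = E2"
  proof (rule vector_derivative_unique_at[OF D2_derivative[OF ha hi z]])
    have "((\<lambda>s. E1 (of_real (0 + s))) has_vector_derivative E2) (at 0)"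
      by (rule has_vector_derivative_of_real_shift) (use E1' in simp)
    thus "((\<lambda>t. D1 h (z + t *\<^sub>R v) v) has_vector_derivative E2) (at 0)"
      by (rule has_vector_derivative_transform_within[OF _ \<open>e > 0\<close>]) (use D1E in \<open>auto simp: dist_real_def\<close>)
  qed
  also have "E2 = K * (2 * of_real \<delta> ^ 2 + of_nat (4 * (N + 2)) * of_real \<delta> * (\<alpha> * \<beta>)
     + (of_nat ((N + 2) * (N + 3)) - of_nat (N * Suc N)) * (\<alpha> * \<beta>)\<^sup>2) / of_real \<delta> ^ (N + 4)"
    using \<delta>_pos unfolding E2_def c_def
    by (simp add: power_add power2_eq_square power4_eq_xxxx divide_simps) (simp add: algebra_simps)
  also have "\<dots> = of_real (real (N * Suc N) * (2 * \<delta>\<^sup>2 + real (4 * (N + 2)) * \<delta> * a + (real (4 * N + 6)) * a\<^sup>2) / \<delta> ^ (N + 4))"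
    unfolding \<alpha>\<beta> K_def by (simp add: algebra_simps)
  finally have "l2sq h = real (N * Suc N) * (2 * \<delta>\<^sup>2 + real (4 * (N + 2)) * \<delta> * a + (real (4 * N + 6)) * a\<^sup>2) / \<delta> ^ (N + 4)"
    unfolding l2sq_def D[OF ha hi] hz by (simp only: mult_zero_right diff_zero Re_complex_of_real)
  also have "\<dots> \<le> real (N * Suc N) * real (4 * N + 6) / \<delta> ^ (N + 4)"
  \<comment> \<open>The expression grows with \<open>a\<close>, so a = 1 - \<delta> is the worst
    case; there the terms in \<delta>^2 cancel.\<close>
  proof (intro divide_right_mono mult_left_mono)
    have "2 * \<delta>\<^sup>2 + real (4 * (N + 2)) * \<delta> * a + real (4 * N + 6) * a\<^sup>2
       \<le> 2 * \<delta>\<^sup>2 + real (4 * (N + 2)) * \<delta> * (1 - \<delta>) + real (4 * N + 6) * (1 - \<delta>)\<^sup>2"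
      using a_bounds \<delta>_pos by (intro add_mono mult_left_mono power_mono) auto
    also have "\<dots> = real (4 * N + 6) - real (4 * N + 4) * \<delta>"
      by (simp add: power2_eq_square algebra_simps)
    also have "\<dots> \<le> real (4 * N + 6)" using \<delta>_pos by simp
    finally show "2 * \<delta>\<^sup>2 + real (4 * (N + 2)) * \<delta> * a + real (4 * N + 6) * a\<^sup>2 \<le> real (4 * N + 6)" .
  qed (use \<delta>_pos in auto)
  finally have H: "l2sq h \<le> real (N * Suc N * (4 * N + 6)) / \<delta> ^ (N + 4)" by (simp only: of_nat_mult)
  have "l2sq f \<ge> 0" unfolding l2sq_def
    by (rule ball_mean_Re_nonneg[OF _ f2]) (simp add: complex_mult_cnj)
  hence "l2sq f * l2sq h \<le> l2sq f * (real (N * Suc N * (4 * N + 6)) / \<delta> ^ (N + 4))"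
    by (rule mult_left_mono[OF H])
  thus ?thesis using cauchy_schwarz_mean[OF fi f2 hc] by (simp only: D[OF f fi])
qed

end

lemma bounded_linear_axis: "bounded_linear (axis i :: complex \<Rightarrow> complex^'n)"
proof (rule bounded_linear_intro[of _ 1])
  fix x :: complex
  have "axis i x = x *s axis i (1 :: complex)" by (simp add: vec_eq_iff axis_def)
  thus "norm (axis i x :: complex^'n) \<le> norm x * 1" by (simp add: norm_vector_smult norm_axis_1)
qed (auto simp: vec_eq_iff axis_def)

lemma axis_expansion: "y = (\<Sum>i\<in>UNIV. axis i (y $ i))" for y :: "complex^'n"
  by (simp add: vec_eq_iff axis_def if_distrib cong: if_cong)

lemma has_vector_derivative_vec:
  fixes F :: "real \<Rightarrow> complex^'n"
  assumes "\<And>i. ((\<lambda>t. F t $ i) has_vector_derivative D $ i) (at x)"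
  shows "(F has_vector_derivative D) (at x)"
proof -
  have "((\<lambda>t. \<Sum>i\<in>UNIV. axis i (F t $ i)) has_vector_derivative (\<Sum>i\<in>UNIV. axis i (D $ i))) (at x)"
    by (intro has_vector_derivative_sum bounded_linear.has_vector_derivative[OF bounded_linear_axis] assms)
  thus ?thesis by (simp only: axis_expansion[symmetric])
qed

subsection \<open>Numerical estimates\<close>

text \<open>With \<open>q\<close> the N-th root of 1 - \<sigma>, bounding the powers q^j, j >= 1, by
  \<open>q\<close> in the geometric sum gives 1 - q^N <= N(1 - q^2)/2, which is the claim for q^2.
  Equality holds at N = 2.\<close>

lemma power_mean_bound:
  fixes \<sigma> :: real and N :: nat
  assumes "0 \<le> \<sigma>" "\<sigma> < 1" "2 \<le> N"
  shows "(1 - \<sigma>)\<^sup>2 \<le> (1 - 2 * \<sigma> / N) ^ N"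
proof -
  define q where "q = root N (1 - \<sigma>)"
  have q: "0 \<le> q" "q \<le> 1" "q ^ N = 1 - \<sigma>"
    using assms by (auto simp: q_def real_root_le_1_iff)
  obtain m where m: "N = Suc m" using assms by (cases N) auto
  have "(\<Sum>j<N. q ^ j) = 1 + (\<Sum>j<m. q ^ Suc j)"
    unfolding m by (subst sum.lessThan_Suc_shift) simp
  also have "(\<Sum>j<m. q ^ Suc j) \<le> (\<Sum>j<m. q)"
    using q by (intro sum_mono) (simp add: mult_left_le power_le_one)
  finally have S: "(\<Sum>j<N. q ^ j) \<le> 1 + real m * q" by simp
  have "\<sigma> = (1 - q) * (\<Sum>j<N. q ^ j)"
    using q by (simp add: one_diff_power_eq[symmetric])
  also have "\<dots> \<le> (1 - q) * (1 + real m * q)"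
    using q by (intro mult_left_mono S) auto
  finally have "2 * \<sigma> \<le> 2 * ((1 - q) * (1 + real m * q))" by simp
  also have "\<dots> = N * (1 - q\<^sup>2) - (1 - q) * ((real m - 1) * (1 - q))"
    by (simp add: m power2_eq_square algebra_simps)
  also have "\<dots> \<le> N * (1 - q\<^sup>2)"
    using q assms m by simp
  finally have "q\<^sup>2 \<le> 1 - 2 * \<sigma> / N"
    using assms by (simp add: field_simps)
  hence "(q\<^sup>2) ^ N \<le> (1 - 2 * \<sigma> / N) ^ N" by (intro power_mono) auto
  thus ?thesis using q(3) by (metis mult.commute power_mult)
qed

text \<open>Along a segment, 1 - |z|^2 can shrink by the factor \<open>p\<close>, which enters the
  second derivative with exponent (N+4)/2. Two of the six factors 1 - \<sigma> in the square come
  from p^N, four from p^4; so the loss is at most the cubic one of the majorant.\<close>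

lemma contraction_factor_bound:
  fixes \<sigma> :: real and N :: nat
  assumes "0 \<le> \<sigma>" "\<sigma> \<le> 178/1000" "3 \<le> N"
  defines "p \<equiv> 1 - 2 * \<sigma> / N"
  shows "(1 - \<sigma>) ^ 3 \<le> sqrt (p ^ (N + 4))" and "p \<ge> 88/100" and "p \<le> 1"
proof -
  have N: "real N \<ge> 3" using assms by simp
  have "2 * \<sigma> / N \<le> 2 * (178/1000) / 3"
    using assms N by (intro frac_le) auto
  thus "p \<ge> 88/100" by (simp add: p_def)
  show "p \<le> 1" using assms by (simp add: p_def)
  have "\<sigma> * 2 \<le> \<sigma> * N" using assms(1) N by (intro mult_left_mono) auto
  hence "2 * \<sigma> / N \<le> \<sigma>" using N by (simp add: divide_le_eq mult.commute)
  hence "1 - \<sigma> \<le> p" by (simp add: p_def)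
  hence "(1 - \<sigma>) ^ 4 \<le> p ^ 4" using assms by (intro power_mono) auto
  moreover have "(1 - \<sigma>)\<^sup>2 \<le> p ^ N"
    unfolding p_def using assms by (intro power_mean_bound) auto
  ultimately have "(1 - \<sigma>)\<^sup>2 * (1 - \<sigma>) ^ 4 \<le> p ^ N * p ^ 4"
    using assms by (intro mult_mono) auto
  hence "((1 - \<sigma>) ^ 3)\<^sup>2 \<le> p ^ (N + 4)" by (simp flip: power_add power_mult)
  thus "(1 - \<sigma>) ^ 3 \<le> sqrt (p ^ (N + 4))" by (rule real_le_rsqrt)
qed

text \<open>The budget 2 N^2 is split into 5/3 N^2 for the corrected second derivative and 1/3 N^2
  for the subtracted multiple of f(z). At N = 3 the first part needs sqrt 216, about 14.7, of the
  available 15.\<close>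

lemma second_derivative_constant:
  fixes \<sigma> p :: real and N :: nat
  assumes \<sigma>: "0 \<le> \<sigma>" "\<sigma> \<le> 178/1000" and N: "3 \<le> N" and p: "p \<ge> 88/100"
  shows "sqrt (real (N * Suc N * (4 * N + 6))) + real (N * Suc N) * sqrt (real (N * Suc N)) * \<sigma> / (N * p) \<le> 2 * (real N)\<^sup>2"
proof -
  define n where "n = real N"
  have n: "n \<ge> 3" using N by (simp add: n_def)
  have n2: "n\<^sup>2 \<ge> 3 * n" using n by (simp add: power2_eq_square)
  have n3: "n ^ 3 \<ge> 3 * n\<^sup>2" using n by (simp add: power2_eq_square power3_eq_cube)
  have "9 * ((n + 1) * (4 * n + 6)) \<le> 25 * n ^ 3"
  proof -
    have "9 * ((n + 1) * (4 * n + 6)) = 36 * n\<^sup>2 + 90 * n + 54"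
      by (simp add: power2_eq_square algebra_simps)
    thus ?thesis using n n2 n3 by linarith
  qed
  hence "n * (9 * ((n + 1) * (4 * n + 6))) \<le> n * (25 * n ^ 3)"
    using n by (intro mult_left_mono) auto
  hence "n * (n + 1) * (4 * n + 6) \<le> (5/3 * n\<^sup>2)\<^sup>2"
    by (simp add: power2_eq_square power3_eq_cube algebra_simps)
  hence A: "sqrt (n * (n + 1) * (4 * n + 6)) \<le> 5/3 * n\<^sup>2"
    by (intro real_le_lsqrt) auto
  have "n * (n + 1) \<le> (6/5 * n)\<^sup>2" using n n2 by (simp add: power2_eq_square algebra_simps)
  hence B: "sqrt (n * (n + 1)) \<le> 6/5 * n" using n by (intro real_le_lsqrt) auto
  have "n * (n + 1) * sqrt (n * (n + 1)) \<le> (n * (4/3 * n)) * (6/5 * n)"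
    using B n by (intro mult_mono) auto
  hence "n * (n + 1) * sqrt (n * (n + 1)) * \<sigma> \<le> (8/5 * n\<^sup>2 * n) * \<sigma>"
    using \<sigma> by (intro mult_right_mono) (auto simp: power2_eq_square)
  also have "\<dots> = (8/5 * \<sigma>) * (n\<^sup>2 * n)" by simp
  also have "\<dots> \<le> (1/3 * p) * (n\<^sup>2 * n)"
    using \<sigma> p n by (intro mult_right_mono) auto
  finally have "n * (n + 1) * sqrt (n * (n + 1)) * \<sigma> \<le> 1/3 * n\<^sup>2 * (n * p)"
    by (simp add: mult_ac)
  hence "n * (n + 1) * sqrt (n * (n + 1)) * \<sigma> / (n * p) \<le> 1/3 * n\<^sup>2"
    using n p by (simp add: divide_le_eq)
  with A have "sqrt (n * (n + 1) * (4 * n + 6)) + n * (n + 1) * sqrt (n * (n + 1)) * \<sigma> / (n * p) \<le> 2 * n\<^sup>2"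
    by simp
  moreover have "real (N * Suc N * (4 * N + 6)) = n * (n + 1) * (4 * n + 6)" "real (N * Suc N) = n * (n + 1)"
    by (simp_all add: n_def algebra_simps)
  ultimately show ?thesis by (simp only: n_def)
qed

subsection \<open>Systems on the unit ball\<close>

locale unit_system =
  fixes F :: "complex^'n \<Rightarrow> complex^'n"
  assumes analytic: "\<And>i. cvec_analytic_on (\<lambda>w. F w $ i) (ball 0 1)"
    and integ: "\<And>i. set_integrable lborel (ball 0 1) (\<lambda>w. F w $ i)"
    and integ2: "\<And>i. set_integrable lborel (ball 0 1) (\<lambda>w. F w $ i * cnj (F w $ i))"
begin

definition "VD1 z v = (\<chi> i. D1 (\<lambda>w. F w $ i) z v)"
definition "VD2 z u v = (\<chi> i. D2 (\<lambda>w. F w $ i) z u v)"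
definition "S = sqrt (\<Sum>i\<in>UNIV. l2sq (\<lambda>w. F w $ i))"
definition "N = Suc CARD('n)"

lemma l2sq_nonneg: "l2sq (\<lambda>w. F w $ i) \<ge> 0"
  unfolding l2sq_def by (rule ball_mean_Re_nonneg[OF _ integ2]) (simp add: complex_mult_cnj)

lemma S_nonneg: "S \<ge> 0"
  by (simp add: S_def sum_nonneg l2sq_nonneg)

text \<open>Squared component bounds with a common factor add up exactly, so the passage to systems
  costs no constant.\<close>

lemma norm_le_from_components:
  fixes y :: "complex^'n"
  assumes "\<And>i. (cmod (y $ i))\<^sup>2 \<le> l2sq (\<lambda>w. F w $ i) * B" "B \<ge> 0"
  shows "norm y \<le> S * sqrt B"
proof -
  have "(norm y)\<^sup>2 \<le> (\<Sum>i\<in>UNIV. l2sq (\<lambda>w. F w $ i)) * B"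
    unfolding norm_vec_power2 sum_distrib_right by (intro sum_mono assms)
  hence "norm y \<le> sqrt ((\<Sum>i\<in>UNIV. l2sq (\<lambda>w. F w $ i)) * B)" by (rule real_le_rsqrt)
  thus ?thesis by (simp add: S_def real_sqrt_mult)
qed

lemma VD1_derivative:
  assumes "norm z < 1"
  shows "((\<lambda>t. F (z + t *\<^sub>R v)) has_vector_derivative VD1 z v) (at 0)"
  by (rule has_vector_derivative_vec) (simp add: VD1_def D1_derivative[OF analytic integ assms])

lemma VD2_derivative:
  assumes "norm z < 1"
  shows "((\<lambda>t. VD1 (z + t *\<^sub>R u) v) has_vector_derivative VD2 z u v) (at 0)"
  by (rule has_vector_derivative_vec) (simp add: VD1_def VD2_def D2_derivative[OF analytic integ assms])

lemma VD1_scaleR: "VD1 z (r *\<^sub>R v) = r *\<^sub>R VD1 z v"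
  by (simp add: VD1_def vec_eq_iff D1_scaleR[OF analytic integ] scaleR_conv_of_real[where 'a=complex])

lemma VD2_scaleR: "VD2 z (r *\<^sub>R v) (r *\<^sub>R v) = r\<^sup>2 *\<^sub>R VD2 z v v"
  by (simp add: VD2_def vec_eq_iff D2_scaleR[OF analytic integ] scaleR_conv_of_real[where 'a=complex])

lemma VD1_bound:
  assumes z: "norm z < 1"
  shows "norm (VD1 z v) \<le> S * sqrt (real (N * Suc N) / (1 - (norm z)\<^sup>2) ^ (N + 2)) * norm v"
proof (cases "v = 0")
  case True
  thus ?thesis using VD1_scaleR[of z 0 v] by simp
next
  case False
  have v: "norm (sgn v) = 1" using False by (simp add: norm_sgn)
  have "norm (VD1 z (sgn v)) \<le> S * sqrt (real (N * Suc N) / (1 - (norm z)\<^sup>2) ^ (N + 2))"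
  proof (rule norm_le_from_components)
    show "(cmod (VD1 z (sgn v) $ i))\<^sup>2 \<le> l2sq (\<lambda>w. F w $ i) * (real (N * Suc N) / (1 - (norm z)\<^sup>2) ^ (N + 2))" for i
      using D1_bound_unit[OF z v analytic integ integ2] by (simp only: VD1_def vec_lambda_beta N_def)
    show "0 \<le> real (N * Suc N) / (1 - (norm z)\<^sup>2) ^ (N + 2)"
      using z by (intro divide_nonneg_nonneg zero_le_power) (auto simp: abs_square_le_1)
  qed
  moreover have "VD1 z v = norm v *\<^sub>R VD1 z (sgn v)"
    using VD1_scaleR[of z "norm v" "sgn v"] False by (simp add: sgn_div_norm)
  ultimately show ?thesis by (simp add: mult.commute[of "norm v"] mult_right_mono)
qed

text \<open>Polarization keeps the diagonal constant because the domain is a Hilbert space: for unit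
  vectors the parallelogram law gives |a+b|^2 + |a-b|^2 = 4.\<close>

lemma VD2_bound:
  assumes z: "norm z < 1"
  defines "\<delta> \<equiv> 1 - (norm z)\<^sup>2"
  shows "norm (VD2 z u v) \<le> (S * sqrt (real (N * Suc N * (4 * N + 6)) / \<delta> ^ (N + 4))
    + real (N * Suc N) / \<delta>\<^sup>2 * norm (F z)) * norm u * norm v" (is "_ \<le> ?B * _ * _")
proof -
  have \<delta>: "\<delta> > 0" using z by (simp add: \<delta>_def abs_square_less_1)
  have B: "?B \<ge> 0" using S_nonneg \<delta> by simp
  have diag1: "norm (VD2 z y y) \<le> ?B" if y: "norm y = 1" for y
  proof -
    \<comment> \<open>The coefficient is the same for all components, so a single multiple of the
      vector \<open>F z\<close> is subtracted.\<close>
    have "norm (VD2 z y y - pcoeff z y *s F z) \<le> S * sqrt (real (N * Suc N * (4 * N + 6)) / \<delta> ^ (N + 4))"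
    proof (rule norm_le_from_components)
      show "(cmod ((VD2 z y y - pcoeff z y *s F z) $ i))\<^sup>2
          \<le> l2sq (\<lambda>w. F w $ i) * (real (N * Suc N * (4 * N + 6)) / \<delta> ^ (N + 4))" for i
        using D2_bound_unit[OF z y analytic integ integ2]
        by (simp only: VD2_def vec_lambda_beta vector_minus_component vector_smult_component N_def \<delta>_def)
    qed (use \<delta> in simp)
    moreover have "norm (pcoeff z y *s F z) \<le> real (N * Suc N) / \<delta>\<^sup>2 * norm (F z)"
      unfolding norm_vector_smult N_def \<delta>_def by (intro mult_right_mono norm_pcoeff z y) auto
    moreover have "norm (VD2 z y y) \<le> norm (VD2 z y y - pcoeff z y *s F z) + norm (pcoeff z y *s F z)"
      using norm_triangle_ineq[of "VD2 z y y - pcoeff z y *s F z" "pcoeff z y *s F z"] by simp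
    ultimately show ?thesis by linarith
  qed
  have diag: "norm (VD2 z y y) \<le> ?B * (norm y)\<^sup>2" for y
  proof (cases "y = 0")
    case True
    thus ?thesis using VD2_scaleR[of z 0 y] by simp
  next
    case False
    have "VD2 z y y = (norm y)\<^sup>2 *\<^sub>R VD2 z (sgn y) (sgn y)"
      using VD2_scaleR[of z "norm y" "sgn y"] False by (simp add: sgn_div_norm)
    thus ?thesis using diag1[of "sgn y"] False
      by (simp add: norm_sgn mult.commute[of "(norm y)\<^sup>2"] mult_right_mono)
  qed
  have unit: "norm (VD2 z a b) \<le> ?B" if "norm a = 1" "norm b = 1" for a b
  proof -
    have "VD2 z a b = (1/4) *\<^sub>R (VD2 z (a + b) (a + b) - VD2 z (a - b) (a - b))"
      by (simp add: vec_eq_iff VD2_def D2_polarization[OF analytic integ z, of _ a b] scaleR_conv_of_real[where 'a=complex])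
    moreover have gen: "(1/4) * (B * x + B * y) = B * ((1/4) * (x + y))" for B x y :: real
      by (simp add: algebra_simps)
    ultimately have "norm (VD2 z a b) \<le> (1/4) * (norm (VD2 z (a + b) (a + b)) + norm (VD2 z (a - b) (a - b)))"
      using norm_triangle_ineq4[of "VD2 z (a + b) (a + b)" "VD2 z (a - b) (a - b)"] by simp
    also have "\<dots> \<le> (1/4) * (?B * (norm (a + b))\<^sup>2 + ?B * (norm (a - b))\<^sup>2)"
      by (intro mult_left_mono add_mono diag) auto
    also have "\<dots> = ?B * ((1/4) * ((norm (a + b))\<^sup>2 + (norm (a - b))\<^sup>2))"
      by (rule gen)
    also have "(norm (a + b))\<^sup>2 + (norm (a - b))\<^sup>2 = 4"
      using that by (simp add: power2_norm_eq_inner inner_simps norm_eq_1)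
    finally show ?thesis by simp
  qed
  show ?thesis
  proof (cases "u = 0 \<or> v = 0")
    case True
    have "D2 (\<lambda>w. F w $ i) z u v = 0" for i
      using True by (auto simp: D2_def ball_mean_def set_lebesgue_integral_def)
    thus ?thesis using True by (auto simp: VD2_def zero_vec_def[symmetric])
  next
    case False
    have "D2 (\<lambda>w. F w $ i) z (a *\<^sub>R y) (b *\<^sub>R y') = of_real (a * b) * D2 (\<lambda>w. F w $ i) z y y'" for a b y y' i
      unfolding D2_def ball_mean_cmult[symmetric]
      by (intro ball_mean_cong) (simp add: herm_scaleR_left mult_ac)
    hence "VD2 z (a *\<^sub>R y) (b *\<^sub>R y') = (a * b) *\<^sub>R VD2 z y y'" for a b y y'
      by (simp add: VD2_def vec_eq_iff scaleR_conv_of_real[where 'a=complex])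
    from this[of "norm u" "sgn u" "norm v" "sgn v"]
    have "VD2 z u v = (norm u * norm v) *\<^sub>R VD2 z (sgn u) (sgn v)"
      using False by (simp add: sgn_div_norm)
    moreover have "norm (VD2 z (sgn u) (sgn v)) \<le> ?B"
      using False by (intro unit) (auto simp: norm_sgn)
    hence "(norm u * norm v) * norm (VD2 z (sgn u) (sgn v)) \<le> (norm u * norm v) * ?B"
      by (intro mult_left_mono) auto
    ultimately show ?thesis by (simp only: norm_scaleR abs_mult abs_norm_cancel) (simp only: mult_ac)
  qed
qed

end

subsection \<open>Estimates along a segment\<close>

lemma has_vector_derivative_shift:
  fixes g :: "real \<Rightarrow> 'a::real_normed_vector"
  assumes "((\<lambda>s. g (t + s)) has_vector_derivative D) (at 0)"
  shows "(g has_vector_derivative D) (at t)"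
proof -
  have 1: "((\<lambda>x. x - t) has_vector_derivative 1) (at t)"
    by (auto intro!: derivative_eq_intros)
  have "((\<lambda>s. g (t + s)) has_vector_derivative D) (at (t - t))" using assms by simp
  from vector_diff_chain_at[OF 1 this] show ?thesis by (simp add: o_def)
qed

text \<open>This and the next lemma give primitives of the cubic majorant, without and with a weight
  \<tau>; they are the comparison functions for the mean value inequality.\<close>

lemma DERIV_inverse_square_line:
  fixes s \<tau> c :: real
  assumes "1 - \<tau> * s \<noteq> 0"
  shows "((\<lambda>\<tau>. c / (1 - \<tau> * s)\<^sup>2) has_vector_derivative c * (2 * s / (1 - \<tau> * s) ^ 3)) (at \<tau>)"
  unfolding has_real_derivative_iff_has_vector_derivative[symmetric]
  using assms
  by (auto intro!: derivative_eq_intros simp: power2_eq_square power3_eq_cube divide_simps)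

lemma DERIV_square_quotient_line:
  fixes s \<tau> c :: real
  assumes "1 - \<tau> * s \<noteq> 0"
  shows "((\<lambda>\<tau>. c * ((\<tau> * s)\<^sup>2 / (1 - \<tau> * s)\<^sup>2)) has_vector_derivative c * (2 * s\<^sup>2 * \<tau> / (1 - \<tau> * s) ^ 3)) (at \<tau>)"
  unfolding has_real_derivative_iff_has_vector_derivative[symmetric]
  using assms
  by (auto intro!: derivative_eq_intros simp: power2_eq_square power3_eq_cube divide_simps)
     (simp add: algebra_simps)

text \<open>\<open>s\<close> is the step length in the unit-ball scale, measured in multiples of
  \<delta>/N; after rescaling it is at most \<open>u\<close>.\<close>

locale unit_root = unit_system F for F :: "complex^'n \<Rightarrow> complex^'n" +
  fixes \<zeta> h :: "complex^'n" and \<delta> s :: real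
  assumes card: "CARD('n) \<ge> 2" and \<zeta>: "norm \<zeta> < 1" and root: "F \<zeta> = 0"
  defines "\<delta> \<equiv> 1 - (norm \<zeta>)\<^sup>2"
  defines "s \<equiv> N / \<delta> * norm h"
  assumes s_le: "s \<le> 178/1000"
begin

lemma N3: "N \<ge> 3" using card by (simp add: N_def)

lemma \<delta>: "\<delta> > 0" "\<delta> \<le> 1" using \<zeta> by (simp_all add: \<delta>_def abs_square_less_1)

lemma s_nonneg: "s \<ge> 0" using \<delta> by (simp add: s_def)

lemma norm_h: "norm h = s * \<delta> / N" using \<delta> N3 by (simp add: s_def)

text \<open>The step length \<rho> is at most \<delta>, hence at most 2(1 - |\<zeta>|). So
  2|\<zeta>| + \<rho> <= 2, and the squared norm grows by at most 2\<rho>.\<close>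

lemma segment_defect:
  assumes \<tau>: "0 \<le> \<tau>" "\<tau> \<le> 1"
  shows "\<delta> * (1 - 2 * (\<tau> * s) / N) \<le> 1 - (norm (\<zeta> + \<tau> *\<^sub>R h))\<^sup>2"
    and "norm (\<zeta> + \<tau> *\<^sub>R h) < 1"
proof -
  define \<rho> where "\<rho> = \<tau> * norm h"
  have \<rho>: "\<rho> \<ge> 0" using \<tau> by (simp add: \<rho>_def)
  have ts: "0 \<le> \<tau> * s" "\<tau> * s \<le> 178/1000"
    using \<tau> s_nonneg s_le mult_left_le_one_le[of s \<tau>] by auto
  have "\<rho> = (\<tau> * s / N) * \<delta>" by (simp add: \<rho>_def norm_h)
  also have "\<dots> \<le> 1 * \<delta>"
  proof (rule mult_right_mono)
    have "\<tau> * s / N \<le> 1 / 1" using ts N3 by (intro frac_le) auto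
    thus "\<tau> * s / N \<le> 1" by simp
  qed (use \<delta> in simp)
  also have "1 * \<delta> \<le> 2 * (1 - norm \<zeta>)"
  proof -
    have "0 \<le> (1 - norm \<zeta>)\<^sup>2" by simp
    thus ?thesis by (simp add: \<delta>_def power2_eq_square algebra_simps)
  qed
  finally have "\<rho> * (2 * norm \<zeta> + \<rho>) \<le> \<rho> * 2" using \<rho> by (intro mult_left_mono) auto
  moreover have nz: "norm (\<zeta> + \<tau> *\<^sub>R h) \<le> norm \<zeta> + \<rho>"
    using norm_triangle_ineq[of \<zeta> "\<tau> *\<^sub>R h"] \<tau> by (simp add: \<rho>_def)
  hence "(norm (\<zeta> + \<tau> *\<^sub>R h))\<^sup>2 \<le> (norm \<zeta> + \<rho>)\<^sup>2" by (intro power_mono) auto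
  ultimately have "(norm (\<zeta> + \<tau> *\<^sub>R h))\<^sup>2 \<le> (norm \<zeta>)\<^sup>2 + 2 * \<rho>"
    by (simp add: power2_eq_square algebra_simps)
  moreover have "2 * \<rho> = \<delta> * (2 * (\<tau> * s) / N)" by (simp add: \<rho>_def norm_h)
  ultimately show 1: "\<delta> * (1 - 2 * (\<tau> * s) / N) \<le> 1 - (norm (\<zeta> + \<tau> *\<^sub>R h))\<^sup>2"
    by (simp add: \<delta>_def right_diff_distrib)
  have "1 - 2 * (\<tau> * s) / N \<ge> 88/100"
    using contraction_factor_bound(2)[OF ts N3] .
  hence "\<delta> * (1 - 2 * (\<tau> * s) / N) > 0" using \<delta> by (intro mult_pos_pos) auto
  with 1 have "(norm (\<zeta> + \<tau> *\<^sub>R h))\<^sup>2 < 1" by linarith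
  thus "norm (\<zeta> + \<tau> *\<^sub>R h) < 1" by (simp add: abs_square_less_1)
qed

lemma segment_VD1:
  assumes "0 \<le> \<tau>" "\<tau> \<le> 1"
  shows "((\<lambda>t. F (\<zeta> + t *\<^sub>R h)) has_vector_derivative VD1 (\<zeta> + \<tau> *\<^sub>R h) h) (at \<tau>)"
  by (rule has_vector_derivative_shift)
     (use VD1_derivative[OF segment_defect(2)[OF assms], of h] in \<open>simp add: scaleR_add_left add.assoc\<close>)

lemma segment_VD2:
  assumes "0 \<le> \<tau>" "\<tau> \<le> 1"
  shows "((\<lambda>t. VD1 (\<zeta> + t *\<^sub>R h) w) has_vector_derivative VD2 (\<zeta> + \<tau> *\<^sub>R h) h w) (at \<tau>)"
  by (rule has_vector_derivative_shift)
     (use VD2_derivative[OF segment_defect(2)[OF assms], of h w] in \<open>simp add: scaleR_add_left add.assoc\<close>)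

text \<open>Integrates the first derivative bound from the root; \<open>p\<close> belongs to the far
  end of the segment, where the bound is worst.\<close>

lemma segment_F_bound:
  assumes \<tau>: "0 \<le> \<tau>" "\<tau> \<le> 1"
  defines "p \<equiv> 1 - 2 * (\<tau> * s) / N"
  shows "norm (F (\<zeta> + \<tau> *\<^sub>R h)) \<le> (\<tau> * norm h) * (S * sqrt (real (N * Suc N) / (\<delta> * p) ^ (N + 2)))"
proof (cases "\<tau> = 0")
  case False
  hence \<tau>0: "0 < \<tau>" using \<tau> by simp
  let ?C = "S * sqrt (real (N * Suc N) / (\<delta> * p) ^ (N + 2)) * norm h"
  have ts: "0 \<le> \<tau> * s" "\<tau> * s \<le> 178/1000"
    using \<tau> s_nonneg s_le mult_left_le_one_le[of s \<tau>] by auto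
  have p: "p \<ge> 88/100" unfolding p_def by (rule contraction_factor_bound(2)[OF ts N3])
  have "norm (F (\<zeta> + \<tau> *\<^sub>R h) - F (\<zeta> + 0 *\<^sub>R h)) \<le> \<tau> * ?C - 0 * ?C"
  proof (rule differentiable_bound_general[OF \<tau>0])
    show "continuous_on {0..\<tau>} (\<lambda>t. F (\<zeta> + t *\<^sub>R h))"
      using \<tau> by (intro continuous_at_imp_continuous_on ballI has_vector_derivative_continuous[OF segment_VD1]) auto
    show "continuous_on {0..\<tau>} (\<lambda>t. t * ?C)" by (intro continuous_intros)
    fix t assume t: "0 < t" "t < \<tau>"
    hence t1: "0 \<le> t" "t \<le> 1" using \<tau> by auto
    show "((\<lambda>t. F (\<zeta> + t *\<^sub>R h)) has_vector_derivative VD1 (\<zeta> + t *\<^sub>R h) h) (at t)"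
      by (rule segment_VD1[OF t1])
    show "((\<lambda>t. t * ?C) has_vector_derivative ?C) (at t)"
      unfolding has_real_derivative_iff_has_vector_derivative[symmetric]
      by (auto intro!: derivative_eq_intros)
    have "t * s \<le> \<tau> * s" using t s_nonneg by (intro mult_right_mono) auto
    hence "p \<le> 1 - 2 * (t * s) / N" unfolding p_def by (intro diff_left_mono divide_right_mono) auto
    hence "\<delta> * p \<le> \<delta> * (1 - 2 * (t * s) / N)" using \<delta> by (intro mult_left_mono) auto
    also have "\<dots> \<le> 1 - (norm (\<zeta> + t *\<^sub>R h))\<^sup>2" by (rule segment_defect(1)[OF t1])
    finally have le: "\<delta> * p \<le> 1 - (norm (\<zeta> + t *\<^sub>R h))\<^sup>2" .
    have pos: "\<delta> * p > 0" using \<delta> p by simp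
    have "norm (VD1 (\<zeta> + t *\<^sub>R h) h) \<le> S * sqrt (real (N * Suc N) / (1 - (norm (\<zeta> + t *\<^sub>R h))\<^sup>2) ^ (N + 2)) * norm h"
      by (rule VD1_bound[OF segment_defect(2)[OF t1]])
    also have "\<dots> \<le> ?C"
      using le pos less_le_trans[OF pos le] S_nonneg \<delta> p
      by (intro mult_right_mono mult_left_mono real_sqrt_le_mono divide_left_mono power_mono mult_pos_pos zero_less_power) auto
    finally show "norm (VD1 (\<zeta> + t *\<^sub>R h) h) \<le> ?C" .
  qed
  thus ?thesis by (simp add: root mult_ac)
qed (simp add: root)

lemma segment_VD2_bound:
  assumes \<tau>: "0 \<le> \<tau>" "\<tau> \<le> 1"
  shows "norm (VD2 (\<zeta> + \<tau> *\<^sub>R h) u v) \<le> 2 * (S / sqrt (\<delta> ^ N)) * (N / \<delta>)\<^sup>2 / (1 - \<tau> * s) ^ 3 * norm u * norm v"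
proof -
  define \<sigma> where "\<sigma> = \<tau> * s"
  define p where "p = 1 - 2 * \<sigma> / N"
  define z where "z = \<zeta> + \<tau> *\<^sub>R h"
  \<comment> \<open>Powers of \<open>p\<close> lost by the second derivative; \<open>W2\<close> is
    the loss for the first one, which bounds \<open>F z\<close>. Since \<open>W = p * W2\<close>,
    both terms fit one denominator, leaving the \<open>N * p\<close> of
    \<open>second_derivative_constant\<close>.\<close>
  define W where "W = sqrt (p ^ (N + 4))"
  define W2 where "W2 = sqrt (p ^ (N + 2))"
  define q where "q = sqrt (\<delta> ^ N)"
  define K where "K = real (N * Suc N)"
  define L where "L = real (N * Suc N * (4 * N + 6))"
  have \<sigma>: "0 \<le> \<sigma>" "\<sigma> \<le> 178/1000"
    using \<tau> s_nonneg s_le mult_left_le_one_le[of s \<tau>] by (auto simp: \<sigma>_def)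
  note cf = contraction_factor_bound[OF \<sigma> N3, folded p_def]
  have p: "p > 0" using cf(2) by simp
  have N: "real N > 0" using N3 by simp
  have q: "q > 0" using \<delta> by (simp add: q_def)
  have W: "W > 0" using p by (simp add: W_def)
  have W2: "W2 > 0" using p by (simp add: W2_def)
  have WW2: "W = p * W2"
  proof -
    have "p ^ (N + 4) = p\<^sup>2 * p ^ (N + 2)" by (simp add: power_add eval_nat_numeral mult_ac)
    thus ?thesis using p by (simp add: W_def W2_def real_sqrt_mult)
  qed
  have Y: "\<delta> * p > 0" using \<delta> p by simp
  have le: "\<delta> * p \<le> 1 - (norm z)\<^sup>2"
    using segment_defect(1)[OF \<tau>] by (simp only: p_def \<sigma>_def z_def)
  have s4: "sqrt ((\<delta> * p) ^ (N + 4)) = q * \<delta>\<^sup>2 * W"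
  proof -
    have "(\<delta> * p) ^ (N + 4) = \<delta> ^ N * (\<delta>\<^sup>2)\<^sup>2 * p ^ (N + 4)"
      by (simp add: power_mult_distrib power_add eval_nat_numeral mult_ac)
    thus ?thesis by (simp only: real_sqrt_mult q_def W_def real_sqrt_abs) simp
  qed
  have s2: "sqrt ((\<delta> * p) ^ (N + 2)) = q * \<delta> * W2"
  proof -
    have "(\<delta> * p) ^ (N + 2) = \<delta> ^ N * \<delta>\<^sup>2 * p ^ (N + 2)"
      by (simp add: power_mult_distrib power_add eval_nat_numeral mult_ac)
    thus ?thesis using \<delta> by (simp add: real_sqrt_mult q_def W2_def del: power_Suc power_add)
  qed
  have K: "K \<ge> 0" "L \<ge> 0" by (simp_all add: K_def L_def)
  have T1: "S * sqrt (L / (1 - (norm z)\<^sup>2) ^ (N + 4)) \<le> S * (sqrt L / (q * \<delta>\<^sup>2 * W))"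
  proof (rule mult_left_mono[OF _ S_nonneg])
    have "sqrt (L / (1 - (norm z)\<^sup>2) ^ (N + 4)) \<le> sqrt (L / (\<delta> * p) ^ (N + 4))"
      using Y le less_le_trans[OF Y le] K \<delta> p by (intro real_sqrt_le_mono divide_left_mono power_mono mult_pos_pos zero_less_power) auto
    thus "sqrt (L / (1 - (norm z)\<^sup>2) ^ (N + 4)) \<le> sqrt L / (q * \<delta>\<^sup>2 * W)"
      by (simp only: real_sqrt_divide s4)
  qed
  have "norm (F z) \<le> (\<tau> * norm h) * (S * sqrt (K / (\<delta> * p) ^ (N + 2)))"
    using segment_F_bound[OF \<tau>] by (simp only: K_def z_def p_def \<sigma>_def)
  also have "\<dots> = (\<sigma> * \<delta> / N) * (S * (sqrt K / (q * \<delta> * W2)))"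
    by (simp only: real_sqrt_divide s2 norm_h \<sigma>_def) simp
  finally have Fb: "norm (F z) \<le> (\<sigma> * \<delta> / N) * (S * (sqrt K / (q * \<delta> * W2)))" .
  have "K / (1 - (norm z)\<^sup>2)\<^sup>2 * norm (F z) \<le> K / (\<delta> * p)\<^sup>2 * ((\<sigma> * \<delta> / N) * (S * (sqrt K / (q * \<delta> * W2))))"
    using Y le less_le_trans[OF Y le] K \<delta> p by (intro mult_mono Fb divide_left_mono power_mono mult_pos_pos zero_less_power divide_nonneg_nonneg) auto
  also have "\<dots> = S * ((K * sqrt K * \<sigma> / (N * p)) / (q * \<delta>\<^sup>2 * W))"
    using \<delta> p N q W2 unfolding WW2 by (simp add: field_simps power2_eq_square)
  finally have T2: "K / (1 - (norm z)\<^sup>2)\<^sup>2 * norm (F z) \<le> S * ((K * sqrt K * \<sigma> / (N * p)) / (q * \<delta>\<^sup>2 * W))" .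
  have "S * sqrt (L / (1 - (norm z)\<^sup>2) ^ (N + 4)) + K / (1 - (norm z)\<^sup>2)\<^sup>2 * norm (F z)
    \<le> S * ((sqrt L + K * sqrt K * \<sigma> / (N * p)) / (q * \<delta>\<^sup>2 * W))"
    using T1 T2 by (simp add: add_divide_distrib distrib_left)
  also have "\<dots> \<le> S * (2 * (real N)\<^sup>2 / (q * \<delta>\<^sup>2 * (1 - \<sigma>) ^ 3))"
  proof (rule mult_left_mono[OF frac_le S_nonneg])
    show "sqrt L + K * sqrt K * \<sigma> / (N * p) \<le> 2 * (real N)\<^sup>2"
      using second_derivative_constant[OF \<sigma> N3 cf(2)] by (simp only: K_def L_def)
    show "q * \<delta>\<^sup>2 * (1 - \<sigma>) ^ 3 \<le> q * \<delta>\<^sup>2 * W"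
      using cf(1) q by (intro mult_left_mono) (auto simp: W_def)
  qed (use q \<delta> \<sigma> in auto)
  also have "\<dots> = 2 * (S / q) * (N / \<delta>)\<^sup>2 / (1 - \<sigma>) ^ 3"
    by (simp add: power_divide mult_ac)
  finally have B: "S * sqrt (L / (1 - (norm z)\<^sup>2) ^ (N + 4)) + K / (1 - (norm z)\<^sup>2)\<^sup>2 * norm (F z)
    \<le> 2 * (S / q) * (N / \<delta>)\<^sup>2 / (1 - \<sigma>) ^ 3" .
  have "norm (VD2 z u v) \<le> (S * sqrt (L / (1 - (norm z)\<^sup>2) ^ (N + 4)) + K / (1 - (norm z)\<^sup>2)\<^sup>2 * norm (F z)) * norm u * norm v"
    using VD2_bound[OF segment_defect(2)[OF \<tau>], of u v] by (simp only: K_def L_def z_def)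
  also have "\<dots> \<le> 2 * (S / q) * (N / \<delta>)\<^sup>2 / (1 - \<sigma>) ^ 3 * norm u * norm v"
    by (intro mult_right_mono B) auto
  finally show ?thesis by (simp only: z_def q_def \<sigma>_def)
qed

lemma line_nz: "1 - \<tau> * s > 0" if "0 \<le> \<tau>" "\<tau> \<le> 1" for \<tau>
  using that s_nonneg s_le mult_left_le_one_le[of s \<tau>] by auto

lemma derivative_variation:
  "norm (VD1 (\<zeta> + h) w - VD1 \<zeta> w) \<le> S / sqrt (\<delta> ^ N) * (N / \<delta>) * (1 / (1 - s)\<^sup>2 - 1) * norm w"
proof -
  let ?c = "S / sqrt (\<delta> ^ N) * (N / \<delta>) * norm w"
  have "norm (VD1 (\<zeta> + 1 *\<^sub>R h) w - VD1 (\<zeta> + 0 *\<^sub>R h) w) \<le> ?c / (1 - 1 * s)\<^sup>2 - ?c / (1 - 0 * s)\<^sup>2"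
  proof (rule differentiable_bound_general[OF zero_less_one])
    show "continuous_on {0..1} (\<lambda>t. VD1 (\<zeta> + t *\<^sub>R h) w)"
      by (intro continuous_at_imp_continuous_on ballI has_vector_derivative_continuous[OF segment_VD2]) auto
    show "continuous_on {0..1} (\<lambda>t. ?c / (1 - t * s)\<^sup>2)"
      by (intro continuous_intros ballI) (use line_nz in force)
    fix t :: real assume "0 < t" "t < 1"
    hence t: "0 \<le> t" "t \<le> 1" by auto
    show "((\<lambda>t. VD1 (\<zeta> + t *\<^sub>R h) w) has_vector_derivative VD2 (\<zeta> + t *\<^sub>R h) h w) (at t)"
      by (rule segment_VD2[OF t])
    show "((\<lambda>t. ?c / (1 - t * s)\<^sup>2) has_vector_derivative ?c * (2 * s / (1 - t * s) ^ 3)) (at t)"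
      by (rule DERIV_inverse_square_line) (use line_nz[OF t] in simp)
    have "norm (VD2 (\<zeta> + t *\<^sub>R h) h w) \<le> 2 * (S / sqrt (\<delta> ^ N)) * (N / \<delta>)\<^sup>2 / (1 - t * s) ^ 3 * norm h * norm w"
      by (rule segment_VD2_bound[OF t])
    also have "\<dots> = ?c * (2 * (N / \<delta> * norm h) / (1 - t * s) ^ 3)"
      by (simp add: power2_eq_square mult_ac)
    also have "\<dots> = ?c * (2 * s / (1 - t * s) ^ 3)" by (simp only: s_def)
    finally show "norm (VD2 (\<zeta> + t *\<^sub>R h) h w) \<le> ?c * (2 * s / (1 - t * s) ^ 3)" .
  qed
  also have "?c / (1 - 1 * s)\<^sup>2 - ?c / (1 - 0 * s)\<^sup>2 = S / sqrt (\<delta> ^ N) * (N / \<delta>) * (1 / (1 - s)\<^sup>2 - 1) * norm w"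
    by (simp add: right_diff_distrib left_diff_distrib)
  finally show ?thesis by simp
qed

text \<open>In the derivative of \<open>t *\<^sub>R VD1 (\<zeta> + t *\<^sub>R h) h - F (\<zeta> + t
  *\<^sub>R h)\<close> the first-order terms cancel. This function vanishes at 0 because \<zeta> is
  a root, and its value at 1 is the residual.\<close>

lemma newton_residual:
  "norm (VD1 (\<zeta> + h) h - F (\<zeta> + h)) \<le> S / sqrt (\<delta> ^ N) * (s\<^sup>2 / (1 - s)\<^sup>2)"
proof -
  let ?c = "S / sqrt (\<delta> ^ N)"
  let ?\<Psi> = "\<lambda>t. t *\<^sub>R VD1 (\<zeta> + t *\<^sub>R h) h - F (\<zeta> + t *\<^sub>R h)"
  have der: "(?\<Psi> has_vector_derivative t *\<^sub>R VD2 (\<zeta> + t *\<^sub>R h) h h) (at t)" if t: "0 \<le> t" "t \<le> 1" for t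
  proof -
    have "((\<lambda>t. t *\<^sub>R VD1 (\<zeta> + t *\<^sub>R h) h) has_vector_derivative
        t *\<^sub>R VD2 (\<zeta> + t *\<^sub>R h) h h + 1 *\<^sub>R VD1 (\<zeta> + t *\<^sub>R h) h) (at t)"
      by (rule has_vector_derivative_scaleR[OF _ segment_VD2[OF t]]) simp
    from has_vector_derivative_diff[OF this segment_VD1[OF t]] show ?thesis by simp
  qed
  have "norm (?\<Psi> 1 - ?\<Psi> 0) \<le> ?c * ((1 * s)\<^sup>2 / (1 - 1 * s)\<^sup>2) - ?c * ((0 * s)\<^sup>2 / (1 - 0 * s)\<^sup>2)"
  proof (rule differentiable_bound_general[OF zero_less_one])
    show "continuous_on {0..1} ?\<Psi>"
      by (intro continuous_at_imp_continuous_on ballI has_vector_derivative_continuous[OF der]) auto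
    show "continuous_on {0..1} (\<lambda>t. ?c * ((t * s)\<^sup>2 / (1 - t * s)\<^sup>2))"
      by (intro continuous_intros ballI) (use line_nz in force)
    fix t :: real assume "0 < t" "t < 1"
    hence t: "0 \<le> t" "t \<le> 1" by auto
    show "(?\<Psi> has_vector_derivative t *\<^sub>R VD2 (\<zeta> + t *\<^sub>R h) h h) (at t)" by (rule der[OF t])
    show "((\<lambda>t. ?c * ((t * s)\<^sup>2 / (1 - t * s)\<^sup>2)) has_vector_derivative ?c * (2 * s\<^sup>2 * t / (1 - t * s) ^ 3)) (at t)"
      by (rule DERIV_square_quotient_line) (use line_nz[OF t] in simp)
    have "norm (t *\<^sub>R VD2 (\<zeta> + t *\<^sub>R h) h h) = t * norm (VD2 (\<zeta> + t *\<^sub>R h) h h)" using t by simp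
    also have "\<dots> \<le> t * (2 * ?c * (N / \<delta>)\<^sup>2 / (1 - t * s) ^ 3 * norm h * norm h)"
      by (rule mult_left_mono[OF segment_VD2_bound[OF t] t(1)])
    also have "\<dots> = ?c * (2 * (N / \<delta> * norm h)\<^sup>2 * t / (1 - t * s) ^ 3)"
      by (simp add: power2_eq_square mult_ac)
    also have "\<dots> = ?c * (2 * s\<^sup>2 * t / (1 - t * s) ^ 3)" by (simp only: s_def)
    finally show "norm (t *\<^sub>R VD2 (\<zeta> + t *\<^sub>R h) h h) \<le> ?c * (2 * s\<^sup>2 * t / (1 - t * s) ^ 3)" .
  qed
  thus ?thesis by (simp add: root)
qed

end

subsection \<open>Rescaling to the unit ball\<close>

lemma has_derivative_vec:
  fixes F :: "'a::real_normed_vector \<Rightarrow> complex^'n"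
  assumes "\<And>i. ((\<lambda>x. F x $ i) has_derivative (\<lambda>v. L v $ i)) (at x)"
  shows "(F has_derivative L) (at x)"
proof -
  have "((\<lambda>x. \<Sum>i\<in>UNIV. axis i (F x $ i)) has_derivative (\<lambda>v. \<Sum>i\<in>UNIV. axis i (L v $ i))) (at x)"
    by (intro has_derivative_sum bounded_linear.has_derivative[OF bounded_linear_axis] assms)
  thus ?thesis by (simp only: axis_expansion[symmetric])
qed

text \<open>A complex matrix represents only C-linear maps, so the C-linearity of the component
  derivatives is what makes \<open>matrix\<close> faithful here.\<close>

lemma Dmat_derivative:
  fixes f :: "complex^'n \<Rightarrow> complex^'n"
  assumes an: "\<And>i. cvec_analytic_on (\<lambda>w. f w $ i) B" and y: "y \<in> B"
  shows "(f has_derivative (\<lambda>v. Dmat f y *v v)) (at y)"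
proof -
  have "\<forall>i. \<exists>L. ((\<lambda>w. f w $ i) has_derivative L) (at y) \<and> (\<forall>c v. L (c *s v) = c * L v)"
    using an y unfolding cvec_analytic_on_def by blast
  then obtain L where L: "\<And>i. ((\<lambda>w. f w $ i) has_derivative L i) (at y)" "\<And>i c v. L i (c *s v) = c * L i v"
    by metis
  define M where "M v = (\<chi> i. L i v)" for v
  have M: "(f has_derivative M) (at y)"
    by (rule has_derivative_vec) (simp add: M_def L(1))
  have "linear M" using M has_derivative_linear by blast
  hence "M (x + y) = M x + M y" for x y by (rule linear_add)
  moreover have "M (c *s x) = c *s M x" for c x by (simp add: M_def vec_eq_iff L(2))
  ultimately have "Vector_Spaces.linear (*s) (*s) M"
    by (auto simp: linear_iff_module_hom module_hom_iff vec.module_axioms)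
  hence "matrix M *v v = M v" for v by (rule matrix_works)
  moreover have "frechet_derivative f (at y) = M"
    using frechet_derivative_at[OF M] ..
  ultimately have "(\<lambda>v. Dmat f y *v v) = M" by (auto simp: Dmat_def)
  thus ?thesis using M by simp
qed

context
  fixes \<omega> :: "complex^'n" and R :: real and f :: "complex^'n \<Rightarrow> complex^'n"
    and F :: "complex^'n \<Rightarrow> complex^'n"
  assumes R: "R > 0" and f: "f \<in> bergman_systems \<omega> R"
  defines "F \<equiv> (\<lambda>y. f (\<omega> + R *\<^sub>R y))"
begin

lemma f_analytic: "cvec_analytic_on (\<lambda>w. f w $ i) (ball \<omega> R)"
  using f by (simp add: bergman_systems_def bergman_space_def)

lemma indicator_affine: "indicator (ball \<omega> R) (\<omega> + R *\<^sub>R y) = (indicator (ball 0 1) y :: real)"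
  using R by (simp add: indicator_def dist_norm)

lemma affine_in_ball: "\<omega> + R *\<^sub>R y \<in> ball \<omega> R \<longleftrightarrow> norm y < 1"
  using R by (simp add: dist_norm)

lemma F_analytic: "cvec_analytic_on (\<lambda>w. F w $ i) (ball 0 1)"
  unfolding cvec_analytic_on_def
proof (intro conjI ballI)
  fix z :: "complex^'n" assume "z \<in> ball 0 1"
  hence "\<omega> + R *\<^sub>R z \<in> ball \<omega> R" by (simp only: affine_in_ball mem_ball_0)
  then obtain L where L: "((\<lambda>w. f w $ i) has_derivative L) (at (\<omega> + R *\<^sub>R z))" "\<And>c v. L (c *s v) = c * L v"
    using f_analytic[of i] unfolding cvec_analytic_on_def by blast
  have "((\<lambda>y. \<omega> + R *\<^sub>R y) has_derivative (\<lambda>v. R *\<^sub>R v)) (at z)"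
    by (auto intro!: derivative_eq_intros)
  from diff_chain_at[OF this L(1)] have "((\<lambda>w. F w $ i) has_derivative (\<lambda>v. L (R *\<^sub>R v))) (at z)"
    by (simp add: o_def F_def)
  thus "\<exists>L. ((\<lambda>w. F w $ i) has_derivative L) (at z) \<and> (\<forall>c v. L (c *s v) = c * L v)"
    by (intro exI[of _ "\<lambda>v. L (R *\<^sub>R v)"]) (simp add: scaleR_eq_vector_smult L(2) mult_ac del: vector_smult_assoc)
qed simp

lemma f_integrable_sq: "integrable lborel (\<lambda>z. indicator (ball \<omega> R) z *\<^sub>R (f z $ i * cnj (f z $ i)))"
proof -
  have "integrable lborel (\<lambda>z. indicator (ball \<omega> R) z *\<^sub>R (cmod (f z $ i))\<^sup>2)"
    using f by (simp add: bergman_systems_def bergman_space_def set_integrable_def)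
  hence "integrable lborel (\<lambda>z. complex_of_real (indicator (ball \<omega> R) z *\<^sub>R (cmod (f z $ i))\<^sup>2))"
    by (rule integrable_of_real)
  thus ?thesis
    by (simp add: complex_norm_square[symmetric] scaleR_conv_of_real)
qed

lemma F_integrable_sq: "set_integrable lborel (ball 0 1) (\<lambda>w. F w $ i * cnj (F w $ i))"
  using lborel_integrable_affine[OF f_integrable_sq, of R \<omega> i] R
  by (simp only: indicator_affine set_integrable_def F_def)

text \<open>The ball has finite measure and r <= 1 + r^2.\<close>

lemma F_integrable: "set_integrable lborel (ball 0 1) (\<lambda>w. F w $ i)"
  unfolding set_integrable_def
proof (rule Bochner_Integration.integrable_bound)
  have "set_integrable lborel (ball (0 :: complex^'n) 1) (\<lambda>_. 1 :: complex)"
    by (intro set_integrable_continuous continuous_intros)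
  from set_integral_add(1)[OF this F_integrable_sq]
  show "integrable lborel (\<lambda>x. indicator (ball 0 1) x *\<^sub>R (1 + F x $ i * cnj (F x $ i)))"
    by (simp add: set_integrable_def)
  have "continuous_on (ball 0 1) (\<lambda>w. F w $ i)"
    by (rule cvec_analytic_on_continuous[OF F_analytic])
  hence "(\<lambda>x. indicator (ball 0 1) x *\<^sub>R F x $ i) \<in> borel_measurable borel"
    by (intro borel_measurable_continuous_on_indicator) auto
  thus "(\<lambda>x. indicator (ball 0 1) x *\<^sub>R F x $ i) \<in> borel_measurable lborel"
    by simp
  show "AE x in lborel. norm (indicator (ball 0 1) x *\<^sub>R F x $ i)
      \<le> norm (indicator (ball 0 1) x *\<^sub>R (1 + F x $ i * cnj (F x $ i)))"
  proof (intro always_eventually allI)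
    fix x
    let ?r = "cmod (F x $ i)"
    have "?r \<le> 1 + ?r\<^sup>2" using sum_squares_ge_zero[of "?r - 1" ?r] by (simp add: power2_eq_square algebra_simps)
    moreover have "1 + F x $ i * cnj (F x $ i) = of_real (1 + ?r\<^sup>2)"
      by (simp only: complex_norm_square[symmetric] of_real_add of_real_1)
    hence "cmod (1 + F x $ i * cnj (F x $ i)) = 1 + ?r\<^sup>2" by (simp only: norm_of_real) simp
    ultimately show "norm (indicator (ball 0 1) x *\<^sub>R F x $ i)
      \<le> norm (indicator (ball 0 1) x *\<^sub>R (1 + F x $ i * cnj (F x $ i)))"
      by (simp add: indicator_def)
  qed
qed


text \<open>The Jacobian R^(2n) cancels the weight in the Bergman inner product.\<close>

lemma l2sq_F: "l2sq (\<lambda>w. F w $ i) = (bergman_norm \<omega> R (\<lambda>z. f z $ i))\<^sup>2"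
proof -
  let ?n = "CARD('n)"
  let ?g = "\<lambda>z. indicator (ball \<omega> R) z *\<^sub>R (f z $ i * cnj (f z $ i))"
  have "(LINT z:ball \<omega> R|lborel. f z $ i * cnj (f z $ i)) = \<bar>R\<bar> ^ DIM(complex^'n) *\<^sub>R (LINT x|lborel. ?g (\<omega> + R *\<^sub>R x))"
    unfolding set_lebesgue_integral_def
    by (rule lborel_integral_affine) (use R borel_measurable_integrable[OF f_integrable_sq] in auto)
  also have "(LINT x|lborel. ?g (\<omega> + R *\<^sub>R x)) = (LINT w:ball 0 1|lborel. F w $ i * cnj (F w $ i))"
    by (simp only: indicator_affine set_lebesgue_integral_def F_def)
  finally have "bergman_inner \<omega> R (\<lambda>z. f z $ i) (\<lambda>z. f z $ i) = ball_mean (\<lambda>w. F w $ i * cnj (F w $ i))"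
    using R by (simp add: bergman_inner_def ball_mean_def scaleR_conv_of_real mult.commute[of _ 2])
  moreover have "l2sq (\<lambda>w. F w $ i) \<ge> 0"
    unfolding l2sq_def by (rule ball_mean_Re_nonneg[OF _ F_integrable_sq]) (simp add: complex_mult_cnj)
  ultimately show ?thesis by (simp add: bergman_norm_def l2sq_def)
qed

interpretation F: unit_system F
  by unfold_locales (rule F_analytic F_integrable F_integrable_sq)+

lemma S_F: "F.S = system_norm \<omega> R f"
  by (simp add: F.S_def system_norm_def l2sq_F)

text \<open>Uniqueness of derivatives identifies the kernel integral with the matrix of Newton's
  method; the chain rule supplies the factor \<open>R\<close>.\<close>

lemma VD1_F:
  assumes "norm z < 1"
  shows "F.VD1 z v = R *\<^sub>R (Dmat f (\<omega> + R *\<^sub>R z) *v v)"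
proof (rule vector_derivative_unique_at[OF F.VD1_derivative[OF assms]])
  have L: "(f has_derivative (\<lambda>v. Dmat f (\<omega> + R *\<^sub>R z) *v v)) (at (\<omega> + R *\<^sub>R z))"
    by (rule Dmat_derivative[OF f_analytic]) (simp only: affine_in_ball assms)
  have "((\<lambda>t. \<omega> + R *\<^sub>R (z + t *\<^sub>R v)) has_derivative (\<lambda>t. t *\<^sub>R (R *\<^sub>R v))) (at 0)"
    by (auto intro!: derivative_eq_intros simp: mult.commute)
  from diff_chain_at[OF this, of f "\<lambda>v. Dmat f (\<omega> + R *\<^sub>R z) *v v"] L
  have "((\<lambda>t. F (z + t *\<^sub>R v)) has_derivative (\<lambda>t. Dmat f (\<omega> + R *\<^sub>R z) *v (t *\<^sub>R (R *\<^sub>R v)))) (at 0)"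
    by (simp add: o_def F_def)
  moreover have "Dmat f (\<omega> + R *\<^sub>R z) *v (t *\<^sub>R (R *\<^sub>R v)) = t *\<^sub>R (R *\<^sub>R (Dmat f (\<omega> + R *\<^sub>R z) *v v))" for t
    by (simp only: scaleR_eq_vector_smult vector_scalar_commute)
  ultimately show "((\<lambda>t. F (z + t *\<^sub>R v)) has_vector_derivative R *\<^sub>R (Dmat f (\<omega> + R *\<^sub>R z) *v v)) (at 0)"
    by (simp only: has_vector_derivative_def)
qed

lemma newton_estimates:
  assumes card: "CARD('n) \<ge> 2" and \<zeta>: "\<zeta> \<in> ball \<omega> R" and root: "f \<zeta> = 0"
    and u_def: "u = kappa_at \<omega> R \<zeta> * norm (x - \<zeta>)" and u: "u \<le> 178/1000"
  shows "x \<in> ball \<omega> R" (is ?in)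
    and "norm (Dmat f x *v w - Dmat f \<zeta> *v w)
      \<le> lambda_at \<omega> R f \<zeta> * kappa_at \<omega> R \<zeta> * (1 / (1 - u)\<^sup>2 - 1) * norm w" (is ?var)
    and "norm (Dmat f x *v (x - \<zeta>) - f x)
      \<le> lambda_at \<omega> R f \<zeta> * kappa_at \<omega> R \<zeta> * (u / (1 - u)\<^sup>2) * norm (x - \<zeta>)" (is ?res)
proof -
  define z where "z = (1 / R) *\<^sub>R (\<zeta> - \<omega>)"
  define h where "h = (1 / R) *\<^sub>R (x - \<zeta>)"
  define \<delta> where "\<delta> = 1 - (norm z)\<^sup>2"
  define s where "s = F.N / \<delta> * norm h"
  define lam where "lam = lambda_at \<omega> R f \<zeta>"
  define \<kappa> where "\<kappa> = kappa_at \<omega> R \<zeta>"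
  have z\<zeta>: "\<omega> + R *\<^sub>R z = \<zeta>" and zx: "\<omega> + R *\<^sub>R (z + h) = x" and Rh: "R *\<^sub>R h = x - \<zeta>"
    using R by (simp_all add: z_def h_def scaleR_add_right)
  have z1: "norm z < 1" using \<zeta> by (simp only: affine_in_ball[symmetric] z\<zeta>)
  have \<delta>: "\<delta> > 0" using z1 by (simp add: \<delta>_def abs_square_less_1)
  have nu: "nu_at \<omega> R \<zeta> = norm z" using R by (simp add: nu_at_def z_def)
  have lam: "lam = F.S / sqrt (\<delta> ^ F.N)"
  proof -
    have "sqrt (\<delta> ^ F.N) = \<delta> powr ((real CARD('n) + 1) / 2)"
      using \<delta> by (simp add: powr_half_sqrt[symmetric] powr_realpow[symmetric] powr_powr F.N_def del: power_Suc) (simp add: add.commute)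
    thus ?thesis by (simp add: lam_def lambda_at_def S_F nu \<delta>_def)
  qed
  have lam0: "lam \<ge> 0" unfolding lam using F.S_nonneg \<delta> by simp
  \<comment> \<open>The quotient is the second entry of the maximum that defines \<kappa>. Together
    with the monotonicity of the majorants it allows \<open>s\<close> to be replaced by
    \<open>u\<close>.\<close>
  have k: "F.N / \<delta> / R \<le> \<kappa>"
    by (simp add: \<kappa>_def kappa_at_def nu \<delta>_def[symmetric] F.N_def mult.commute add.commute)
  have hR: "norm h = norm (x - \<zeta>) / R" using R by (simp add: h_def)
  have su: "s \<le> u"
  proof -
    have "s = F.N / \<delta> / R * norm (x - \<zeta>)" by (simp add: s_def hR)
    also have "\<dots> \<le> \<kappa> * norm (x - \<zeta>)" by (rule mult_right_mono[OF k]) simp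
    finally show ?thesis by (simp add: u_def \<kappa>_def)
  qed
  have s0: "s \<ge> 0" using \<delta> by (simp add: s_def)
  have s_le: "s \<le> 178/1000" using su u by linarith
  interpret rt: unit_root F z h \<delta> s
    by unfold_locales (use card z1 root s_le in \<open>simp_all add: F_def z\<zeta> \<delta>_def s_def\<close>)
  have in1: "norm (z + h) < 1" using rt.segment_defect(2)[of 1] by simp
  thus ?in using affine_in_ball[of "z + h"] by (simp only: zx)
  have mono: "1 / (1 - s)\<^sup>2 \<le> 1 / (1 - u)\<^sup>2"
    using su s0 u by (intro divide_left_mono power_mono mult_pos_pos zero_less_power) auto
  have one: "1 \<le> 1 / (1 - s)\<^sup>2"
    using s0 su u by (simp add: le_divide_eq abs_square_le_1)
  have "R * norm (Dmat f x *v w - Dmat f \<zeta> *v w) = norm (F.VD1 (z + h) w - F.VD1 z w)"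
    using R by (simp add: VD1_F in1 z1 z\<zeta> zx scaleR_diff_right[symmetric])
  also have "\<dots> \<le> lam * (F.N / \<delta>) * (1 / (1 - s)\<^sup>2 - 1) * norm w"
    unfolding lam by (rule rt.derivative_variation)
  also have "\<dots> \<le> lam * (R * \<kappa>) * (1 / (1 - u)\<^sup>2 - 1) * norm w"
  proof (intro mult_right_mono mult_mono order_refl)
    show "F.N / \<delta> \<le> R * \<kappa>" using k R \<delta> by (simp add: divide_le_eq mult_ac)
    thus "0 \<le> lam * (R * \<kappa>)"
      using lam0 \<delta> by (meson divide_nonneg_pos mult_nonneg_nonneg of_nat_0_le_iff order_trans)
  qed (use lam0 \<delta> mono one in auto)
  finally have "R * norm (Dmat f x *v w - Dmat f \<zeta> *v w) \<le> R * (lam * \<kappa> * (1 / (1 - u)\<^sup>2 - 1) * norm w)"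
    by (simp only: mult_ac)
  thus ?var using R by (simp only: mult_le_cancel_left_pos lam_def \<kappa>_def)
  have "F.VD1 (z + h) h = Dmat f x *v (x - \<zeta>)"
    by (simp only: VD1_F in1 zx Rh[symmetric]) (simp only: scaleR_eq_vector_smult vector_scalar_commute)
  hence "norm (Dmat f x *v (x - \<zeta>) - f x) = norm (F.VD1 (z + h) h - F (z + h))"
    by (simp only: F_def zx)
  also have "\<dots> \<le> lam * (s\<^sup>2 / (1 - s)\<^sup>2)"
    unfolding lam by (rule rt.newton_residual)
  also have "\<dots> \<le> lam * (u\<^sup>2 / (1 - u)\<^sup>2)"
    using su s0 u lam0 by (intro mult_left_mono frac_le power_mono) auto
  also have "\<dots> = lam * \<kappa> * (u / (1 - u)\<^sup>2) * norm (x - \<zeta>)"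
    by (simp add: u_def \<kappa>_def power2_eq_square mult_ac)
  finally show ?res by (simp only: lam_def \<kappa>_def)
qed

end

subsection \<open>The Newton iteration\<close>

lemma matrix_inv_mult:
  fixes A :: "complex^'n^'n"
  assumes "invertible A" shows "A ** matrix_inv A = mat 1" "matrix_inv A ** A = mat 1"
  using someI_ex[OF assms[unfolded invertible_def]] unfolding matrix_inv_def by auto

lemma matrix_inv_vector:
  fixes A :: "complex^'n^'n"
  assumes "invertible A"
  shows "A *v (matrix_inv A *v v) = v" "matrix_inv A *v (A *v v) = v"
  using matrix_inv_mult[OF assms] by (simp_all add: matrix_vector_mul_assoc)

lemma bounded_linear_matrix_vector: "bounded_linear (\<lambda>v. (A :: complex^'n^'m) *v v)"
proof -
  have "linear (\<lambda>v. A *v v)"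
    by (rule linearI) (simp_all only: matrix_vector_right_distrib scaleR_eq_vector_smult vector_scalar_commute)
  thus ?thesis by (simp only: linear_conv_bounded_linear)
qed

lemma matrix_vector_diff: "(A :: complex^'n^'m) *v (x - y) = A *v x - A *v y"
  using bounded_linear.linear[OF bounded_linear_matrix_vector] by (rule linear_diff)

text \<open>Writing y = A^-1 (B y) - A^-1 (B y - A y) bounds \<open>B\<close> from below, so
  \<open>B\<close> is injective and, the dimension being finite, invertible. The lower bound is kept
  because it applies directly to the Newton error.\<close>

lemma perturbed_inverse:
  fixes A B :: "complex^'n^'n"
  assumes A: "invertible A" and var: "\<And>w. norm (B *v w - A *v w) \<le> c * norm w"
    and \<mu>: "\<mu> = onorm (\<lambda>v. matrix_inv A *v v)" and q: "\<mu> * c \<le> q" "q < 1"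
  shows "invertible B" and "(1 - q) * norm y \<le> \<mu> * norm (B *v y)"
proof -
  have \<mu>0: "\<mu> \<ge> 0" unfolding \<mu> by (rule onorm_pos_le[OF bounded_linear_matrix_vector])
  have on: "norm (matrix_inv A *v v) \<le> \<mu> * norm v" for v
    unfolding \<mu> by (rule onorm[OF bounded_linear_matrix_vector])
  have low: "(1 - q) * norm y \<le> \<mu> * norm (B *v y)" for y
  proof -
    have "y = matrix_inv A *v (B *v y) - matrix_inv A *v (B *v y - A *v y)"
      by (simp add: matrix_vector_diff matrix_inv_vector[OF A])
    hence "norm y \<le> norm (matrix_inv A *v (B *v y)) + norm (matrix_inv A *v (B *v y - A *v y))"
      by (metis norm_triangle_ineq4)
    also have "\<dots> \<le> \<mu> * norm (B *v y) + \<mu> * (c * norm y)"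
      using on[of "B *v y"] on[of "B *v y - A *v y"] mult_left_mono[OF var[of y] \<mu>0] by linarith
    also have "\<mu> * (c * norm y) \<le> q * norm y"
      using mult_right_mono[OF q(1) norm_ge_zero[of y]] by (simp add: mult.assoc)
    finally show ?thesis by (simp add: left_diff_distrib)
  qed
  show "(1 - q) * norm y \<le> \<mu> * norm (B *v y)" by (rule low)
  have "x = 0" if "B *v x = 0" for x
  proof -
    have "(1 - q) * norm x \<le> 0" using low[of x] that by simp
    hence "norm x \<le> 0" using q(2) by (simp add: mult_le_0_iff)
    thus ?thesis by simp
  qed
  thus "invertible B"
    using matrix_left_invertible_ker[of B] by (auto simp: invertible_left_inverse)
qed

text \<open>The second inequality says that the Newton step contracts by less than 1/2. It amounts
  to (1+\<gamma>)u^2 - 2(1+2\<gamma>)u + 1 > 0, which holds below the smaller root.\<close>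

lemma radius_bounds:
  fixes \<gamma> u :: real
  assumes \<gamma>: "\<gamma> \<ge> 1" and u0: "u \<ge> 0" and u: "u < (2 * \<gamma> + 1 - sqrt (4 * \<gamma>\<^sup>2 + 3 * \<gamma>)) / (\<gamma> + 1)"
  shows "u \<le> 178/1000" and "2 * \<gamma> * u < (1 + \<gamma>) * (1 - u)\<^sup>2 - \<gamma>"
proof -
  define D where "D = sqrt (4 * \<gamma>\<^sup>2 + 3 * \<gamma>)"
  have "0 \<le> 4 * \<gamma>\<^sup>2 + 3 * \<gamma>" using \<gamma> by simp
  hence D2: "D\<^sup>2 = 4 * \<gamma>\<^sup>2 + 3 * \<gamma>" and D0: "D \<ge> 0" by (simp_all add: D_def)
  have lt: "u * (\<gamma> + 1) < 2 * \<gamma> + 1 - D" using u \<gamma> by (simp add: D_def less_divide_eq)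
  have "\<gamma>\<^sup>2 \<ge> \<gamma>" using \<gamma> by (simp add: power2_eq_square)
  \<comment> \<open>The coefficients are 2 - 178/1000 and 1 - 178/1000.\<close>
  hence "(1822/1000 * \<gamma> + 822/1000)\<^sup>2 \<le> 4 * \<gamma>\<^sup>2 + 3 * \<gamma>"
  proof -
    have "(1822/1000 * \<gamma> + 822/1000)\<^sup>2 = 3319684/1000000 * \<gamma>\<^sup>2 + 2995368/1000000 * \<gamma> + 675684/1000000"
      by (simp add: power2_eq_square algebra_simps)
    thus ?thesis using \<open>\<gamma>\<^sup>2 \<ge> \<gamma>\<close> \<gamma> by linarith
  qed
  hence "1822/1000 * \<gamma> + 822/1000 \<le> D" unfolding D_def by (rule real_le_rsqrt)
  with lt have "u * (\<gamma> + 1) \<le> 178/1000 * (\<gamma> + 1)" by (simp add: algebra_simps)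
  thus "u \<le> 178/1000" by (rule mult_right_le_imp_le) (use \<gamma> in simp)
  have "D < 2 * \<gamma> + 1 - u * (\<gamma> + 1)" using lt by simp
  hence "D\<^sup>2 < (2 * \<gamma> + 1 - u * (\<gamma> + 1))\<^sup>2" using D0 by (intro power_strict_mono) auto
  hence "0 < (\<gamma> + 1) * ((1 + \<gamma>) * (1 - u)\<^sup>2 - \<gamma> - 2 * \<gamma> * u)"
    unfolding D2 by (simp add: power2_eq_square algebra_simps)
  thus "2 * \<gamma> * u < (1 + \<gamma>) * (1 - u)\<^sup>2 - \<gamma>" using \<gamma> by (simp add: zero_less_mult_iff)
qed

text \<open>The matrix \<open>Dmat f x\<close> maps the new error to the residual
  \<open>Dmat f x *v (x - \<zeta>) - f x\<close>. With r = (1-u)^2 and q = \<gamma>(1/r - 1), the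
  lower bound 1 - q of \<open>perturbed_inverse\<close> becomes (1+\<gamma>)r - \<gamma> after
  multiplication by \<open>r\<close>, so no division is left.\<close>

lemma newton_step:
  fixes \<omega> \<zeta> x :: "complex^'n" and R \<gamma> u :: real
  assumes card: "CARD('n) \<ge> 2" and R: "R > 0" and \<zeta>: "\<zeta> \<in> ball \<omega> R" and f: "f \<in> bergman_systems \<omega> R"
    and root: "f \<zeta> = 0" and inv: "invertible (Dmat f \<zeta>)"
    and \<gamma>: "\<gamma> = gamma_at \<omega> R f \<zeta>" and u_def: "u = kappa_at \<omega> R \<zeta> * norm (x - \<zeta>)"
    and u: "u < (2 * \<gamma> + 1 - sqrt (4 * \<gamma>\<^sup>2 + 3 * \<gamma>)) / (\<gamma> + 1)"
  shows "x \<in> ball \<omega> R" and "invertible (Dmat f x)"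
    and "((1 + \<gamma>) * (1 - u)\<^sup>2 - \<gamma>) * norm (newton_op f x - \<zeta>) \<le> \<gamma> * u * norm (x - \<zeta>)"
proof -
  define c where "c = lambda_at \<omega> R f \<zeta> * kappa_at \<omega> R \<zeta>"
  define \<mu> where "\<mu> = onorm (\<lambda>v. matrix_inv (Dmat f \<zeta>) *v v)"
  have \<mu>0: "\<mu> \<ge> 0" unfolding \<mu>_def by (rule onorm_pos_le[OF bounded_linear_matrix_vector])
  have \<gamma>1: "\<gamma> \<ge> 1" and c\<mu>: "\<mu> * c \<le> \<gamma>"
    by (simp_all add: \<gamma> gamma_at_def mu_at_def c_def \<mu>_def mult.commute)
  have "kappa_at \<omega> R \<zeta> \<ge> 1" by (simp add: kappa_at_def)
  hence u0: "u \<ge> 0" by (simp add: u_def)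
  note rb = radius_bounds[OF \<gamma>1 u0 u]
  note ne = newton_estimates[OF R f card \<zeta> root u_def rb(1), folded c_def]
  show "x \<in> ball \<omega> R" by (rule ne(1))
  define r where "r = (1 - u)\<^sup>2"
  have r: "0 < r" "r \<le> 1" using u0 rb(1) by (auto simp: r_def abs_square_le_1)
  define q where "q = \<gamma> * (1 / r - 1)"
  have "\<gamma> < (1 + \<gamma>) * r" using rb(2) u0 \<gamma>1 mult_nonneg_nonneg[of \<gamma> u] unfolding r_def by linarith
  hence q1: "q < 1" using r by (simp add: q_def field_simps)
  have "\<mu> * (c * (1 / r - 1)) \<le> q"
    unfolding q_def mult.assoc[symmetric] using c\<mu> r by (intro mult_right_mono) auto
  note pi = perturbed_inverse[OF inv ne(2)[folded r_def] \<mu>_def this q1]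
  show iB: "invertible (Dmat f x)" by (rule pi(1))
  define y where "y = newton_op f x - \<zeta>"
  have "y = (x - \<zeta>) - matrix_inv (Dmat f x) *v f x" by (simp add: y_def newton_op_def)
  hence By: "Dmat f x *v y = Dmat f x *v (x - \<zeta>) - f x"
    by (simp add: matrix_vector_diff matrix_inv_vector[OF iB])
  have "(1 - q) * norm y \<le> \<mu> * norm (Dmat f x *v y)" by (rule pi(2))
  also have "\<dots> \<le> \<mu> * (c * (u / r) * norm (x - \<zeta>))"
    unfolding By by (rule mult_left_mono[OF ne(3)[folded r_def] \<mu>0])
  also have "\<dots> = (\<mu> * c) * (u / r * norm (x - \<zeta>))" by simp
  also have "\<dots> \<le> \<gamma> * (u / r * norm (x - \<zeta>))"
    using c\<mu> u0 r by (intro mult_right_mono) auto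
  finally have "r * ((1 - q) * norm y) \<le> r * (\<gamma> * (u / r * norm (x - \<zeta>)))"
    using r by (intro mult_left_mono) auto
  moreover have "r * ((1 - q) * norm y) = ((1 + \<gamma>) * r - \<gamma>) * norm y"
    using r by (simp add: q_def field_simps)
  moreover have "r * (\<gamma> * (u / r * norm (x - \<zeta>))) = \<gamma> * u * norm (x - \<zeta>)"
    using r by simp
  ultimately show "((1 + \<gamma>) * (1 - u)\<^sup>2 - \<gamma>) * norm (newton_op f x - \<zeta>) \<le> \<gamma> * u * norm (x - \<zeta>)"
    by (simp only: r_def y_def)
qed

theorem mainTheorem6:
  fixes \<omega> \<zeta> x :: "complex^'n"
    and R \<gamma> \<kappa> u :: real
    and f :: "complex^'n \<Rightarrow> complex^'n"
  assumes "CARD('n) \<ge> 2"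
    and "R > 0"
    and "\<zeta> \<in> ball \<omega> R"
    and "f \<in> bergman_systems \<omega> R"
    and "f \<zeta> = 0"
    and "invertible (Dmat f \<zeta>)"
    and "\<gamma> = gamma_at \<omega> R f \<zeta>"
    and "\<kappa> = kappa_at \<omega> R \<zeta>"
    and "u = \<kappa> * norm (x - \<zeta>)"
    and "u < (2 * \<gamma> + 1 - sqrt (4 * \<gamma>\<^sup>2 + 3 * \<gamma>)) / (\<gamma> + 1)"
  shows "(\<forall>k. (newton_op f ^^ k) x \<in> ball \<omega> R \<and> invertible (Dmat f ((newton_op f ^^ k) x))) \<and>
    (\<lambda>k. (newton_op f ^^ k) x) \<longlonglongrightarrow> \<zeta> \<and>
    (\<forall>k. norm ((newton_op f ^^ k) x - \<zeta>) \<le> (1 / 2) ^ (2 ^ k - 1) * norm (x - \<zeta>))"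
proof -
  define X where "X k = (newton_op f ^^ k) x" for k
  define e where "e k = norm (X k - \<zeta>)" for k
  have \<gamma>1: "\<gamma> \<ge> 1" by (simp add: assms(7) gamma_at_def)
  have \<kappa>1: "\<kappa> \<ge> 1" by (simp add: assms(8) kappa_at_def)
  have u0: "u \<ge> 0" using \<kappa>1 by (simp add: assms(9))
  have ue: "u = \<kappa> * e 0" by (simp add: assms(9) e_def X_def)
  note rb = radius_bounds[OF \<gamma>1 u0 assms(10)]
  have step: "X k \<in> ball \<omega> R \<and> invertible (Dmat f (X k)) \<and> 
      ((1 + \<gamma>) * (1 - \<kappa> * e k)\<^sup>2 - \<gamma>) * e (Suc k) \<le> \<gamma> * (\<kappa> * e k) * e k"
    if "\<kappa> * e k \<le> u" for k
  proof -
    have lt: "\<kappa> * e k < (2 * \<gamma> + 1 - sqrt (4 * \<gamma>\<^sup>2 + 3 * \<gamma>)) / (\<gamma> + 1)"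
      using that assms(10) by linarith
    have "\<kappa> * e k = kappa_at \<omega> R \<zeta> * norm (X k - \<zeta>)" by (simp add: assms(8) e_def)
    from newton_step[OF assms(1-7) this lt] show ?thesis
      by (simp add: e_def X_def)
  qed
  have bound: "e k \<le> (1 / 2) ^ (2 ^ k - 1) * e 0" for k
  proof (induction k)
    case (Suc k)
    define b where "b = (1 / 2 :: real) ^ (2 ^ k - 1)"
    have b: "0 \<le> b" "b \<le> 1" by (simp_all add: b_def power_le_one)
    have e0: "e j \<ge> 0" for j by (simp add: e_def)
    have eb: "e k \<le> b * e 0" using Suc by (simp add: b_def)
    hence kb: "\<kappa> * e k \<le> b * u"
      using \<kappa>1 mult_left_mono[OF eb, of \<kappa>] by (simp add: ue mult_ac)
    also have "\<dots> \<le> u" using b u0 by (simp add: mult_left_le_one_le)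
    finally have ku: "\<kappa> * e k \<le> u" .
    have "(1 - u)\<^sup>2 \<le> (1 - \<kappa> * e k)\<^sup>2" using ku rb(1) by (intro power_mono) auto
    hence "(1 + \<gamma>) * (1 - u)\<^sup>2 \<le> (1 + \<gamma>) * (1 - \<kappa> * e k)\<^sup>2" using \<gamma>1 by (intro mult_left_mono) auto
    \<comment> \<open>The coefficient of the new error is bounded at every step by its value at the
      starting point, so the rate is not lost while the error shrinks.\<close>
    hence G: "2 * \<gamma> * u \<le> (1 + \<gamma>) * (1 - \<kappa> * e k)\<^sup>2 - \<gamma>" "0 < (1 + \<gamma>) * (1 - \<kappa> * e k)\<^sup>2 - \<gamma>"
      using rb(2) mult_nonneg_nonneg[of \<gamma> u] u0 \<gamma>1 by linarith+
    note st = step[OF ku, THEN conjunct2, THEN conjunct2]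
    have "e (Suc k) \<le> 1 / 2 * (b * (b * e 0))"
    \<comment> \<open>The general case cancels 2\<gamma>u; for \<open>u = 0\<close> the iteration
      already starts at \<zeta>.\<close>
    proof (cases "u = 0")
      case True
      hence z: "e 0 = 0" using \<kappa>1 by (simp add: ue)
      hence "e k = 0" using eb e0[of k] by simp
      hence "((1 + \<gamma>) * (1 - \<kappa> * e k)\<^sup>2 - \<gamma>) * e (Suc k) \<le> 0" using st by simp
      hence "e (Suc k) \<le> 0" using G(2) by (simp add: mult_le_0_iff)
      thus ?thesis using z by simp
    next
      case False
      have "2 * \<gamma> * u * e (Suc k) \<le> \<gamma> * (\<kappa> * e k) * e k"
        using mult_right_mono[OF G(1) e0[of "Suc k"]] st by linarith
      also have "\<dots> \<le> \<gamma> * (b * u) * (b * e 0)"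
        by (rule mult_mono[OF mult_left_mono[OF kb] eb]) (use e0 b u0 \<gamma>1 \<kappa>1 in auto)
      also have "\<dots> = 2 * \<gamma> * u * (1 / 2 * (b * (b * e 0)))" by simp
      finally show ?thesis using False u0 \<gamma>1 by (simp add: mult_le_cancel_left_pos)
    qed
    also have "1 / 2 * (b * (b * e 0)) = (1 / 2) ^ (2 ^ Suc k - 1) * e 0"
    proof -
      \<comment> \<open>The old exponent is doubled by squaring, and the factor 1/2 of the step adds
        one.\<close>
      have "(2::nat) ^ Suc k - 1 = Suc ((2 ^ k - 1) + (2 ^ k - 1))"
        by (cases "(2::nat) ^ k") auto
      thus ?thesis by (simp only: b_def power_Suc power_add mult.assoc)
    qed
    finally show ?case .
  qed simp
  \<comment> \<open>Convergence needs only the geometric rate.\<close>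
  have small: "(1 / 2 :: real) ^ (2 ^ k - 1) \<le> (1 / 2) ^ k" for k :: nat
  proof (rule power_decreasing)
    have "k < 2 ^ k" by (rule less_exp)
    thus "k \<le> 2 ^ k - 1" by linarith
  qed auto
  have ke: "\<kappa> * e k \<le> u" for k
  proof -
    have "e k \<le> 1 * e 0"
      using bound[of k] by (rule order_trans) (intro mult_right_mono power_le_one, auto simp: e_def)
    thus ?thesis using \<kappa>1 by (simp add: ue)
  qed
  have "(\<lambda>k. (1 / 2) ^ k * e 0) \<longlonglongrightarrow> 0"
    by (intro tendsto_mult_left_zero LIMSEQ_power_zero) simp
  moreover have "\<forall>\<^sub>F k in sequentially. norm (X k - \<zeta>) \<le> (1 / 2) ^ k * e 0"
  proof (intro always_eventually allI)
    fix k
    have "(1 / 2) ^ (2 ^ k - 1) * e 0 \<le> (1 / 2) ^ k * e 0"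
      by (intro mult_right_mono small) (simp add: e_def)
    thus "norm (X k - \<zeta>) \<le> (1 / 2) ^ k * e 0" using bound[of k] by (simp add: e_def)
  qed
  ultimately have "(\<lambda>k. X k - \<zeta>) \<longlonglongrightarrow> 0" by (rule Lim_null_comparison[rotated])
  hence "X \<longlonglongrightarrow> \<zeta>" by (simp add: LIM_zero_iff)
  thus ?thesis using step[OF ke] bound by (simp add: X_def[abs_def] e_def)
qed

end
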